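(* Let $\Omega\subset\mathbb{R}^N$ ($N=2,3$) be a bounded domain with almost everywhere $C^2$ boundary, let $p\in[1,2]$, $\varepsilon>0$, $\sigma>0$, $\eta>0$, and let $u_0\in H^2(\Omega)$. Then there is $T_0>0$, depending on $\|u_0\|_{H^1(\Omega)}$, $G_\sigma$ and $\Omega$ (and on the fixed parameters $p,\varepsilon,\eta,N$), such that for every $T\in(0,T_0)$ the problem $$\begin{cases} u_{tt}+\eta u_t-\operatorname{div}\big((\varepsilon+|\nabla G_\sigma\star u|^2)^{\frac{p-2}{2}}\nabla u\big)=0 & \text{in }(0,T)\times\Omega,\\ u(x,0)=u_0(x),\quad u_t(x,0)=0 & \text{in }\Omega,\\ \partial_n u=0 & \text{on }\partial\Omega\end{cases}$$ has a unique weak solution $u\in\mathcal{U}$.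
   Context: $G_\sigma(x)=(2\pi\sigma)^{-N/2}e^{-|x|^2/(2\sigma)}$; $|\nabla G_\sigma\star u|=\big(\sum_{j=1}^N(\tfrac{\partial G_\sigma}{\partial x_j}\star u)^2\big)^{1/2}$; $n$ is the outward unit normal. The solution space $\mathcal{U}$ consists of $u\in L^\infty(0,T;H^1(\Omega))$ whose distributional time derivatives satisfy $u'\in L^\infty(0,T;L^2(\Omega))$ and $u''\in L^\infty(0,T;H^1(\Omega)^* )$, with norm $\|u\|_{L^\infty(0,T;H^1)}+\|u'\|_{L^\infty(0,T;L^2)}+\|u''\|_{L^\infty(0,T;(H^1)^* )}$. A weak solution is $u\in\mathcal{U}$ satisfying the problem for a.e. $t$ with derivatives in the sense of distributions, i.e. $\langle u_{tt},\varphi\rangle_{(H^1)^*\times H^1}+\int_\Omega\big(\eta u_t\varphi+(\varepsilon+|\nabla G_\sigma\star u|^2)^{\frac{p-2}{2}}\nabla u\cdot\nabla\varphi\big)dx=0$ for all $\varphi\in H^1(\Omega)$ and a.e. $t\in(0,T)$, together with the initial conditions. *)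

theory Defs
  imports "HOL-Analysis.Analysis"
begin

definition pd :: "'n::finite \<Rightarrow> (real^'n \<Rightarrow> real) \<Rightarrow> real^'n \<Rightarrow> real" where
  "pd j f x = frechet_derivative f (at x) (axis j 1)"

definition C1_on :: "(real^'n::finite) set \<Rightarrow> (real^'n \<Rightarrow> real) \<Rightarrow> bool" where
  "C1_on S f \<longleftrightarrow> (\<forall>x\<in>S. f differentiable (at x)) \<and> (\<forall>j. continuous_on S (pd j f))"

definition C2_on :: "(real^'n::finite) set \<Rightarrow> (real^'n \<Rightarrow> real) \<Rightarrow> bool" where
  "C2_on S f \<longleftrightarrow> C1_on S f \<and> (\<forall>j. C1_on S (pd j f))"

definition test_fun :: "(real^'n::finite) set \<Rightarrow> (real^'n \<Rightarrow> real) \<Rightarrow> bool" where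
  "test_fun \<Omega> \<phi> \<longleftrightarrow> C1_on UNIV \<phi> \<and> compact (closure {x. \<phi> x \<noteq> 0}) \<and>
     closure {x. \<phi> x \<noteq> 0} \<subseteq> \<Omega>"

definition C2_boundary_point :: "(real^'n::finite) set \<Rightarrow> real^'n \<Rightarrow> bool" where
  "C2_boundary_point \<Omega> x \<longleftrightarrow> (\<exists>r>0. \<exists>\<psi>. C2_on (ball x r) \<psi> \<and>
      (\<forall>y\<in>ball x r. \<exists>j. pd j \<psi> y \<noteq> 0) \<and>
      \<Omega> \<inter> ball x r = {y \<in> ball x r. \<psi> y < 0})"

definition hausdorff_null :: "nat \<Rightarrow> ('a::metric_space) set \<Rightarrow> bool" where
  "hausdorff_null d S \<longleftrightarrow> (\<forall>\<delta>>0. \<exists>C :: nat \<Rightarrow> 'a set.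
      S \<subseteq> (\<Union>i. C i) \<and> (\<forall>i. bounded (C i)) \<and>
      summable (\<lambda>i. diameter (C i) ^ d) \<and> (\<Sum>i. diameter (C i) ^ d) < \<delta>)"

definition ae_C2_boundary :: "(real^'n::finite) set \<Rightarrow> bool" where
  "ae_C2_boundary \<Omega> \<longleftrightarrow>
     hausdorff_null (CARD('n) - 1) {x \<in> frontier \<Omega>. \<not> C2_boundary_point \<Omega> x}"

definition bounded_domain :: "(real^'n::finite) set \<Rightarrow> bool" where
  "bounded_domain \<Omega> \<longleftrightarrow> open \<Omega> \<and> connected \<Omega> \<and> bounded \<Omega> \<and> \<Omega> \<noteq> {}"

definition L2 :: "(real^'n::finite) set \<Rightarrow> (real^'n \<Rightarrow> real) \<Rightarrow> bool" where
  "L2 \<Omega> f \<longleftrightarrow> f \<in> borel_measurable (lebesgue_on \<Omega>) \<and>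
     integrable (lebesgue_on \<Omega>) (\<lambda>x. (f x)\<^sup>2)"

definition L2_norm :: "(real^'n::finite) set \<Rightarrow> (real^'n \<Rightarrow> real) \<Rightarrow> real" where
  "L2_norm \<Omega> f = sqrt (LINT x|lebesgue_on \<Omega>. (f x)\<^sup>2)"

definition weak_deriv :: "(real^'n::finite) set \<Rightarrow> 'n \<Rightarrow> (real^'n \<Rightarrow> real) \<Rightarrow> (real^'n \<Rightarrow> real) \<Rightarrow> bool" where
  "weak_deriv \<Omega> j f g \<longleftrightarrow> (\<forall>\<phi>. test_fun \<Omega> \<phi> \<longrightarrow>
     (LINT x|lebesgue_on \<Omega>. f x * pd j \<phi> x) = - (LINT x|lebesgue_on \<Omega>. g x * \<phi> x))"

definition H1 :: "(real^'n::finite) set \<Rightarrow> (real^'n \<Rightarrow> real) \<Rightarrow> bool" where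
  "H1 \<Omega> f \<longleftrightarrow> L2 \<Omega> f \<and> (\<forall>j. \<exists>g. L2 \<Omega> g \<and> weak_deriv \<Omega> j f g)"

definition wpd :: "(real^'n::finite) set \<Rightarrow> 'n \<Rightarrow> (real^'n \<Rightarrow> real) \<Rightarrow> real^'n \<Rightarrow> real" where
  "wpd \<Omega> j f = (SOME g. L2 \<Omega> g \<and> weak_deriv \<Omega> j f g)"

definition H2 :: "(real^'n::finite) set \<Rightarrow> (real^'n \<Rightarrow> real) \<Rightarrow> bool" where
  "H2 \<Omega> f \<longleftrightarrow> H1 \<Omega> f \<and> (\<forall>j. H1 \<Omega> (wpd \<Omega> j f))"

definition H1_norm :: "(real^'n::finite) set \<Rightarrow> (real^'n \<Rightarrow> real) \<Rightarrow> real" where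
  "H1_norm \<Omega> f = sqrt ((LINT x|lebesgue_on \<Omega>. (f x)\<^sup>2) +
      (LINT x|lebesgue_on \<Omega>. (\<Sum>j\<in>UNIV. (wpd \<Omega> j f x)\<^sup>2)))"

definition grad_dot :: "(real^'n::finite) set \<Rightarrow> (real^'n \<Rightarrow> real) \<Rightarrow> (real^'n \<Rightarrow> real) \<Rightarrow> real^'n \<Rightarrow> real" where
  "grad_dot \<Omega> f g x = (\<Sum>j\<in>UNIV. wpd \<Omega> j f x * wpd \<Omega> j g x)"

definition H1_dual :: "(real^'n::finite) set \<Rightarrow> ((real^'n \<Rightarrow> real) \<Rightarrow> real) \<Rightarrow> bool" where
  "H1_dual \<Omega> L \<longleftrightarrow>
     (\<forall>v1 v2 a b. H1 \<Omega> v1 \<longrightarrow> H1 \<Omega> v2 \<longrightarrow> L (\<lambda>x. a * v1 x + b * v2 x) = a * L v1 + b * L v2) \<and>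
     (\<exists>C. \<forall>v. H1 \<Omega> v \<longrightarrow> \<bar>L v\<bar> \<le> C * H1_norm \<Omega> v)"

definition gauss :: "real \<Rightarrow> real^'n::finite \<Rightarrow> real" where
  "gauss \<sigma> x = (2 * pi * \<sigma>) powr (- real CARD('n) / 2) * exp (- (norm x)\<^sup>2 / (2 * \<sigma>))"

text \<open>(dG_sigma/dx_j * f)(x), with f extended by zero outside Omega.\<close>
definition conv_dgauss :: "real \<Rightarrow> (real^'n::finite) set \<Rightarrow> 'n \<Rightarrow> (real^'n \<Rightarrow> real) \<Rightarrow> real^'n \<Rightarrow> real" where
  "conv_dgauss \<sigma> \<Omega> j f x = (LINT y|lebesgue_on \<Omega>. pd j (gauss \<sigma>) (x - y) * f y)"

definition coef :: "real \<Rightarrow> real \<Rightarrow> real \<Rightarrow> (real^'n::finite) set \<Rightarrow> (real^'n \<Rightarrow> real) \<Rightarrow> real^'n \<Rightarrow> real" where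
  "coef p \<epsilon> \<sigma> \<Omega> f x = (\<epsilon> + (\<Sum>j\<in>UNIV. (conv_dgauss \<sigma> \<Omega> j f x)\<^sup>2)) powr ((p - 2) / 2)"

definition time_test :: "real \<Rightarrow> (real \<Rightarrow> real) \<Rightarrow> (real \<Rightarrow> real) \<Rightarrow> bool" where
  "time_test T \<psi> \<psi>' \<longleftrightarrow> (\<forall>t. (\<psi> has_real_derivative \<psi>' t) (at t)) \<and> continuous_on UNIV \<psi>' \<and>
     (\<exists>\<delta>>0. \<forall>t\<ge>T - \<delta>. \<psi> t = 0)"

definition weak_dt_init :: "real \<Rightarrow> (real \<Rightarrow> real) \<Rightarrow> (real \<Rightarrow> real) \<Rightarrow> real \<Rightarrow> bool" where
  "weak_dt_init T a b a0 \<longleftrightarrow> (\<forall>\<psi> \<psi>'. time_test T \<psi> \<psi>' \<longrightarrow>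
     (LINT t|lebesgue_on {0<..<T}. a t * \<psi>' t) =
       - a0 * \<psi> 0 - (LINT t|lebesgue_on {0<..<T}. b t * \<psi> t))"

text \<open>u in L^infty(0,T;H^1(Omega)) (strong measurability expressed via Pettis' theorem
  as weak measurability against the dual of H^1).\<close>
definition Linf_H1 :: "real \<Rightarrow> (real^'n::finite) set \<Rightarrow> (real \<Rightarrow> real^'n \<Rightarrow> real) \<Rightarrow> bool" where
  "Linf_H1 T \<Omega> u \<longleftrightarrow>
     (AE t in lebesgue_on {0<..<T}. H1 \<Omega> (u t)) \<and>
     (\<forall>v. L2 \<Omega> v \<longrightarrow> (\<lambda>t. LINT x|lebesgue_on \<Omega>. u t x * v x) \<in> borel_measurable (lebesgue_on {0<..<T})) \<and>
     (\<forall>v j. L2 \<Omega> v \<longrightarrow> (\<lambda>t. LINT x|lebesgue_on \<Omega>. wpd \<Omega> j (u t) x * v x) \<in> borel_measurable (lebesgue_on {0<..<T})) \<and>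
     (\<exists>M. AE t in lebesgue_on {0<..<T}. H1_norm \<Omega> (u t) \<le> M)"

definition Linf_L2 :: "real \<Rightarrow> (real^'n::finite) set \<Rightarrow> (real \<Rightarrow> real^'n \<Rightarrow> real) \<Rightarrow> bool" where
  "Linf_L2 T \<Omega> w \<longleftrightarrow>
     (AE t in lebesgue_on {0<..<T}. L2 \<Omega> (w t)) \<and>
     (\<forall>v. L2 \<Omega> v \<longrightarrow> (\<lambda>t. LINT x|lebesgue_on \<Omega>. w t x * v x) \<in> borel_measurable (lebesgue_on {0<..<T})) \<and>
     (\<exists>M. AE t in lebesgue_on {0<..<T}. L2_norm \<Omega> (w t) \<le> M)"

definition Linf_H1dual :: "real \<Rightarrow> (real^'n::finite) set \<Rightarrow> (real \<Rightarrow> (real^'n \<Rightarrow> real) \<Rightarrow> real) \<Rightarrow> bool" where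
  "Linf_H1dual T \<Omega> z \<longleftrightarrow>
     (AE t in lebesgue_on {0<..<T}. H1_dual \<Omega> (z t)) \<and>
     (\<forall>v. H1 \<Omega> v \<longrightarrow> (\<lambda>t. z t v) \<in> borel_measurable (lebesgue_on {0<..<T})) \<and>
     (\<exists>M. AE t in lebesgue_on {0<..<T}. \<forall>v. H1 \<Omega> v \<longrightarrow> \<bar>z t v\<bar> \<le> M * H1_norm \<Omega> v)"

text \<open>u is a weak solution in the space U on (0,T): u in L^infty(H^1) with u' = w in
  L^infty(L^2) and u'' = z in L^infty((H^1)^*), distributional time derivatives,
  u(0) = u0, u_t(0) = 0 (initial data encoded in the weak time-derivative identities),
  and the variational equation holds for a.e. t and all test functions phi in H^1.\<close>
definition weak_solution ::
  "(real^'n::finite) set \<Rightarrow> real \<Rightarrow> real \<Rightarrow> real \<Rightarrow> real \<Rightarrow> (real^'n \<Rightarrow> real) \<Rightarrow> real \<Rightarrow>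
   (real \<Rightarrow> real^'n \<Rightarrow> real) \<Rightarrow> bool" where
  "weak_solution \<Omega> p \<epsilon> \<sigma> \<eta> u0 T u \<longleftrightarrow>
    (\<exists>w z. Linf_H1 T \<Omega> u \<and> Linf_L2 T \<Omega> w \<and> Linf_H1dual T \<Omega> z \<and>
      (\<forall>v. L2 \<Omega> v \<longrightarrow>
         weak_dt_init T (\<lambda>t. LINT x|lebesgue_on \<Omega>. u t x * v x)
                        (\<lambda>t. LINT x|lebesgue_on \<Omega>. w t x * v x)
                        (LINT x|lebesgue_on \<Omega>. u0 x * v x)) \<and>
      (\<forall>v. H1 \<Omega> v \<longrightarrow>
         weak_dt_init T (\<lambda>t. LINT x|lebesgue_on \<Omega>. w t x * v x) (\<lambda>t. z t v) 0) \<and>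
      (AE t in lebesgue_on {0<..<T}. \<forall>\<phi>. H1 \<Omega> \<phi> \<longrightarrow>
         z t \<phi> + (LINT x|lebesgue_on \<Omega>.
            \<eta> * w t x * \<phi> x + coef p \<epsilon> \<sigma> \<Omega> (u t) x * grad_dot \<Omega> (u t) \<phi> x) = 0))"

end

(* Write the equation as an abstract wave equation f'' + eta f' + (grad)^* M(f) grad f = 0 on the
   graph V of the weak gradient, a closed subspace of L2 x L2^N.  The multiplication operator M(f)
   depends on f only through the smooth kernel, so f |-> M(f) is locally Lipschitz from L2 into the
   operator norm, and M(f) is coercive with a constant controlled by the L2 norm of f.

   Stability (Ladyzhenskaya): for two approximate solutions with residual delta, let d be the
   difference of the functions, G the time integral of the difference of the gradients, N that of the
   fluxes M(f) grad f, and R = N - M(f1) G.  Testing the equation with the difference of the solutions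
   shows that F = |d|^2/2 + <M(f1) G, G>/2 + <R, G> + (2/m) |R|^2 grows at most exponentially up to a
   source of order delta, and F controls |d|^2.  With delta = 0 this is uniqueness.

   Existence: the implicit Euler scheme is solvable by the Riesz theorem and has uniformly bounded energy
   on a short time interval.  Its interpolants are approximate solutions whose residual is
   proportional to the time step, so by the same stability estimate they converge strongly in L2 at
   every time.  Strong convergence of f gives norm convergence of M(f), and the gradients converge
   weakly because a bounded sequence in V converges weakly as soon as its first components converge. *)

theory Submission
  imports Defs
begin

text \<open>The velocity is only bounded in L2, so the equation cannot be tested with it; the
  difference \<open>u1 - u2\<close> is an admissible test element, and integrating the equation in
  time first makes it fit: the second derivative of \<open>d\<close> becomes a first one. The price
  is the term \<open>N \<bullet> G'\<close>, a time integral of fluxes against a gradient difference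
  that is not under control. Formally, with g2 the gradient of the second solution, N' = M(f1) G' +
  (M(f1) - M(f2)) g2, so R' = (M(f1) - M(f2)) g2 - M(f1)' G contains no G'. Inserting N = M(f1) G +
  R, the term \<open>N \<bullet> G'\<close> is the derivative of
  \<open>M (f1) G \<bullet> G / 2 + R \<bullet> G\<close> up to quantities quadratic in
  \<open>d\<close> and \<open>G\<close>, and Gronwall closes. M(f1)' is bounded because
  \<open>f1\<close> is Lipschitz in time with values in L2.

  The functions of time are only weakly integrable, so no derivative is ever taken: each identity is
  an estimate of increments over an interval with an error quadratic in its length. Strong
  convergence of the scheme is a Cauchy property: two time steps are compared through their
  residuals.\<close>

section \<open>Hilbert spaces\<close>

text \<open>By symmetry the equation is the Euler equation of the quadratic functional
  \<open>J\<close> on \<open>V\<close>. Coercivity bounds \<open>J\<close> below and makes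
  minimising sequences Cauchy, so the minimum is attained in the closed subspace.\<close>

lemma lax_milgram_symmetric:
  fixes V :: "'a::{real_inner,complete_space} set" and S :: "'a \<Rightarrow> 'a" and l :: "'a \<Rightarrow> real"
  assumes V: "subspace V" "closed V" and S: "bounded_linear S" and l: "bounded_linear l"
    and sym: "\<And>x y. S x \<bullet> y = x \<bullet> S y"
    and c: "c > 0" "\<And>x. c * (norm x)\<^sup>2 \<le> S x \<bullet> x"
  shows "\<exists>u\<in>V. \<forall>y\<in>V. S u \<bullet> y = l y"
proof -
  interpret S: bounded_linear S by fact
  interpret l: bounded_linear l by fact
  define J where "J x = S x \<bullet> x - 2 * l x" for x
  obtain K where K: "\<And>x. norm (l x) \<le> norm x * K" using l.bounded by blast
  have Jlow: "J x \<ge> - (K\<^sup>2 / c)" for x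
  proof -
    have "2 * l x \<le> 2 * (norm x * K)" using K[of x] by (simp add: abs_le_iff)
    also have "\<dots> \<le> c * (norm x)\<^sup>2 + K\<^sup>2 / c"
    proof -
      have "0 \<le> (c * norm x - K)\<^sup>2 / c" using c(1) by simp
      also have "\<dots> = c * (norm x)\<^sup>2 - 2 * (norm x * K) + K\<^sup>2 / c"
        using c(1) by (simp add: power2_eq_square field_simps)
      finally show ?thesis by simp
    qed
    finally show ?thesis using c(2)[of x] unfolding J_def by simp
  qed
  define i where "i = Inf (J ` V)"
  have V0: "0 \<in> V" using V(1) by (rule subspace_0)
  have bdd: "bdd_below (J ` V)" using Jlow by (auto intro!: bdd_belowI)
  have i_le: "i \<le> J x" if "x \<in> V" for x unfolding i_def using that bdd by (auto intro: cInf_lower)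
  have "\<exists>x\<in>V. J x < i + 1 / real (Suc n)" for n
  proof -
    have "\<exists>y\<in>J ` V. y < i + 1 / real (Suc n)"
      by (rule cInf_lessD) (use V0 in \<open>auto simp: i_def\<close>)
    then show ?thesis by auto
  qed
  then obtain X where XV: "\<And>n. X n \<in> V" and XJ: "\<And>n. J (X n) < i + 1 / real (Suc n)" by metis
  \<comment> \<open>Parallelogram identity for \<open>J\<close>. The midpoint of two points of
    \<open>V\<close> lies in \<open>V\<close>, where \<open>J\<close> is at least \<open>i\<close>,
    so nearly minimal values force the points to be close.\<close>
  have par: "J x + J y = 2 * J ((1/2) *\<^sub>R (x + y)) + (1/2) * (S (x - y) \<bullet> (x - y))" for x y
    unfolding J_def by (simp add: S.scaleR S.add S.diff l.scaleR l.add inner_add_left inner_add_right inner_diff_left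
        inner_diff_right algebra_simps)
  have close: "c * (norm (X n - X k))\<^sup>2 \<le> 2 / real (Suc n) + 2 / real (Suc k)" for n k
  proof -
    have "(1/2) *\<^sub>R (X n + X k) \<in> V" using V(1) XV by (intro subspace_scale subspace_add)
    from i_le[OF this] par[of "X n" "X k"] XJ[of n] XJ[of k] c(2)[of "X n - X k"]
    show ?thesis by simp
  qed
  have "Cauchy X"
  proof (rule metric_CauchyI)
    fix e :: real assume e: "e > 0"
    obtain N where N: "4 / (c * e\<^sup>2) < real (Suc N)" using reals_Archimedean2 less_SucI
      by (metis less_trans of_nat_less_iff lessI)
    { fix n k assume nk: "n \<ge> N" "k \<ge> N"
      have "2 / real (Suc n) \<le> 2 / real (Suc N)" "2 / real (Suc k) \<le> 2 / real (Suc N)"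
        using nk by (auto intro!: divide_left_mono)
      then have "c * (norm (X n - X k))\<^sup>2 \<le> 4 / real (Suc N)" using close[of n k] by simp
      also have "\<dots> < c * e\<^sup>2" using N c(1) e by (simp add: field_simps)
      finally have "norm (X n - X k) < e" using c(1) e by (simp add: power_less_imp_less_base)
      then have "dist (X n) (X k) < e" by (simp add: dist_norm) }
    then show "\<exists>M. \<forall>m\<ge>M. \<forall>n\<ge>M. dist (X m) (X n) < e" by blast
  qed
  then obtain u where u: "X \<longlonglongrightarrow> u" using Cauchy_convergent convergent_def by blast
  have uV: "u \<in> V" using V(2) XV u closed_sequentially by blast
  have "(\<lambda>n. J (X n)) \<longlonglongrightarrow> J u" unfolding J_def using u
    by (intro tendsto_intros S.tendsto l.tendsto)
  moreover have "(\<lambda>n. i + 1 / real (Suc n)) \<longlonglongrightarrow> i + 0"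
    by (intro tendsto_add tendsto_const LIMSEQ_Suc[OF lim_1_over_n])
  ultimately have "J u \<le> i + 0" by (rule LIMSEQ_le) (use XJ less_imp_le in blast)
  then have Ju: "J u \<le> i" by simp
  have "S u \<bullet> y = l y" if y: "y \<in> V" for y
  proof -
    define p where "p = S u \<bullet> y - l y"
    define q where "q = S y \<bullet> y"
    have quad: "0 \<le> 2 * t * p + t\<^sup>2 * q" for t
    proof -
      have "u + t *\<^sub>R y \<in> V" using V(1) uV y by (intro subspace_add subspace_scale)
      then have "J u \<le> J (u + t *\<^sub>R y)" using Ju i_le by force
      moreover have "J (u + t *\<^sub>R y) = J u + 2 * t * p + t\<^sup>2 * q"
        unfolding J_def p_def q_def
        by (simp add: S.add S.scaleR l.add l.scaleR inner_add_left inner_add_right sym[of y u] inner_commute[of y "S u"]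
            power2_eq_square algebra_simps)
      ultimately show ?thesis by simp
    qed
    have q0: "q \<ge> 0" using c(2)[of y] c(1) unfolding q_def
      by (metis less_imp_le mult_nonneg_nonneg order_trans zero_le_power2)
    \<comment> \<open>The minimising \<open>t\<close> would be \<open>- p / q\<close>; the
      denominator \<open>q + 1\<close> also covers \<open>q = 0\<close>, and the value is still
      negative unless \<open>p = 0\<close>.\<close>
    have "0 \<le> 2 * (- p / (q + 1)) * p + (- p / (q + 1))\<^sup>2 * q" by (rule quad)
    also have "\<dots> = - (p\<^sup>2 * (q + 2)) / (q + 1)\<^sup>2"
      using q0 by (simp add: divide_simps power2_eq_square) (simp add: algebra_simps)
    finally have "p\<^sup>2 * (q + 2) \<le> 0" using q0 by (simp add: divide_simps)
    then have "p = 0" using q0 by (smt (verit) mult_pos_pos zero_less_power2)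
    then show ?thesis unfolding p_def by simp
  qed
  with uV show ?thesis by blast
qed

lemma riesz_on_subspace:
  fixes V :: "'a::{real_inner,complete_space} set"
  assumes "subspace V" "closed V" "bounded_linear l"
  shows "\<exists>u\<in>V. \<forall>y\<in>V. u \<bullet> y = l y"
  using lax_milgram_symmetric[OF assms(1,2) bounded_linear_ident assms(3), of 1]
  by (simp add: power2_norm_eq_inner)

lemma riesz:
  fixes l :: "'a::{real_inner,complete_space} \<Rightarrow> real"
  assumes "bounded_linear l"
  obtains u where "\<And>y. u \<bullet> y = l y"
  using riesz_on_subspace[of UNIV l] assms by auto

lemma orthogonal_projection:
  fixes V :: "'a::{real_inner,complete_space} set"
  assumes "subspace V" "closed V"
  obtains u where "u \<in> V" "\<And>y. y \<in> V \<Longrightarrow> (x - u) \<bullet> y = 0"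
  using riesz_on_subspace[OF assms bounded_linear_inner_right[of x]]
  by (auto simp: inner_diff_left)

text \<open>A closed subspace is its own double orthogonal complement. In this form membership
  passes to weak limits and weak integrals, which are known only through scalar products.\<close>

lemma in_closed_subspace:
  fixes V :: "'a::{real_inner,complete_space} set"
  assumes "subspace V" "closed V" "\<And>z. (\<And>y. y \<in> V \<Longrightarrow> z \<bullet> y = 0) \<Longrightarrow> x \<bullet> z = 0"
  shows "x \<in> V"
proof -
  obtain u where u: "u \<in> V" "\<And>y. y \<in> V \<Longrightarrow> (x - u) \<bullet> y = 0"
    using orthogonal_projection[OF assms(1,2)] by metis
  have "x \<bullet> (x - u) = 0" using assms(3) u(2) by blast
  moreover have "u \<bullet> (x - u) = 0" using u by (metis inner_commute)
  ultimately have "(x - u) \<bullet> (x - u) = 0" by (simp add: inner_diff_left)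
  with u(1) show ?thesis by simp
qed

lemma norm_le_inner:
  fixes x :: "'a::real_inner"
  assumes "\<And>y. x \<bullet> y \<le> C * norm y" "C \<ge> 0"
  shows "norm x \<le> C"
proof (cases "x = 0")
  case False
  have "norm x * norm x \<le> C * norm x" using assms(1)[of x] by (simp add: power2_norm_eq_inner[symmetric] power2_eq_square)
  with False show ?thesis by simp
qed (use assms in auto)

text \<open>No subsequence is extracted. The vectors against which the sequence converges form a
  closed subspace \<open>C\<close>, by boundedness. It contains \<open>D\<close> and the complement
  of \<open>V\<close>, so a vector orthogonal to \<open>C\<close> lies in \<open>V\<close> and is
  orthogonal to \<open>D\<close>, hence is zero: \<open>C\<close> is the whole space.\<close>

lemma weak_limit:
  fixes V :: "'a::{real_inner,complete_space} set" and x :: "nat \<Rightarrow> 'a"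
  assumes V: "subspace V" "closed V" and xV: "\<And>k. x k \<in> V" and B: "\<And>k. norm (x k) \<le> B"
    and D: "\<And>d. d \<in> D \<Longrightarrow> convergent (\<lambda>k. x k \<bullet> d)"
    and dense: "\<And>z. z \<in> V \<Longrightarrow> (\<And>d. d \<in> D \<Longrightarrow> z \<bullet> d = 0) \<Longrightarrow> z = 0"
  shows "\<exists>u\<in>V. norm u \<le> B \<and> (\<forall>y. (\<lambda>k. x k \<bullet> y) \<longlonglongrightarrow> u \<bullet> y)"
proof -
  define C where "C = {y. convergent (\<lambda>k. x k \<bullet> y)}"
  have B0: "0 \<le> B" using B[of 0] norm_ge_zero order_trans by blast
  have C_sub: "subspace C" unfolding subspace_def C_def
    by (auto simp: inner_add_right intro: convergent_add convergent_const convergent_mult)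
  have C_closed: "closed C"
  proof (subst closed_sequential_limits, intro allI impI, elim conjE)
    fix y z assume y: "\<forall>n. y n \<in> C" "y \<longlonglongrightarrow> z"
    have "Cauchy (\<lambda>k. x k \<bullet> z)"
    proof (rule metric_CauchyI)
      fix e :: real assume e: "e > 0"
      have "\<exists>N. norm (y N - z) < e / (4 * (B + 1))"
        using LIMSEQ_D[OF y(2), of "e / (4 * (B + 1))"] e B0 by auto
      then obtain N where N: "norm (y N - z) < e / (4 * (B + 1))" by blast
      have "Cauchy (\<lambda>k. x k \<bullet> y N)" using y(1) unfolding C_def
        by (auto intro: convergent_Cauchy)
      then obtain M where M: "\<And>a b. a \<ge> M \<Longrightarrow> b \<ge> M \<Longrightarrow> \<bar>x a \<bullet> y N - x b \<bullet> y N\<bar> < e / 2"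
        using e unfolding Cauchy_def dist_real_def by (metis half_gt_zero)
      have small: "\<bar>x a \<bullet> y N - x a \<bullet> z\<bar> \<le> e / 4" for a
      proof -
        have "\<bar>x a \<bullet> (y N - z)\<bar> \<le> norm (x a) * norm (y N - z)" by (rule Cauchy_Schwarz_ineq2)
        also have "\<dots> \<le> (B + 1) * (e / (4 * (B + 1)))"
          using B[of a] N B0 e by (intro mult_mono) auto
        also have "\<dots> = e / 4" using B0 by (simp add: field_simps)
        finally show ?thesis by (simp add: inner_diff_right)
      qed
      { fix a b assume "a \<ge> M" "b \<ge> M"
        then have "dist (x a \<bullet> z) (x b \<bullet> z) < e"
          using M[of a b] small[of a] small[of b] unfolding dist_real_def by linarith }
      then show "\<exists>M. \<forall>m\<ge>M. \<forall>n\<ge>M. dist (x m \<bullet> z) (x n \<bullet> z) < e" by blast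
    qed
    then show "z \<in> C" unfolding C_def using Cauchy_convergent by blast
  qed
  have perpC: "z \<in> C" if "\<And>y. y \<in> V \<Longrightarrow> z \<bullet> y = 0" for z
  proof -
    have "(\<lambda>k. x k \<bullet> z) = (\<lambda>k. 0)" using that xV by (metis inner_commute)
    then show ?thesis unfolding C_def by (simp add: convergent_const)
  qed
  have C_all: "y \<in> C" for y
  proof (rule in_closed_subspace[OF C_sub C_closed])
    fix z assume z: "\<And>y. y \<in> C \<Longrightarrow> z \<bullet> y = 0"
    have "z \<in> V" using in_closed_subspace[OF V] z perpC by blast
    moreover have "z \<bullet> d = 0" if "d \<in> D" for d using z D that unfolding C_def by blast
    ultimately show "y \<bullet> z = 0" using dense by fastforce
  qed
  define l where "l y = lim (\<lambda>k. x k \<bullet> y)" for y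
  have l: "(\<lambda>k. x k \<bullet> y) \<longlonglongrightarrow> l y" for y
    using C_all[of y] unfolding C_def l_def by (simp add: convergent_LIMSEQ_iff)
  have l_bd: "\<bar>l y\<bar> \<le> B * norm y" for y
  proof (rule LIMSEQ_le_const2[OF tendsto_rabs[OF l]], intro exI allI impI)
    fix k show "\<bar>x k \<bullet> y\<bar> \<le> B * norm y"
      using Cauchy_Schwarz_ineq2[of "x k" y] B[of k] by (meson mult_right_mono norm_ge_zero order_trans)
  qed
  have "bounded_linear l"
  proof (rule bounded_linear_intro)
    show "l (y + z) = l y + l z" for y z
      using LIMSEQ_unique[OF l[of "y + z"]] tendsto_add[OF l[of y] l[of z]] by (simp add: inner_add_right)
    show "l (r *\<^sub>R y) = r *\<^sub>R l y" for r y
      using LIMSEQ_unique[OF l[of "r *\<^sub>R y"]] tendsto_mult[OF tendsto_const[of r] l[of y]] by simp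
    show "norm (l y) \<le> norm y * B" for y using l_bd[of y] by (simp add: mult.commute)
  qed
  then obtain u where u: "\<And>y. u \<bullet> y = l y" using riesz by blast
  have "norm u \<le> B" using l_bd B0 u by (intro norm_le_inner) (auto simp: abs_le_iff)
  moreover have "u \<in> V"
  proof (rule in_closed_subspace[OF V])
    fix z assume z: "\<And>y. y \<in> V \<Longrightarrow> z \<bullet> y = 0"
    have "(\<lambda>k. x k \<bullet> z) = (\<lambda>k. 0)" using z xV by (metis inner_commute)
    then show "u \<bullet> z = 0" using l[of z] u LIMSEQ_const_iff by (metis)
  qed
  ultimately show ?thesis using l u by auto
qed

section \<open>Weak integrals\<close>

text \<open>The weak (Pettis) integral; the type of the values need not be second countable, as the Bochner
  integral of the library requires.\<close>

definition wint :: "real \<Rightarrow> real \<Rightarrow> (real \<Rightarrow> 'a::real_inner) \<Rightarrow> 'a" where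
  "wint a b x = (THE y. \<forall>h. y \<bullet> h = integral {a..b} (\<lambda>t. x t \<bullet> h))"

definition wintble :: "real \<Rightarrow> real \<Rightarrow> real \<Rightarrow> (real \<Rightarrow> 'a::real_inner) \<Rightarrow> bool" where
  "wintble B a b x \<longleftrightarrow> (\<forall>t\<in>{a..b}. norm (x t) \<le> B) \<and> (\<forall>h. (\<lambda>t. x t \<bullet> h) integrable_on {a..b})"

lemma wintble_subinterval:
  assumes "wintble B a b x" "a \<le> c" "d \<le> b" shows "wintble B c d x"
  using assms unfolding wintble_def by (auto intro: integrable_on_subinterval)

lemma wintble_diff:
  assumes "wintble B a b x" "wintble C a b y" shows "wintble (B + C) a b (\<lambda>t. x t - y t)"
  using assms unfolding wintble_def
  by (auto simp: inner_diff_left intro!: integrable_diff) (smt (verit) atLeastAtMost_iff norm_triangle_ineq4)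

lemma integral_inner_bound:
  assumes "wintble B a b x" "a \<le> b" shows "\<bar>integral {a..b} (\<lambda>t. x t \<bullet> h)\<bar> \<le> B * (b - a) * norm h"
proof -
  have "norm (integral {a..b} (\<lambda>t. x t \<bullet> h)) \<le> integral {a..b} (\<lambda>t. B * norm h)"
  proof (rule integral_norm_bound_integral)
    fix t assume "t \<in> {a..b}"
    then show "norm (x t \<bullet> h) \<le> B * norm h" using assms Cauchy_Schwarz_ineq2[of "x t" h]
      unfolding wintble_def real_norm_def by (meson mult_right_mono norm_ge_zero order_trans)
  qed (use assms in \<open>auto simp: wintble_def\<close>)
  then show ?thesis using assms by (simp add: algebra_simps)
qed

text \<open>The uniform bound in \<open>wintble\<close> makes the integral a bounded functional of
  \<open>h\<close>, so the Riesz theorem supplies the vector that the definite description in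
  \<open>wint\<close> asks for.\<close>

lemma wint_inner:
  fixes x :: "real \<Rightarrow> 'a::{real_inner,complete_space}"
  assumes "wintble B a b x" "a \<le> b"
  shows "wint a b x \<bullet> h = integral {a..b} (\<lambda>t. x t \<bullet> h)"
proof -
  have int: "(\<lambda>t. x t \<bullet> h) integrable_on {a..b}" for h using assms unfolding wintble_def by blast
  have "bounded_linear (\<lambda>h. integral {a..b} (\<lambda>t. x t \<bullet> h))"
    by (rule bounded_linear_intro[where K = "B * (b - a)"])
      (use integral_inner_bound[OF assms] in \<open>auto simp: inner_add_right integral_add int mult.commute\<close>)
  then obtain u where u: "\<And>h. u \<bullet> h = integral {a..b} (\<lambda>t. x t \<bullet> h)" using riesz by blast
  have "wint a b x = u" unfolding wint_def
  proof (rule the_equality)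
    fix y assume "\<forall>h. y \<bullet> h = integral {a..b} (\<lambda>t. x t \<bullet> h)"
    then show "y = u" using u by (metis vector_eq_rdot inner_commute)
  qed (use u in auto)
  with u show ?thesis by simp
qed

lemma norm_wint:
  fixes x :: "real \<Rightarrow> 'a::{real_inner,complete_space}"
  assumes "wintble B a b x" "a \<le> b"
  shows "norm (wint a b x) \<le> B * (b - a)"
proof (rule norm_le_inner)
  have "0 \<le> B" using assms unfolding wintble_def
    by (metis atLeastAtMost_iff norm_ge_zero order_refl order_trans)
  then show "0 \<le> B * (b - a)" using assms by simp
qed (use integral_inner_bound[OF assms] wint_inner[OF assms] in \<open>auto simp: abs_le_iff\<close>)

lemma wint_combine:
  fixes x :: "real \<Rightarrow> 'a::{real_inner,complete_space}"
  assumes x: "wintble B a c x" and ab: "a \<le> b" "b \<le> c"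
  shows "wint a c x = wint a b x + wint b c x"
proof -
  have "wint a c x \<bullet> h = (wint a b x + wint b c x) \<bullet> h" for h
  proof -
    have "integral {a..b} (\<lambda>t. x t \<bullet> h) + integral {b..c} (\<lambda>t. x t \<bullet> h) = integral {a..c} (\<lambda>t. x t \<bullet> h)"
      using x ab by (intro Henstock_Kurzweil_Integration.integral_combine) (auto simp: wintble_def)
    moreover have "wintble B a b x" "wintble B b c x" using x ab by (auto intro: wintble_subinterval)
    ultimately show ?thesis using wint_inner x ab by (simp add: inner_add_left wint_inner)
  qed
  then show ?thesis by (metis vector_eq_rdot inner_commute)
qed

lemma wint_refl:
  fixes x :: "real \<Rightarrow> 'a::{real_inner,complete_space}"
  assumes "wintble B a a x" shows "wint a a x = 0"
  using norm_wint[OF assms] by simp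

lemma wint_in_subspace:
  fixes x :: "real \<Rightarrow> 'a::{real_inner,complete_space}"
  assumes V: "subspace V" "closed V" and x: "wintble B a b x" "a \<le> b" "\<And>t. t \<in> {a..b} \<Longrightarrow> x t \<in> V"
  shows "wint a b x \<in> V"
proof (rule in_closed_subspace[OF V])
  fix z assume z: "\<And>y. y \<in> V \<Longrightarrow> z \<bullet> y = 0"
  have "wint a b x \<bullet> z = integral {a..b} (\<lambda>t. x t \<bullet> z)" by (rule wint_inner[OF x(1,2)])
  also have "\<dots> = integral {a..b} (\<lambda>t. 0)"
    by (rule integral_cong) (metis z x(3) inner_commute)
  finally show "wint a b x \<bullet> z = 0" by simp
qed

text \<open>A norm continuous \<open>y\<close> is a uniform limit of step functions, and against a
  step function the product reduces to weak integrals with fixed vectors. Uniform limits preserve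
  integrability.\<close>

lemma integrable_inner_continuous:
  fixes x y :: "real \<Rightarrow> 'a::real_inner"
  assumes x: "wintble B a b x" and y: "continuous_on {a..b} y"
  shows "(\<lambda>t. x t \<bullet> y t) integrable_on {a..b}"
proof -
  \<comment> \<open>Induction on the number \<open>n\<close> of pieces of length \<delta> still
    needed to reach \<open>b\<close>: the first piece takes the constant value \<open>y c\<close>,
    the rest comes from the induction hypothesis.\<close>
  have step: "\<exists>z. (\<forall>t\<in>{c..b}. norm (y t - z t) \<le> e) \<and> (\<lambda>t. x t \<bullet> z t) integrable_on {c..b}"
    if \<delta>: "\<delta> > 0" "\<And>s t. s \<in> {a..b} \<Longrightarrow> t \<in> {a..b} \<Longrightarrow> dist t s \<le> \<delta> \<Longrightarrow> dist (y t) (y s) \<le> e"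
      and "a \<le> c" "c \<le> b" "b - c \<le> real n * \<delta>" for c e \<delta> n
    using that(3-5)
  proof (induction n arbitrary: c)
    case 0
    then have "c = b" by simp
    have "0 \<le> e" using \<delta>(2)[of b b] \<delta>(1) 0 by simp
    then show ?case using \<open>c = b\<close> integrable_on_refl[of "\<lambda>t. x t \<bullet> y t" b]
      by (intro exI[of _ y]) auto
  next
    case (Suc n)
    have xi: "(\<lambda>t. x t \<bullet> h) integrable_on {c..d}" if "d \<le> b" for h d
      using wintble_subinterval[OF x Suc(2) that] unfolding wintble_def by blast
    show ?case
    proof (cases "b - c \<le> \<delta>")
      case True
      have "\<forall>t\<in>{c..b}. norm (y t - y c) \<le> e"
        using \<delta>(2)[of c] Suc(2,3) True by (auto simp: dist_norm)
      then show ?thesis using xi[OF order_refl, of "y c"] by (intro exI[of _ "\<lambda>_. y c"]) auto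
    next
      case False
      have "b - (c + \<delta>) \<le> real n * \<delta>" using Suc(4) by (simp add: algebra_simps)
      then obtain z where z: "\<forall>t\<in>{c + \<delta>..b}. norm (y t - z t) \<le> e" "(\<lambda>t. x t \<bullet> z t) integrable_on {c + \<delta>..b}"
        using Suc.IH[of "c + \<delta>"] False Suc(2) \<delta>(1) by auto
      define z' where "z' t = (if t \<le> c + \<delta> then y c else z t)" for t
      have "(\<lambda>t. x t \<bullet> z' t) integrable_on {c..c+\<delta>}"
        by (rule integrable_eq[OF xi[of "c + \<delta>" "y c"]]) (use False in \<open>auto simp: z'_def\<close>)
      moreover have "(\<lambda>t. x t \<bullet> z' t) integrable_on {c+\<delta>..b}"
        by (rule integrable_spike_finite[OF _ _ z(2), of "{c + \<delta>}"]) (auto simp: z'_def)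
      ultimately have "(\<lambda>t. x t \<bullet> z' t) integrable_on {c..b}"
        using False \<delta>(1) Henstock_Kurzweil_Integration.integrable_combine[of c "c + \<delta>" b] by simp
      moreover have "\<forall>t\<in>{c..b}. norm (y t - z' t) \<le> e"
        using \<delta>(2)[of c] Suc(2,3) \<delta>(1) z(1) unfolding z'_def by (auto simp: dist_norm)
      ultimately show ?thesis by blast
    qed
  qed
  have B0: "B \<ge> 0" if "a \<le> b" using x that unfolding wintble_def
    by (metis atLeastAtMost_iff norm_ge_zero order_refl order_trans)
  show ?thesis
  proof (cases "a \<le> b")
    case True
    have "\<exists>g. (\<forall>t\<in>cbox a b. norm (x t \<bullet> y t - g t) \<le> e) \<and> g integrable_on cbox a b" if e: "e > 0" for e
    proof -
      define e' where "e' = e / (B + 1)"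
      have e': "e' > 0" using e B0[OF True] by (simp add: e'_def)
      have "uniformly_continuous_on {a..b} y" using y compact_uniformly_continuous by blast
      then obtain \<delta>0 where \<delta>0: "\<delta>0 > 0" "\<And>s t. s \<in> {a..b} \<Longrightarrow> t \<in> {a..b} \<Longrightarrow> dist t s < \<delta>0 \<Longrightarrow> dist (y t) (y s) < e'"
        unfolding uniformly_continuous_on_def using e' by metis
      obtain n :: nat where n: "b - a \<le> real n * (\<delta>0 / 2)"
        using \<delta>0(1) by (metis ex_less_of_nat_mult half_gt_zero less_imp_le)
      obtain z where z: "\<forall>t\<in>{a..b}. norm (y t - z t) \<le> e'" "(\<lambda>t. x t \<bullet> z t) integrable_on {a..b}"
        using step[of "\<delta>0 / 2" e' a n] \<delta>0 n True by (force intro: less_imp_le)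
      have "norm (x t \<bullet> y t - x t \<bullet> z t) \<le> e" if t: "t \<in> {a..b}" for t
      proof -
        have "norm (x t \<bullet> (y t - z t)) \<le> norm (x t) * norm (y t - z t)" by (simp add: Cauchy_Schwarz_ineq2)
        also have "\<dots> \<le> (B + 1) * e'" using x z(1) t B0[OF True] e' unfolding wintble_def
          by (intro mult_mono) force+
        also have "\<dots> = e" using B0[OF True] by (simp add: e'_def)
        finally show ?thesis by (simp add: inner_diff_right)
      qed
      then show ?thesis using z(2) by (intro exI[of _ "\<lambda>t. x t \<bullet> z t"]) auto
    qed
    then show ?thesis using integrable_uniform_limit[where a = a and b = b and f = "\<lambda>t. x t \<bullet> y t"] by auto
  qed auto
qed

text \<open>Only increments of F over short intervals are estimated, so F need not be continuous: the bound
  is iterated over n equal steps and n tends to infinity.\<close>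

lemma increment_gronwall:
  fixes F :: "real \<Rightarrow> real"
  assumes inc: "\<And>a b. 0 \<le> a \<Longrightarrow> a \<le> b \<Longrightarrow> b \<le> T \<Longrightarrow> F b - F a \<le> A * (b - a) * F a + C * (b - a)\<^sup>2 + D * (b - a)"
    and F0: "F 0 \<le> 0" and A: "A \<ge> 0" and C: "C \<ge> 0" and D: "D \<ge> 0" and t: "0 \<le> t" "t \<le> T"
  shows "F t \<le> D * t * exp (A * t)"
proof -
  have bound: "F t \<le> exp (A * t) * (C * t\<^sup>2 * (1 / real (Suc n)) + D * t)" for n
  proof -
    define N where "N = Suc n"
    define h where "h = t / real N"
    have h: "h \<ge> 0" "real N * h = t" unfolding h_def N_def using t by auto
    define e where "e = C * h\<^sup>2 + D * h"
    have e0: "e \<ge> 0" unfolding e_def using C D h by simp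
    have "F (real k * h) \<le> (1 + A * h) ^ k * (real k * e)" if "k \<le> N" for k
      using that
    proof (induction k)
      case 0 then show ?case using F0 by simp
    next
      case (Suc k)
      have "real (Suc k) * h \<le> real N * h" using Suc(2) h(1) by (intro mult_right_mono) auto
      then have le: "real (Suc k) * h \<le> T" using h(2) t by simp
      have Ah: "A * h \<ge> 0" using A h by simp
      have "real (Suc k) * h - real k * h = h" by (simp add: algebra_simps)
      then have "F (real (Suc k) * h) \<le> (1 + A * h) * F (real k * h) + e"
        using inc[of "real k * h" "real (Suc k) * h"] le h(1) unfolding e_def
        by (simp add: algebra_simps)
      also have "\<dots> \<le> (1 + A * h) * ((1 + A * h) ^ k * (real k * e)) + e"
        using Suc Ah by (intro add_right_mono mult_left_mono) auto
      \<comment> \<open>The new source is inflated by a power that is at least 1, so that the k + 1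
        sources carry a common factor and the induction closes.\<close>
      also have "\<dots> \<le> (1 + A * h) * ((1 + A * h) ^ k * (real k * e)) + (1 + A * h) ^ Suc k * e"
      proof -
        have "1 \<le> (1 + A * h) ^ Suc k" using Ah by (intro one_le_power) simp
        from mult_right_mono[OF this e0] show ?thesis by simp
      qed
      also have "\<dots> = (1 + A * h) ^ Suc k * (real (Suc k) * e)" by (simp add: algebra_simps)
      finally show ?case .
    qed
    from this[of N] have "F t \<le> (1 + A * h) ^ N * (real N * e)" using h by simp
    also have "\<dots> \<le> exp (A * t) * (real N * e)"
    proof -
      have "(1 + A * h) ^ N \<le> exp (A * h) ^ N" using A h by (intro power_mono) auto
      also have "\<dots> = exp (A * t)" using h(2) by (simp add: exp_of_nat_mult[symmetric] mult.left_commute)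
      finally show ?thesis using e0 by (intro mult_right_mono) auto
    qed
    also have "real N * e = C * (real N * h) * h + D * (real N * h)"
      unfolding e_def by (simp add: power2_eq_square algebra_simps)
    also have "\<dots> = C * t\<^sup>2 * (1 / real (Suc n)) + D * t"
      unfolding h(2) by (simp add: h_def N_def power2_eq_square)
    finally show ?thesis .
  qed
  have "(\<lambda>n. exp (A * t) * (C * t\<^sup>2 * (1 / real (Suc n)) + D * t)) \<longlonglongrightarrow> exp (A * t) * (C * t\<^sup>2 * 0 + D * t)"
    by (intro tendsto_intros LIMSEQ_Suc[OF lim_1_over_n])
  then have "F t \<le> exp (A * t) * (C * t\<^sup>2 * 0 + D * t)"
    by (rule LIMSEQ_le_const) (use bound in auto)
  then show ?thesis by (simp add: mult.commute)
qed

section \<open>The abstract wave equation\<close>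

text \<open>\<open>L\<close> and \<open>m\<close> depend on a radius because the diffusion
  coefficient is a nonpositive power of \<epsilon> plus a quadratic expression in the state: it
  decays as the state grows, and a quadratic is Lipschitz only on balls. The upper bound
  \<open>M0\<close> is global since the power is largest at \<epsilon>.\<close>

locale wave =
  fixes V :: "('h::{real_inner,complete_space} \<times> 'g::{real_inner,complete_space}) set"
    and M :: "'h \<Rightarrow> 'g \<Rightarrow> 'g" and M0 :: real and L m :: "real \<Rightarrow> real" and \<eta> :: real
  assumes V_subspace: "subspace V" and V_closed: "closed V"
    and V_inj: "\<And>g. (0, g) \<in> V \<Longrightarrow> g = 0"
    and M_linear: "\<And>f. linear (M f)"
    and M_sym: "\<And>f x y. M f x \<bullet> y = x \<bullet> M f y"
    and M_bound: "\<And>f x. norm (M f x) \<le> M0 * norm x"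
    and M_lipschitz: "\<And>R f f' x. norm f \<le> R \<Longrightarrow> norm f' \<le> R \<Longrightarrow>
          norm (M f x - M f' x) \<le> L R * norm (f - f') * norm x"
    and m_pos: "\<And>R. m R > 0"
    and M_coercive: "\<And>R f x. norm f \<le> R \<Longrightarrow> m R * (norm x)\<^sup>2 \<le> M f x \<bullet> x"
    and M0_nonneg: "M0 \<ge> 0" and L_nonneg: "\<And>R. L R \<ge> 0" and eta_nonneg: "\<eta> \<ge> 0"
begin

text \<open>Approximate solutions with residual \<open>\<delta>\<close>: \<open>f\<close> is the primitive of the velocity \<open>w\<close>, \<open>u\<close> takes values
  in \<open>V\<close> and its first component is \<open>\<delta>\<close>-close to \<open>f\<close>.  Both this closeness and the equation (integrated
  once in time) are required only after integration over subintervals, against a fixed test element.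
  Hence for a weak solution the exceptional null set of times may depend on the test element.\<close>

definition approx_sol ::
  "real \<Rightarrow> real \<Rightarrow> real \<Rightarrow> 'h \<Rightarrow> (real \<Rightarrow> 'h) \<Rightarrow> (real \<Rightarrow> 'h \<times> 'g) \<Rightarrow> (real \<Rightarrow> 'h) \<Rightarrow> bool" where
  "approx_sol \<delta> B T f0 f u w \<longleftrightarrow>
     (\<forall>t\<in>{0..T}. u t \<in> V) \<and> wintble B 0 T u \<and> wintble B 0 T w \<and> (\<forall>t\<in>{0..T}. norm (f t) \<le> B) \<and>
     (\<forall>t\<in>{0..T}. \<forall>h. f t \<bullet> h = f0 \<bullet> h + integral {0..t} (\<lambda>s. w s \<bullet> h)) \<and>
     (\<forall>a b h. 0 \<le> a \<longrightarrow> a \<le> b \<longrightarrow> b \<le> T \<longrightarrow>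
        \<bar>integral {a..b} (\<lambda>t. (f t - fst (u t)) \<bullet> h)\<bar> \<le> \<delta> * (b - a) * norm h) \<and>
     (\<forall>a b \<phi>. \<phi> \<in> V \<longrightarrow> 0 \<le> a \<longrightarrow> a \<le> b \<longrightarrow> b \<le> T \<longrightarrow>
        \<bar>integral {a..b} (\<lambda>t. w t \<bullet> fst \<phi> + \<eta> * ((f t - f0) \<bullet> fst \<phi>) +
            integral {0..t} (\<lambda>s. M (f s) (snd (u s)) \<bullet> snd \<phi>))\<bar> \<le> \<delta> * (b - a) * norm \<phi>)"

lemma approx_sol_equation:
  assumes "approx_sol \<delta> B T f0 f u w" "\<phi> \<in> V" "0 \<le> a" "a \<le> b" "b \<le> T"
  shows "\<bar>integral {a..b} (\<lambda>t. w t \<bullet> fst \<phi> + \<eta> * ((f t - f0) \<bullet> fst \<phi>) +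
            integral {0..t} (\<lambda>s. M (f s) (snd (u s)) \<bullet> snd \<phi>))\<bar> \<le> \<delta> * (b - a) * norm \<phi>"
  using assms unfolding approx_sol_def by blast

lemma approx_sol_mono:
  assumes "approx_sol \<delta> B T f0 f u w" "\<delta> \<le> \<delta>'"
  shows "approx_sol \<delta>' B T f0 f u w"
proof -
  have "\<delta> * (b - a) * norm h \<le> \<delta>' * (b - a) * norm h" if "a \<le> b" for a b :: real and h :: "'x::real_normed_vector"
    using assms(2) that by (intro mult_right_mono) auto
  then have mono: "x \<le> \<delta> * (b - a) * norm h \<Longrightarrow> a \<le> b \<Longrightarrow> x \<le> \<delta>' * (b - a) * norm h" for x a b :: real and h :: "'x::real_normed_vector"
    by (meson order_trans)
  show ?thesis using assms(1) unfolding approx_sol_def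
    by (elim conjE, intro conjI allI impI mono) blast+
qed

lemma wintble_fst: "wintble B a b u \<Longrightarrow> wintble B a b (\<lambda>t. fst (u t) :: 'h)" for u :: "real \<Rightarrow> 'h \<times> 'g"
  unfolding wintble_def
proof (intro conjI ballI allI; elim conjE)
  show "norm (fst (u t)) \<le> B" if "\<forall>t\<in>{a..b}. norm (u t) \<le> B" "t \<in> {a..b}" for t
    using norm_fst_le[of "fst (u t)" "snd (u t)"] that by force
  show "(\<lambda>t. fst (u t) \<bullet> h) integrable_on {a..b}" if "\<forall>h. (\<lambda>t. u t \<bullet> h) integrable_on {a..b}" for h
    using that[rule_format, of "(h, 0)"] by (simp add: inner_prod_def)
qed

lemma wintble_snd: "wintble B a b u \<Longrightarrow> wintble B a b (\<lambda>t. snd (u t) :: 'g)" for u :: "real \<Rightarrow> 'h \<times> 'g"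
  unfolding wintble_def
proof (intro conjI ballI allI; elim conjE)
  show "norm (snd (u t)) \<le> B" if "\<forall>t\<in>{a..b}. norm (u t) \<le> B" "t \<in> {a..b}" for t
    using norm_snd_le[of "snd (u t)" "fst (u t)"] that by force
  show "(\<lambda>t. snd (u t) \<bullet> h) integrable_on {a..b}" if "\<forall>h. (\<lambda>t. u t \<bullet> h) integrable_on {a..b}" for h
    using that[rule_format, of "(0, h)"] by (simp add: inner_prod_def)
qed

lemma M_diff: "M f (x - y) = M f x - M f y"
  using M_linear linear_diff by blast

lemma M_add: "M f (x + y) = M f x + M f y"
  using M_linear linear_add by blast

lemma primitive_increment:
  assumes w: "wintble B 0 T w" and f: "\<And>t h. t \<in> {0..T} \<Longrightarrow> f t \<bullet> h = f0 \<bullet> h + integral {0..t} (\<lambda>s. w s \<bullet> h)"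
    and ab: "0 \<le> a" "a \<le> b" "b \<le> T"
  shows "f b - f a = (wint a b w :: 'x::{real_inner,complete_space})"
proof -
  have "(f b - f a) \<bullet> h = wint a b w \<bullet> h" for h
  proof -
    have "integral {0..a} (\<lambda>s. w s \<bullet> h) + integral {a..b} (\<lambda>s. w s \<bullet> h) = integral {0..b} (\<lambda>s. w s \<bullet> h)"
      using wintble_subinterval[OF w, of 0 b] ab
      by (intro Henstock_Kurzweil_Integration.integral_combine) (auto simp: wintble_def)
    moreover have "wint a b w \<bullet> h = integral {a..b} (\<lambda>s. w s \<bullet> h)"
      using wintble_subinterval[OF w] ab by (intro wint_inner) auto
    ultimately show ?thesis using f[of a h] f[of b h] ab by (simp add: inner_diff_left)
  qed
  then show ?thesis by (metis vector_eq_rdot inner_commute)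
qed

lemma primitive_lipschitz:
  assumes w: "wintble B 0 T w" and f: "\<And>t h. t \<in> {0..T} \<Longrightarrow> f t \<bullet> h = f0 \<bullet> h + integral {0..t} (\<lambda>s. w s \<bullet> h)"
    and ab: "0 \<le> a" "a \<le> b" "b \<le> T"
  shows "norm (f b - f a :: 'x::{real_inner,complete_space}) \<le> B * (b - a)"
  using primitive_increment[OF assms] norm_wint[OF wintble_subinterval[OF w]] ab by simp

lemma lipschitz_continuous_on:
  fixes f :: "real \<Rightarrow> 'x::real_normed_vector"
  assumes f: "\<And>a b. 0 \<le> a \<Longrightarrow> a \<le> b \<Longrightarrow> b \<le> T \<Longrightarrow> norm (f b - f a) \<le> B * (b - a)"
  shows "continuous_on {0..T} f"
proof (rule continuous_onI)
  fix x e :: real assume x: "x \<in> {0..T}" and e: "e > 0"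
  have "dist (f y) (f x) \<le> e" if y: "y \<in> {0..T}" "dist y x < e / (\<bar>B\<bar> + 1)" for y
  proof -
    have "norm (f y - f x) \<le> \<bar>B\<bar> * \<bar>y - x\<bar>"
    proof (cases "x \<le> y")
      case True
      have "norm (f y - f x) \<le> B * (y - x)" using f[of x y] x y True by simp
      also have "\<dots> \<le> \<bar>B\<bar> * \<bar>y - x\<bar>" by (metis abs_ge_self abs_mult)
      finally show ?thesis .
    next
      case False
      have "norm (f x - f y) \<le> B * (x - y)" using f[of y x] x y False by simp
      also have "\<dots> \<le> \<bar>B\<bar> * \<bar>y - x\<bar>" by (metis abs_ge_self abs_mult abs_minus_commute)
      finally show ?thesis by (simp add: norm_minus_commute)
    qed
    also have "\<dots> \<le> (\<bar>B\<bar> + 1) * (e / (\<bar>B\<bar> + 1))"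
      using y(2) by (intro mult_mono) (auto simp: dist_real_def)
    also have "\<dots> = e" by simp
    finally show ?thesis by (simp add: dist_norm)
  qed
  then show "\<exists>d>0. \<forall>x'\<in>{0..T}. dist x' x < d \<longrightarrow> dist (f x') (f x) \<le> e"
    using e by (intro exI[of _ "e / (\<bar>B\<bar> + 1)"]) auto
qed

lemma continuous_on_M:
  assumes f: "continuous_on A f" and B: "\<And>t. t \<in> A \<Longrightarrow> norm (f t) \<le> B"
  shows "continuous_on A (\<lambda>t. M (f t) x)"
  unfolding continuous_on_def
proof
  fix s assume s: "s \<in> A"
  have "((\<lambda>t. L B * norm (f t - f s) * norm x) \<longlongrightarrow> L B * norm (f s - f s) * norm x) (at s within A)"
    using f s unfolding continuous_on_def by (intro tendsto_intros) auto
  then have lim: "((\<lambda>t. L B * norm (f t - f s) * norm x) \<longlongrightarrow> 0) (at s within A)" by simp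
  have "((\<lambda>t. M (f t) x - M (f s) x) \<longlongrightarrow> 0) (at s within A)"
  proof (rule Lim_null_comparison[OF _ lim])
    show "\<forall>\<^sub>F t in at s within A. norm (M (f t) x - M (f s) x) \<le> L B * norm (f t - f s) * norm x"
      using M_lipschitz B s by (auto simp: eventually_at_filter)
  qed
  then show "((\<lambda>t. M (f t) x) \<longlongrightarrow> M (f s) x) (at s within A)" by (rule LIM_zero_cancel)
qed

text \<open>Symmetry moves \<open>M (f t)\<close> onto the fixed vector, whose image is norm
  continuous in time, so that \<open>integrable_inner_continuous\<close> applies to the merely
  weakly integrable \<open>g\<close>.\<close>

lemma wintble_M:
  assumes g: "wintble B a b g" and f: "continuous_on {a..b} f" "\<And>t. t \<in> {a..b} \<Longrightarrow> norm (f t) \<le> B"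
  shows "wintble (M0 * B) a b (\<lambda>t. M (f t) (g t))"
  unfolding wintble_def
proof (intro conjI ballI allI)
  fix t assume "t \<in> {a..b}"
  then show "norm (M (f t) (g t)) \<le> M0 * B"
    using M_bound[of "f t" "g t"] g M0_nonneg unfolding wintble_def by (meson mult_left_mono order_trans)
next
  fix h
  have "(\<lambda>t. g t \<bullet> M (f t) h) integrable_on {a..b}"
    by (rule integrable_inner_continuous[OF g continuous_on_M[OF f]])
  then show "(\<lambda>t. M (f t) (g t) \<bullet> h) integrable_on {a..b}" by (simp add: M_sym)
qed

lemma equation_integrable:
  assumes f: "continuous_on {0..T} f" and w: "wintble B 0 T w" and Mg: "wintble C 0 T g"
    and ab: "0 \<le> a" "b \<le> T"
  shows "(\<lambda>t. w t \<bullet> p) integrable_on {a..b}" "(\<lambda>t. \<eta> * ((f t - c) \<bullet> p)) integrable_on {a..b}"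
    "(\<lambda>t. integral {0..t} (\<lambda>s. g s \<bullet> q)) integrable_on {a..b}"
proof -
  show "(\<lambda>t. w t \<bullet> p) integrable_on {a..b}" using wintble_subinterval[OF w] ab unfolding wintble_def by auto
  have "continuous_on {a..b} f" by (rule continuous_on_subset[OF f]) (use ab in auto)
  then show "(\<lambda>t. \<eta> * ((f t - c) \<bullet> p)) integrable_on {a..b}"
    by (intro integrable_continuous_interval continuous_intros)
  have "continuous_on {0..T} (\<lambda>t. integral {0..t} (\<lambda>s. g s \<bullet> q))"
    using Mg unfolding wintble_def by (intro indefinite_integral_continuous_1) auto
  then have "continuous_on {a..b} (\<lambda>t. integral {0..t} (\<lambda>s. g s \<bullet> q))"
    by (rule continuous_on_subset) (use ab in auto)
  then show "(\<lambda>t. integral {0..t} (\<lambda>s. g s \<bullet> q)) integrable_on {a..b}"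
    by (rule integrable_continuous_interval)
qed

end

section \<open>Stability estimate for two approximate solutions\<close>

locale wave_pair = wave +
  fixes \<delta> B T :: real and f0 f1 u1 w1 f2 u2 w2
  assumes sol1: "approx_sol \<delta> B T f0 f1 u1 w1" and sol2: "approx_sol \<delta> B T f0 f2 u2 w2"
    and T_nonneg: "0 \<le> T" and \<delta>_nonneg: "0 \<le> \<delta>"
begin

definition "d t = f1 t - f2 t"
definition "G t = wint 0 t (\<lambda>s. snd (u1 s) - snd (u2 s))"
definition "\<nu> t = M (f1 t) (snd (u1 t)) - M (f2 t) (snd (u2 t))"
definition "N t = wint 0 t \<nu>"
text \<open>\<open>R\<close> is what the product rule leaves when the flux integral \<open>N\<close> is compared with \<open>M (f1 t) (G t)\<close>;
  its increments do not involve the difference of the gradients, only \<open>d\<close> and \<open>G\<close>.\<close>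

definition "R t = N t - M (f1 t) (G t)"

lemma B_nonneg: "0 \<le> B"
  using sol1 T_nonneg unfolding approx_sol_def
  by (metis atLeastAtMost_iff norm_ge_zero order_refl order_trans)

lemma u_wintble: "wintble B 0 T u1" "wintble B 0 T u2"
  and w_wintble: "wintble B 0 T w1" "wintble B 0 T w2"
  and f_bound: "t \<in> {0..T} \<Longrightarrow> norm (f1 t) \<le> B" "t \<in> {0..T} \<Longrightarrow> norm (f2 t) \<le> B"
  and f_prim: "\<And>t h. t \<in> {0..T} \<Longrightarrow> f1 t \<bullet> h = f0 \<bullet> h + integral {0..t} (\<lambda>s. w1 s \<bullet> h)"
     "\<And>t h. t \<in> {0..T} \<Longrightarrow> f2 t \<bullet> h = f0 \<bullet> h + integral {0..t} (\<lambda>s. w2 s \<bullet> h)"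
  using sol1 sol2 unfolding approx_sol_def by auto

lemma f_lipschitz:
  assumes "0 \<le> a" "a \<le> b" "b \<le> T"
  shows "norm (f1 b - f1 a) \<le> B * (b - a)" "norm (f2 b - f2 a) \<le> B * (b - a)"
  by (rule primitive_lipschitz[OF w_wintble(1) _ assms], erule f_prim(1))
    (rule primitive_lipschitz[OF w_wintble(2) _ assms], erule f_prim(2))

lemma f_increment:
  assumes "0 \<le> a" "a \<le> b" "b \<le> T"
  shows "f1 b - f1 a = wint a b w1" "f2 b - f2 a = wint a b w2"
  by (rule primitive_increment[OF w_wintble(1) _ assms], erule f_prim(1))
    (rule primitive_increment[OF w_wintble(2) _ assms], erule f_prim(2))

lemma f_cont: "continuous_on {0..T} f1" "continuous_on {0..T} f2"
  by (rule lipschitz_continuous_on, erule (2) f_lipschitz(1))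
    (rule lipschitz_continuous_on, erule (2) f_lipschitz(2))

lemma du_wintble: "wintble (2 * B) 0 T (\<lambda>t. u1 t - u2 t)"
  using wintble_diff[OF u_wintble] by simp

lemma dg_wintble: "wintble (2 * B) 0 T (\<lambda>t. snd (u1 t) - snd (u2 t))"
  using wintble_snd[OF du_wintble] by simp

lemma Mg_wintble: "wintble (M0 * B) 0 T (\<lambda>t. M (f1 t) (snd (u1 t)))" "wintble (M0 * B) 0 T (\<lambda>t. M (f2 t) (snd (u2 t)))"
  using wintble_snd[OF u_wintble(1)] wintble_snd[OF u_wintble(2)] f_cont f_bound by (auto intro: wintble_M)

lemma \<nu>_wintble: "wintble (2 * M0 * B) 0 T \<nu>"
  using wintble_diff[OF Mg_wintble] unfolding \<nu>_def[abs_def] by (simp add: mult_ac)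

lemma d_increment: 
  assumes "0 \<le> a" "a \<le> b" "b \<le> T"
  shows "norm (d b - d a) \<le> 2 * B * (b - a)"
  using f_lipschitz[OF assms] norm_triangle_ineq4[of "f1 b - f1 a" "f2 b - f2 a"]
  unfolding d_def by (simp add: algebra_simps)

lemma G_increment:
  assumes "0 \<le> a" "a \<le> b" "b \<le> T"
  shows "G b - G a = wint a b (\<lambda>s. snd (u1 s) - snd (u2 s))"
  using wint_combine[OF wintble_subinterval[OF dg_wintble], of 0 b a] assms unfolding G_def by simp

lemma N_increment:
  assumes "0 \<le> a" "a \<le> b" "b \<le> T"
  shows "N b - N a = wint a b \<nu>"
  using wint_combine[OF wintble_subinterval[OF \<nu>_wintble], of 0 b a] assms unfolding N_def by simp

lemma G_lipschitz:
  assumes "0 \<le> a" "a \<le> b" "b \<le> T"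
  shows "norm (G b - G a) \<le> 2 * B * (b - a)"
  unfolding G_increment[OF assms] using norm_wint[OF wintble_subinterval[OF dg_wintble]] assms by simp

lemma N_lipschitz:
  assumes "0 \<le> a" "a \<le> b" "b \<le> T"
  shows "norm (N b - N a) \<le> 2 * M0 * B * (b - a)"
  unfolding N_increment[OF assms] using norm_wint[OF wintble_subinterval[OF \<nu>_wintble]] assms by simp

lemma zero_at_0: "d 0 = 0" "G 0 = 0" "N 0 = 0" "R 0 = 0"
proof -
  have "f1 0 \<bullet> h = f2 0 \<bullet> h" for h using f_prim[of 0 h] T_nonneg by simp
  then have "f1 0 = f2 0" by (metis vector_eq_rdot inner_commute)
  then show "d 0 = 0" by (simp add: d_def)
  show G: "G 0 = 0" unfolding G_def using wint_refl wintble_subinterval[OF dg_wintble, of 0 0] T_nonneg by fastforce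
  show N: "N 0 = 0" unfolding N_def using wint_refl wintble_subinterval[OF \<nu>_wintble, of 0 0] T_nonneg by fastforce
  show "R 0 = 0" unfolding R_def N G using M_bound[of "f1 0" 0] by simp
qed

lemma size_bounds:
  assumes t: "0 \<le> t" "t \<le> T"
  shows "norm (d t) \<le> 2 * B" "norm (G t) \<le> 2 * B * T" "norm (R t) \<le> 4 * M0 * B * T"
proof -
  show "norm (d t) \<le> 2 * B" unfolding d_def using norm_triangle_ineq4[of "f1 t" "f2 t"] f_bound[of t] t by simp
  have "norm (G t) \<le> 2 * B * t" using G_lipschitz[of 0 t] t zero_at_0 by simp
  also have "\<dots> \<le> 2 * B * T" using t B_nonneg by (intro mult_left_mono) auto
  finally show G: "norm (G t) \<le> 2 * B * T" .
  have "norm (N t) \<le> 2 * M0 * B * t" using N_lipschitz[of 0 t] t zero_at_0 by simp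
  also have "\<dots> \<le> 2 * M0 * B * T" using t B_nonneg M0_nonneg by (intro mult_left_mono) auto
  finally have "norm (N t) \<le> 2 * M0 * B * T" .
  moreover have "norm (M (f1 t) (G t)) \<le> M0 * (2 * B * T)"
    using M_bound[of "f1 t" "G t"] G M0_nonneg by (meson mult_left_mono order_trans)
  ultimately show "norm (R t) \<le> 4 * M0 * B * T"
    unfolding R_def using norm_triangle_ineq4[of "N t" "M (f1 t) (G t)"] by simp
qed

text \<open>The product rule in difference form: the increment of \<open>M (f1 t) (G t)\<close>
  splits into \<open>M (f1 b)\<close> applied to the increment of \<open>G\<close>, which is
  compared with the increment of \<open>N\<close>, and a change of coefficient acting on
  \<open>G a\<close>.\<close>

lemma R_increment:
  assumes ab: "0 \<le> a" "a \<le> b" "b \<le> T"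
  shows "norm (R b - R a) \<le> 4 * B\<^sup>2 * L B * (b - a)\<^sup>2 + B * L B * (b - a) * (norm (d a) + norm (G a))"
proof (rule norm_le_inner)
  have l0: "0 \<le> L B" by (rule L_nonneg)
  show "0 \<le> 4 * B\<^sup>2 * L B * (b - a)\<^sup>2 + B * L B * (b - a) * (norm (d a) + norm (G a))"
    using ab B_nonneg l0 by simp
  fix \<psi> :: 'b
  define h where "h = b - a"
  have h: "h \<ge> 0" using ab by (simp add: h_def)
  \<comment> \<open>The gradient difference occurs only together with a coefficient increment of
    order \<open>b - a\<close>, hence contributes quadratically after integration; the second
    summand sees the two states only through \<open>M (f1 s) - M (f2 s)\<close>, which is controlled
    by \<open>d\<close>.\<close>
  define y where "y s = (snd (u1 s) - snd (u2 s)) \<bullet> (M (f1 s) \<psi> - M (f1 b) \<psi>) + snd (u2 s) \<bullet> (M (f1 s) \<psi> - M (f2 s) \<psi>)" for s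
  have y_eq: "\<nu> s \<bullet> \<psi> - (snd (u1 s) - snd (u2 s)) \<bullet> M (f1 b) \<psi> = y s" for s
    unfolding \<nu>_def y_def by (simp add: M_sym inner_diff_left inner_diff_right)
  have int1: "(\<lambda>s. \<nu> s \<bullet> \<psi>) integrable_on {a..b}"
    using wintble_subinterval[OF \<nu>_wintble] ab unfolding wintble_def by auto
  have int2: "(\<lambda>s. (snd (u1 s) - snd (u2 s)) \<bullet> M (f1 b) \<psi>) integrable_on {a..b}"
    using wintble_subinterval[OF dg_wintble] ab unfolding wintble_def by auto
  have "(R b - R a) \<bullet> \<psi> = (N b - N a) \<bullet> \<psi> - (G b - G a) \<bullet> M (f1 b) \<psi> - (M (f1 b) (G a) - M (f1 a) (G a)) \<bullet> \<psi>"
    unfolding R_def by (simp add: inner_diff_left M_sym)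
  also have "(N b - N a) \<bullet> \<psi> = integral {a..b} (\<lambda>s. \<nu> s \<bullet> \<psi>)"
    unfolding N_increment[OF ab] using wintble_subinterval[OF \<nu>_wintble] ab by (auto intro: wint_inner)
  also have "(G b - G a) \<bullet> M (f1 b) \<psi> = integral {a..b} (\<lambda>s. (snd (u1 s) - snd (u2 s)) \<bullet> M (f1 b) \<psi>)"
    unfolding G_increment[OF ab] using wintble_subinterval[OF dg_wintble] ab by (auto intro: wint_inner)
  also have "integral {a..b} (\<lambda>s. \<nu> s \<bullet> \<psi>) - integral {a..b} (\<lambda>s. (snd (u1 s) - snd (u2 s)) \<bullet> M (f1 b) \<psi>)
      = integral {a..b} y"
    using integral_diff[OF int1 int2] y_eq by simp
  finally have eq: "(R b - R a) \<bullet> \<psi> = integral {a..b} y - (M (f1 b) (G a) - M (f1 a) (G a)) \<bullet> \<psi>" .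
  have yint: "y integrable_on {a..b}" using integrable_diff[OF int1 int2] y_eq by simp
  define K where "K = 2 * B * (L B * (B * h) * norm \<psi>) + B * (L B * (norm (d a) + 2 * B * h) * norm \<psi>)"
  have "norm (integral {a..b} y) \<le> integral {a..b} (\<lambda>s. K)"
  proof (rule integral_norm_bound_integral[OF yint])
    fix s assume s: "s \<in> {a..b}"
    then have sT: "s \<in> {0..T}" "b \<in> {0..T}" using ab by auto
    have "norm (f1 s - f1 b) \<le> B * h"
    proof -
      have "norm (f1 b - f1 s) \<le> B * (b - s)" using f_lipschitz[of s b] s ab by simp
      also have "\<dots> \<le> B * h" using s B_nonneg by (intro mult_left_mono) (auto simp: h_def)
      finally show ?thesis by (simp add: norm_minus_commute)
    qed
    then have 1: "norm (M (f1 s) \<psi> - M (f1 b) \<psi>) \<le> L B * (B * h) * norm \<psi>"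
      using M_lipschitz[of "f1 s" B "f1 b" \<psi>] f_bound[of s] f_bound[of b] sT l0
      by (meson mult_left_mono mult_right_mono norm_ge_zero order_trans)
    have "norm (d s) \<le> norm (d a) + 2 * B * h"
    proof -
      have "norm (d s - d a) \<le> 2 * B * (s - a)" using d_increment[of a s] s ab by simp
      also have "\<dots> \<le> 2 * B * h" using s B_nonneg by (intro mult_left_mono) (auto simp: h_def)
      finally show ?thesis using norm_triangle_sub[of "d s" "d a"] by simp
    qed
    then have 2: "norm (M (f1 s) \<psi> - M (f2 s) \<psi>) \<le> L B * (norm (d a) + 2 * B * h) * norm \<psi>"
      using M_lipschitz[of "f1 s" B "f2 s" \<psi>] f_bound[of s] sT l0 unfolding d_def
      by (meson mult_left_mono mult_right_mono norm_ge_zero order_trans)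
    have n1: "norm (snd (u1 s) - snd (u2 s)) \<le> 2 * B" and n2: "norm (snd (u2 s)) \<le> B"
      using dg_wintble wintble_snd[OF u_wintble(2)] sT unfolding wintble_def by auto
    have "\<bar>(snd (u1 s) - snd (u2 s)) \<bullet> (M (f1 s) \<psi> - M (f1 b) \<psi>)\<bar> \<le> 2 * B * (L B * (B * h) * norm \<psi>)"
      by (rule order_trans[OF Cauchy_Schwarz_ineq2 mult_mono[OF n1 1]]) (use B_nonneg in auto)
    moreover have "\<bar>snd (u2 s) \<bullet> (M (f1 s) \<psi> - M (f2 s) \<psi>)\<bar> \<le> B * (L B * (norm (d a) + 2 * B * h) * norm \<psi>)"
      by (rule order_trans[OF Cauchy_Schwarz_ineq2 mult_mono[OF n2 2]]) (use B_nonneg in auto)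
    ultimately show "norm (y s) \<le> K" unfolding y_def K_def by simp
  qed auto
  then have 1: "\<bar>integral {a..b} y\<bar> \<le> h * K" using ab by (simp add: h_def)
  have "norm (f1 b - f1 a) \<le> B * h" using f_lipschitz[OF ab] by (simp add: h_def)
  then have "norm (M (f1 b) (G a) - M (f1 a) (G a)) \<le> L B * (B * h) * norm (G a)"
    by (intro order_trans[OF M_lipschitz[of "f1 b" B "f1 a" "G a"]] mult_right_mono mult_left_mono)
      (use f_bound[of a] f_bound[of b] ab l0 in auto)
  then have "\<bar>(M (f1 b) (G a) - M (f1 a) (G a)) \<bullet> \<psi>\<bar> \<le> L B * (B * h) * norm (G a) * norm \<psi>"
    by (meson Cauchy_Schwarz_ineq2 mult_right_mono norm_ge_zero order_trans)
  then have "(R b - R a) \<bullet> \<psi> \<le> h * K + L B * (B * h) * norm (G a) * norm \<psi>" using eq 1 by linarith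
  also have "\<dots> = (4 * B\<^sup>2 * L B * (b - a)\<^sup>2 + B * L B * (b - a) * (norm (d a) + norm (G a))) * norm \<psi>"
    unfolding K_def h_def[symmetric] by (simp add: power2_eq_square algebra_simps)
  finally show "(R b - R a) \<bullet> \<psi> \<le> (4 * B\<^sup>2 * L B * (b - a)\<^sup>2 + B * L B * (b - a) * (norm (d a) + norm (G a))) * norm \<psi>" .
qed

text \<open>The test element is the integral of \<open>u1 - u2\<close> over \<open>[a,b]\<close>: its second component is exactly the
  increment of \<open>G\<close>, and its first one is \<open>(b - a) d(a)\<close> up to a small error.\<close>

lemma tested_equation:
  assumes ab: "0 \<le> a" "a < b" "b \<le> T"
  defines "h \<equiv> b - a"
  shows "\<bar>d a \<bullet> (d b - d a) + N a \<bullet> (G b - G a)\<bar> \<le>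
    8 * B * \<delta> * h + 4 * B\<^sup>2 * h\<^sup>2 + \<eta> * h * (norm (d a) + 2 * B * h) * (norm (d a) + 2 * \<delta> + 2 * B * h) + 4 * M0 * B\<^sup>2 * h\<^sup>2"
proof -
  have h: "h > 0" using ab by (simp add: h_def)
  define \<phi> where "\<phi> = wint a b (\<lambda>t. u1 t - u2 t)"
  have wb: "wintble (2 * B) a b (\<lambda>t. u1 t - u2 t)" using wintble_subinterval[OF du_wintble] ab by simp
  have \<phi>V: "\<phi> \<in> V" unfolding \<phi>_def
  proof (rule wint_in_subspace[OF V_subspace V_closed wb])
    fix t assume "t \<in> {a..b}"
    then show "u1 t - u2 t \<in> V" using sol1 sol2 ab V_subspace unfolding approx_sol_def
      by (auto intro!: subspace_diff)
  qed (use ab in simp)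
  have \<phi>_norm: "norm \<phi> \<le> 2 * B * h" unfolding \<phi>_def h_def using norm_wint[OF wb] ab by simp
  have \<phi>_inner: "\<phi> \<bullet> y = integral {a..b} (\<lambda>t. (u1 t - u2 t) \<bullet> y)" for y
    unfolding \<phi>_def using wint_inner[OF wb] ab by simp
  have snd_\<phi>: "snd \<phi> = G b - G a"
  proof -
    have "snd \<phi> \<bullet> y = (G b - G a) \<bullet> y" for y
    proof -
      have "(G b - G a) \<bullet> y = integral {a..b} (\<lambda>s. (snd (u1 s) - snd (u2 s)) \<bullet> y)"
        using G_increment[of a b] wint_inner[OF wintble_subinterval[OF dg_wintble]] ab by simp
      then show ?thesis using \<phi>_inner[of "(0, y)"] by (simp add: inner_prod_def)
    qed
    then show ?thesis by (metis vector_eq_rdot inner_commute)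
  qed
  have fu_int: "(\<lambda>t. (f t - fst (u t)) \<bullet> y) integrable_on {a..b}"
    if "continuous_on {0..T} f" "wintble B 0 T u" for f and u :: "real \<Rightarrow> 'a \<times> 'b" and y :: 'a
  proof -
    have "continuous_on {a..b} f" by (rule continuous_on_subset[OF that(1)]) (use ab in auto)
    then have "(\<lambda>t. f t \<bullet> y) integrable_on {a..b}"
      by (intro integrable_continuous_interval continuous_intros)
    moreover have "(\<lambda>t. fst (u t) \<bullet> y) integrable_on {a..b}"
      using wintble_subinterval[OF wintble_fst[OF that(2)]] ab unfolding wintble_def by auto
    ultimately show ?thesis by (simp add: inner_diff_left integrable_diff)
  qed
  have fst_\<phi>: "norm (fst \<phi> - h *\<^sub>R d a) \<le> 2 * \<delta> * h + 2 * B * h\<^sup>2"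
  proof (rule norm_le_inner)
    show "0 \<le> 2 * \<delta> * h + 2 * B * h\<^sup>2" using \<delta>_nonneg B_nonneg h by simp
    fix y :: 'a
    have dint: "(\<lambda>t. (d t - d a) \<bullet> y) integrable_on {a..b}" 
    proof -
      have "continuous_on {a..b} f1" "continuous_on {a..b} f2"
        using ab by (auto intro: continuous_on_subset[OF f_cont(1)] continuous_on_subset[OF f_cont(2)])
      then show ?thesis unfolding d_def by (intro integrable_continuous_interval continuous_intros)
    qed
    have "fst \<phi> \<bullet> y = integral {a..b} (\<lambda>t. (fst (u1 t) - fst (u2 t)) \<bullet> y)"
      using \<phi>_inner[of "(y, 0)"] by (simp add: inner_prod_def)
    \<comment> \<open>Passing from the first components of \<open>u1\<close> and \<open>u2\<close>
      to \<open>f1\<close> and \<open>f2\<close> costs one residual each; the remaining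
      \<open>d t\<close> is compared with its value at the left end point.\<close>
    also have "\<dots> = integral {a..b} (\<lambda>t. (f2 t - fst (u2 t)) \<bullet> y - (f1 t - fst (u1 t)) \<bullet> y + ((d t - d a) \<bullet> y + d a \<bullet> y))"
      by (rule integral_cong) (simp add: d_def inner_diff_left)
    also have "\<dots> = integral {a..b} (\<lambda>t. (f2 t - fst (u2 t)) \<bullet> y) - integral {a..b} (\<lambda>t. (f1 t - fst (u1 t)) \<bullet> y)
        + (integral {a..b} (\<lambda>t. (d t - d a) \<bullet> y) + h * (d a \<bullet> y))"
    proof (rule integral_unique, intro has_integral_add has_integral_diff integrable_integral)
      show "((\<lambda>t. d a \<bullet> y) has_integral h * (d a \<bullet> y)) {a..b}"
        using has_integral_const_real[of "d a \<bullet> y" a b] ab by (simp add: h_def)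
    qed (use fu_int[OF f_cont(1) u_wintble(1)] fu_int[OF f_cont(2) u_wintble(2)] dint in auto)
    finally have eq: "(fst \<phi> - h *\<^sub>R d a) \<bullet> y = integral {a..b} (\<lambda>t. (f2 t - fst (u2 t)) \<bullet> y) -
        integral {a..b} (\<lambda>t. (f1 t - fst (u1 t)) \<bullet> y) + integral {a..b} (\<lambda>t. (d t - d a) \<bullet> y)"
      by (simp add: inner_diff_left)
    have "norm (integral {a..b} (\<lambda>t. (d t - d a) \<bullet> y)) \<le> integral {a..b} (\<lambda>t. 2 * B * h * norm y)"
    proof (rule integral_norm_bound_integral[OF dint])
      fix t assume t: "t \<in> {a..b}"
      have "norm (d t - d a) \<le> 2 * B * (t - a)" using d_increment[of a t] t ab by simp
      also have "\<dots> \<le> 2 * B * h" using t B_nonneg by (intro mult_left_mono) (auto simp: h_def)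
      finally show "norm ((d t - d a) \<bullet> y) \<le> 2 * B * h * norm y"
        unfolding real_norm_def by (meson Cauchy_Schwarz_ineq2 mult_right_mono norm_ge_zero order_trans)
    qed auto
    then have "\<bar>integral {a..b} (\<lambda>t. (d t - d a) \<bullet> y)\<bar> \<le> 2 * B * h\<^sup>2 * norm y"
      using ab by (simp add: h_def power2_eq_square mult_ac)
    moreover have "\<bar>integral {a..b} (\<lambda>t. (f2 t - fst (u2 t)) \<bullet> y)\<bar> \<le> \<delta> * h * norm y"
      "\<bar>integral {a..b} (\<lambda>t. (f1 t - fst (u1 t)) \<bullet> y)\<bar> \<le> \<delta> * h * norm y"
      using sol1 sol2 ab unfolding approx_sol_def h_def by auto
    ultimately show "(fst \<phi> - h *\<^sub>R d a) \<bullet> y \<le> (2 * \<delta> * h + 2 * B * h\<^sup>2) * norm y"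
      using eq by (simp add: algebra_simps) 
  qed
  \<comment> \<open>The velocity, damping and flux parts of the difference of the two equations
    tested with \<phi>. Their sum is small because both residuals are multiplied by the norm of
    \<phi>, itself of order \<open>h\<close>.\<close>
  define I1 where "I1 = integral {a..b} (\<lambda>t. (w1 t - w2 t) \<bullet> fst \<phi>)"
  define I2 where "I2 = integral {a..b} (\<lambda>t. \<eta> * (d t \<bullet> fst \<phi>))"
  define I3 where "I3 = integral {a..b} (\<lambda>t. N t \<bullet> snd \<phi>)"
  let ?e1 = "\<lambda>t. w1 t \<bullet> fst \<phi> + \<eta> * ((f1 t - f0) \<bullet> fst \<phi>) + integral {0..t} (\<lambda>s. M (f1 s) (snd (u1 s)) \<bullet> snd \<phi>)"
  let ?e2 = "\<lambda>t. w2 t \<bullet> fst \<phi> + \<eta> * ((f2 t - f0) \<bullet> fst \<phi>) + integral {0..t} (\<lambda>s. M (f2 s) (snd (u2 s)) \<bullet> snd \<phi>)"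
  note i1 = equation_integrable[OF f_cont(1) w_wintble(1) Mg_wintble(1) ab(1,3)]
  note i2 = equation_integrable[OF f_cont(2) w_wintble(2) Mg_wintble(2) ab(1,3)]
  have e12: "?e1 integrable_on {a..b}" "?e2 integrable_on {a..b}"
    by (intro integrable_add i1 i2)+
  have N_inner: "N t \<bullet> y = integral {0..t} (\<lambda>s. M (f1 s) (snd (u1 s)) \<bullet> y) - integral {0..t} (\<lambda>s. M (f2 s) (snd (u2 s)) \<bullet> y)"
    if "0 \<le> t" "t \<le> T" for t y
  proof -
    have "N t \<bullet> y = integral {0..t} (\<lambda>s. \<nu> s \<bullet> y)" unfolding N_def
      using that wintble_subinterval[OF \<nu>_wintble] by (intro wint_inner) auto
    also have "\<dots> = integral {0..t} (\<lambda>s. M (f1 s) (snd (u1 s)) \<bullet> y) - integral {0..t} (\<lambda>s. M (f2 s) (snd (u2 s)) \<bullet> y)"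
      unfolding \<nu>_def inner_diff_left
      using that wintble_subinterval[OF Mg_wintble(1), of 0 t] wintble_subinterval[OF Mg_wintble(2), of 0 t]
      by (intro integral_diff) (auto simp: wintble_def)
    finally show ?thesis .
  qed
  have Nint: "(\<lambda>t. N t \<bullet> snd \<phi>) integrable_on {a..b}"
    by (rule integrable_eq[OF integrable_diff[OF i1(3)[of "snd \<phi>"] i2(3)[of "snd \<phi>"]]]) (use N_inner ab in auto)
  have dint: "(\<lambda>t. \<eta> * (d t \<bullet> fst \<phi>)) integrable_on {a..b}"
    by (rule integrable_eq[OF integrable_diff[OF i1(2)[where c = f0 and p = "fst \<phi>"] i2(2)[where c = f0 and p = "fst \<phi>"]]])
      (auto simp: d_def inner_diff_left algebra_simps)
  have wint: "(\<lambda>t. (w1 t - w2 t) \<bullet> fst \<phi>) integrable_on {a..b}"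
    using integrable_diff[OF i1(1)[of "fst \<phi>"] i2(1)[of "fst \<phi>"]] by (simp add: inner_diff_left)
  have "integral {a..b} ?e1 - integral {a..b} ?e2 = integral {a..b} (\<lambda>t. ?e1 t - ?e2 t)"
    using e12 by (simp add: integral_diff)
  also have "\<dots> = integral {a..b} (\<lambda>t. (w1 t - w2 t) \<bullet> fst \<phi> + \<eta> * (d t \<bullet> fst \<phi>) + N t \<bullet> snd \<phi>)"
    by (rule integral_cong) (use ab N_inner in \<open>auto simp: d_def inner_diff_left algebra_simps\<close>)
  also have "\<dots> = I1 + I2 + I3"
    unfolding I1_def I2_def I3_def using Nint dint wint by (simp add: integral_add integrable_add)
  finally have "I1 + I2 + I3 = integral {a..b} ?e1 - integral {a..b} ?e2" by simp
  moreover have "\<bar>integral {a..b} ?e1\<bar> \<le> \<delta> * h * norm \<phi>" "\<bar>integral {a..b} ?e2\<bar> \<le> \<delta> * h * norm \<phi>"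
    using approx_sol_equation[OF sol1 \<phi>V ab(1) less_imp_le[OF ab(2)] ab(3)]
      approx_sol_equation[OF sol2 \<phi>V ab(1) less_imp_le[OF ab(2)] ab(3)] unfolding h_def by blast+
  moreover have "\<delta> * h * norm \<phi> \<le> \<delta> * h * (2 * B * h)" using \<phi>_norm \<delta>_nonneg h by (intro mult_left_mono) auto
  ultimately have I: "\<bar>I1 + I2 + I3\<bar> \<le> 4 * B * \<delta> * h\<^sup>2" by (simp add: power2_eq_square algebra_simps)
  \<comment> \<open>Here \<phi> does not depend on time, so the velocity difference integrates
    exactly to the increment of \<open>d\<close>; only the replacement of \<open>fst \<phi>\<close>
    by \<open>h *\<^sub>R d a\<close> leaves an error.\<close>
  have I1: "\<bar>I1 - h * (d a \<bullet> (d b - d a))\<bar> \<le> 4 * B * \<delta> * h\<^sup>2 + 4 * B\<^sup>2 * h ^ 3"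
  proof -
    have "I1 = integral {a..b} (\<lambda>t. w1 t \<bullet> fst \<phi>) - integral {a..b} (\<lambda>t. w2 t \<bullet> fst \<phi>)"
      unfolding I1_def inner_diff_left using i1(1) i2(1) by (simp add: integral_diff)
    also have "\<dots> = (d b - d a) \<bullet> fst \<phi>"
      using f_increment[of a b]
       wint_inner[OF wintble_subinterval[OF w_wintble(1), of a b], of "fst \<phi>"]
       wint_inner[OF wintble_subinterval[OF w_wintble(2), of a b], of "fst \<phi>"] ab
      unfolding d_def by (simp add: inner_diff_left algebra_simps)
    finally have "I1 - h * (d a \<bullet> (d b - d a)) = (d b - d a) \<bullet> (fst \<phi> - h *\<^sub>R d a)"
      by (simp add: inner_diff_right inner_diff_left inner_commute algebra_simps)
    also have "\<bar>\<dots>\<bar> \<le> (2 * B * h) * (2 * \<delta> * h + 2 * B * h\<^sup>2)"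
      using d_increment[of a b] ab fst_\<phi> B_nonneg unfolding h_def
      by (intro order_trans[OF Cauchy_Schwarz_ineq2] mult_mono) auto
    finally show ?thesis by (simp add: power2_eq_square power3_eq_cube algebra_simps)
  qed
  have I2: "\<bar>I2\<bar> \<le> h * (\<eta> * ((norm (d a) + 2 * B * h) * (h * (norm (d a) + 2 * \<delta> + 2 * B * h))))"
  proof -
    have nphi: "norm (fst \<phi>) \<le> h * (norm (d a) + 2 * \<delta> + 2 * B * h)"
    proof -
      have "norm (fst \<phi>) \<le> norm (fst \<phi> - h *\<^sub>R d a) + norm (h *\<^sub>R d a)" by (metis diff_add_cancel norm_triangle_ineq)
      then show ?thesis using fst_\<phi> h by (simp add: power2_eq_square algebra_simps)
    qed
    have "norm I2 \<le> integral {a..b} (\<lambda>t. \<eta> * ((norm (d a) + 2 * B * h) * (h * (norm (d a) + 2 * \<delta> + 2 * B * h))))"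
      unfolding I2_def
    proof (rule integral_norm_bound_integral[OF dint])
      fix t assume t: "t \<in> {a..b}"
      have "norm (d t - d a) \<le> 2 * B * (t - a)" using d_increment[of a t] t ab by simp
      also have "\<dots> \<le> 2 * B * h" using t B_nonneg by (intro mult_left_mono) (auto simp: h_def)
      finally have "norm (d t) \<le> norm (d a) + 2 * B * h" using norm_triangle_sub[of "d t" "d a"] by simp
      then have "\<bar>d t \<bullet> fst \<phi>\<bar> \<le> (norm (d a) + 2 * B * h) * (h * (norm (d a) + 2 * \<delta> + 2 * B * h))"
        using nphi B_nonneg h by (intro order_trans[OF Cauchy_Schwarz_ineq2] mult_mono) auto
      then show "norm (\<eta> * (d t \<bullet> fst \<phi>)) \<le> \<eta> * ((norm (d a) + 2 * B * h) * (h * (norm (d a) + 2 * \<delta> + 2 * B * h)))"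
        using eta_nonneg by (simp add: abs_mult mult_left_mono)
    qed auto
    moreover have "integral {a..b} (\<lambda>t. c) = h * c" for c :: real
      unfolding h_def using ab by (subst integral_const_real) simp
    ultimately show ?thesis unfolding real_norm_def by metis
  qed
  have I3: "\<bar>I3 - h * (N a \<bullet> (G b - G a))\<bar> \<le> h * ((2 * M0 * B * h) * (2 * B * h))"
  proof -
    have "I3 - h * (N a \<bullet> (G b - G a)) = integral {a..b} (\<lambda>t. N t \<bullet> snd \<phi>) - integral {a..b} (\<lambda>t. N a \<bullet> snd \<phi>)"
      unfolding I3_def snd_\<phi> using ab by (simp add: h_def)
    also have "\<dots> = integral {a..b} (\<lambda>t. N t \<bullet> snd \<phi> - N a \<bullet> snd \<phi>)"
      by (rule integral_diff[OF Nint, symmetric]) (rule integrable_const_ivl)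
    finally have "I3 - h * (N a \<bullet> (G b - G a)) = integral {a..b} (\<lambda>t. N t \<bullet> snd \<phi> - N a \<bullet> snd \<phi>)" .
    moreover have "norm (integral {a..b} (\<lambda>t. N t \<bullet> snd \<phi> - N a \<bullet> snd \<phi>)) \<le> integral {a..b} (\<lambda>t. (2 * M0 * B * h) * (2 * B * h))"
    proof (rule integral_norm_bound_integral)
      show "(\<lambda>t. N t \<bullet> snd \<phi> - N a \<bullet> snd \<phi>) integrable_on {a..b}" using Nint by (intro integrable_diff) auto
      fix t assume t: "t \<in> {a..b}"
      have "norm (N t - N a) \<le> 2 * M0 * B * (t - a)" using N_lipschitz[of a t] t ab by simp
      also have "\<dots> \<le> 2 * M0 * B * h" using t B_nonneg M0_nonneg by (intro mult_left_mono) (auto simp: h_def)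
      finally have "\<bar>(N t - N a) \<bullet> snd \<phi>\<bar> \<le> (2 * M0 * B * h) * (2 * B * h)"
        using G_lipschitz[of a b] ab B_nonneg M0_nonneg h unfolding snd_\<phi> h_def
        by (intro order_trans[OF Cauchy_Schwarz_ineq2] mult_mono) auto
      then show "norm (N t \<bullet> snd \<phi> - N a \<bullet> snd \<phi>) \<le> (2 * M0 * B * h) * (2 * B * h)"
        by (simp add: inner_diff_left)
    qed auto
    moreover have "integral {a..b} (\<lambda>t. (2 * M0 * B * h) * (2 * B * h)) = h * ((2 * M0 * B * h) * (2 * B * h))"
      unfolding h_def using ab by (subst integral_const_real) simp
    ultimately show ?thesis unfolding real_norm_def by metis
  qed
  define X where "X = d a \<bullet> (d b - d a) + N a \<bullet> (G b - G a)"
  define Y where "Y = 8 * B * \<delta> * h + 4 * B\<^sup>2 * h\<^sup>2 + \<eta> * h * (norm (d a) + 2 * B * h) * (norm (d a) + 2 * \<delta> + 2 * B * h) + 4 * M0 * B\<^sup>2 * h\<^sup>2"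
  \<comment> \<open>The test element has size proportional to \<open>h\<close>, so every term
    carries this factor, which is now divided out.\<close>
  have "h * \<bar>X\<bar> = \<bar>h * X\<bar>" using h by (simp add: abs_mult)
  also have "\<dots> \<le> 4 * B * \<delta> * h\<^sup>2 + (4 * B * \<delta> * h\<^sup>2 + 4 * B\<^sup>2 * h ^ 3) 
      + h * (\<eta> * ((norm (d a) + 2 * B * h) * (h * (norm (d a) + 2 * \<delta> + 2 * B * h)))) + h * ((2 * M0 * B * h) * (2 * B * h))"
    using I I1 I2 I3 unfolding X_def distrib_left by linarith
  also have "\<dots> = h * Y" unfolding Y_def by (simp add: power2_eq_square power3_eq_cube algebra_simps)
  finally have "\<bar>X\<bar> \<le> Y" using h by simp
  then show ?thesis unfolding X_def Y_def .
qed

text \<open>The increments of the first three summands contain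
  \<open>d a \<bullet> (d b - d a) + N a \<bullet> (G b - G a)\<close>, which
  \<open>tested_equation\<close> controls. The mixed term has no sign; the last summand is there to
  dominate it, and its weight is chosen to leave positive parts of both squares.\<close>

definition "F t = (norm (d t))\<^sup>2 / 2 + (M (f1 t) (G t) \<bullet> G t) / 2 + R t \<bullet> G t + 2 / m B * (norm (R t))\<^sup>2"

end

text \<open>\<open>x\<close>, \<open>y\<close>, \<open>z\<close>, \<open>h\<close> stand for the norms of \<open>d\<close>, \<open>G\<close>, \<open>R\<close> at time \<open>a\<close> and for \<open>b - a\<close>; \<open>K\<close> dominates all
  the constants.  The five groups of terms on the left are the errors in the increments of the four
  summands of \<open>F\<close> and in the tested equation.\<close>

lemma increment_arithmetic:
  fixes K h x y z \<delta> :: real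
  assumes K: "1 \<le> K" and h: "0 \<le> h" "h \<le> K" and x: "0 \<le> x" "x \<le> K" and y: "0 \<le> y" "y \<le> K"
    and z: "0 \<le> z" "z \<le> K" and \<delta>: "0 \<le> \<delta>"
  defines "q \<equiv> x\<^sup>2 + y\<^sup>2 + z\<^sup>2" and "D \<equiv> K * h\<^sup>2 + K * h * (x + y)"
  shows "K\<^sup>2 * h\<^sup>2 + (K * h * y\<^sup>2 + 2 * K ^ 4 * h\<^sup>2) + D * (y + K * h) + K * (2 * z * D + D\<^sup>2) +
     (4 * K * \<delta> * h + K\<^sup>2 * h\<^sup>2 + K * h * (x + K * h) * (x + 2 * \<delta> + K * h) + K ^ 3 * h\<^sup>2)
     \<le> 4 * K ^ 3 * h * q + 32 * K ^ 5 * h\<^sup>2 + 8 * K ^ 3 * \<delta> * h"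
proof -
  have pw: "K ^ i \<le> K ^ j" if "i \<le> j" for i j using K that by (rule power_increasing[rotated])
  have h2: "0 \<le> h\<^sup>2" by simp
  have K5: "K ^ i * h\<^sup>2 \<le> K ^ 5 * h\<^sup>2" if "i \<le> 5" for i using pw[OF that] h2 by (rule mult_right_mono)
  have K0: "0 \<le> K" using K by simp
  have t1: "K\<^sup>2 * h\<^sup>2 \<le> K ^ 5 * h\<^sup>2" using K5[of 2] by simp
  have t2: "K * h * y\<^sup>2 + 2 * K ^ 4 * h\<^sup>2 \<le> K\<^sup>2 * h * y\<^sup>2 + 2 * (K ^ 5 * h\<^sup>2)"
  proof -
    have "K * h * y\<^sup>2 \<le> K\<^sup>2 * h * y\<^sup>2" using pw[of 1 2] h by (intro mult_right_mono) auto
    then show ?thesis using K5[of 4] by simp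
  qed
  \<comment> \<open>Since \<open>K\<close> is at least 1 and bounds all the variables, every term
    quadratic in \<open>h\<close> can be reduced to the single monomial
    \<open>K ^ 5 * h\<^sup>2\<close>.\<close>
  have Kx: "K ^ i * h\<^sup>2 * v \<le> K ^ 5 * h\<^sup>2" if "i \<le> 4" "0 \<le> v" "v \<le> K" for i v
  proof -
    have "K ^ i * h\<^sup>2 * v \<le> K ^ i * h\<^sup>2 * K" using that K0 by (intro mult_left_mono) auto
    also have "\<dots> = K ^ Suc i * h\<^sup>2" by simp
    also have "\<dots> \<le> K ^ 5 * h\<^sup>2" using that by (intro K5) auto
    finally show ?thesis .
  qed
  have t3: "D * (y + K * h) \<le> K\<^sup>2 * h * ((x + y) * y) + 4 * (K ^ 5 * h\<^sup>2)"
  proof -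
    have "D * (y + K * h) = K ^ 1 * h\<^sup>2 * y + K ^ 2 * h\<^sup>2 * h + K * h * ((x + y) * y) + K ^ 2 * h\<^sup>2 * x + K ^ 2 * h\<^sup>2 * y"
      unfolding D_def by (simp add: power2_eq_square algebra_simps)
    moreover have "K * h * ((x + y) * y) \<le> K\<^sup>2 * h * ((x + y) * y)" using pw[of 1 2] h x y by (intro mult_right_mono) auto
    ultimately show ?thesis using Kx[of 1 y] Kx[of 2 h] Kx[of 2 x] Kx[of 2 y] x y h by linarith
  qed
  have t4: "K * (2 * z * D + D\<^sup>2) \<le> 2 * (K\<^sup>2 * h * (z * (x + y))) + 11 * (K ^ 5 * h\<^sup>2)"
  proof -
    have "K * (2 * z * D + D\<^sup>2) = 2 * (K ^ 2 * h\<^sup>2 * z) + 2 * (K\<^sup>2 * h * (z * (x + y))) + K ^ 3 * h\<^sup>2 * (h + x + y)\<^sup>2"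
      unfolding D_def by (simp add: power2_eq_square power3_eq_cube algebra_simps)
    moreover have "K ^ 3 * h\<^sup>2 * (h + x + y)\<^sup>2 \<le> 9 * (K ^ 5 * h\<^sup>2)"
    proof -
      have "(h + x + y)\<^sup>2 \<le> (3 * K)\<^sup>2" using h x y by (intro power_mono) auto
      then have "K ^ 3 * h\<^sup>2 * (h + x + y)\<^sup>2 \<le> K ^ 3 * h\<^sup>2 * (3 * K)\<^sup>2" using K0 by (intro mult_left_mono) auto
      also have "\<dots> = 9 * (K ^ 5 * h\<^sup>2)" by (simp add: power2_eq_square eval_nat_numeral)
      finally show ?thesis .
    qed
    ultimately show ?thesis using Kx[of 2 z] z by linarith
  qed
  have t5: "4 * K * \<delta> * h + K\<^sup>2 * h\<^sup>2 + K * h * (x + K * h) * (x + 2 * \<delta> + K * h) + K ^ 3 * h\<^sup>2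
      \<le> K\<^sup>2 * h * x\<^sup>2 + 8 * K ^ 3 * \<delta> * h + 5 * (K ^ 5 * h\<^sup>2)"
  proof -
    have dh: "0 \<le> \<delta> * h" using \<delta> h by simp
    have "K * h * (x + K * h) * (x + 2 * \<delta> + K * h) = K * h * x\<^sup>2 + 2 * (K * x * (\<delta> * h)) + 2 * (K ^ 2 * h\<^sup>2 * x) +
        2 * (K\<^sup>2 * h * (\<delta> * h)) + K ^ 3 * h\<^sup>2 * h"
      by (simp add: power2_eq_square power3_eq_cube algebra_simps)
    moreover have "K * h * x\<^sup>2 \<le> K\<^sup>2 * h * x\<^sup>2" using pw[of 1 2] h by (intro mult_right_mono) auto
    moreover have "K * x * (\<delta> * h) \<le> K ^ 3 * (\<delta> * h)"
    proof -
      have "K * x \<le> K * K" using x K0 by (intro mult_left_mono) auto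
      also have "\<dots> \<le> K ^ 3" using pw[of 2 3] by (simp add: power2_eq_square)
      finally show ?thesis using dh by (rule mult_right_mono)
    qed
    moreover have "K\<^sup>2 * h * (\<delta> * h) \<le> K ^ 3 * (\<delta> * h)"
    proof -
      have "K\<^sup>2 * h \<le> K\<^sup>2 * K" using h by (intro mult_left_mono) auto
      also have "\<dots> = K ^ 3" by (simp add: power2_eq_square power3_eq_cube)
      finally show ?thesis using dh by (rule mult_right_mono)
    qed
    moreover have "K * (\<delta> * h) \<le> K ^ 3 * (\<delta> * h)" using pw[of 1 3] dh by (intro mult_right_mono) auto
    moreover have "4 * K * \<delta> * h = 4 * (K * (\<delta> * h))" "8 * K ^ 3 * \<delta> * h = 8 * (K ^ 3 * (\<delta> * h))" by simp_all
    ultimately show ?thesis using Kx[of 2 x] Kx[of 3 h] K5[of 2] K5[of 3] x h by linarith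
  qed
  \<comment> \<open>The terms linear in \<open>h\<close> and free of \<delta> are quadratic in x, y,
    z; mixed products are absorbed into the squares, so that they can later be bounded by
    \<open>F\<close>.\<close>
  have "y\<^sup>2 + (x + y) * y + 2 * (z * (x + y)) + x\<^sup>2 \<le> 4 * q"
  proof -
    have "y\<^sup>2 + (x + y) * y + 2 * (z * (x + y)) + x\<^sup>2 = x\<^sup>2 + 2 * y\<^sup>2 + x * y + 2 * z * x + 2 * z * y"
      by (simp add: power2_eq_square algebra_simps)
    moreover have "x * y \<le> x\<^sup>2 + y\<^sup>2" using sum_squares_bound[of x y] x y mult_nonneg_nonneg[of x y] by linarith
    ultimately show ?thesis
      using sum_squares_bound[of z x] sum_squares_bound[of z y]
        zero_le_power2[of x] zero_le_power2[of y] zero_le_power2[of z]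
      unfolding q_def distrib_left by linarith
  qed
  then have "K\<^sup>2 * h * (y\<^sup>2 + (x + y) * y + 2 * (z * (x + y)) + x\<^sup>2) \<le> K\<^sup>2 * h * (4 * q)"
    using h by (intro mult_left_mono) auto
  also have "\<dots> \<le> K ^ 3 * h * (4 * q)"
    using pw[of 2 3] h by (intro mult_right_mono) (auto simp: q_def)
  finally have "K\<^sup>2 * h * y\<^sup>2 + K\<^sup>2 * h * ((x + y) * y) + 2 * (K\<^sup>2 * h * (z * (x + y))) + K\<^sup>2 * h * x\<^sup>2 \<le> 4 * K ^ 3 * h * q"
    by (simp add: algebra_simps)
  moreover have "0 \<le> K ^ 5 * h\<^sup>2" using K0 by simp
  ultimately show ?thesis using t1 t2 t3 t4 t5 by linarith
qed

text \<open>A sum of nonnegative quantities, so that it dominates each of them. The summands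
  \<open>2\<close>, \<open>4 / m B\<close> and \<open>m B\<close> compensate the three weights in
  \<open>F_lower\<close>, and \<open>T\<close> bounds the interval lengths. It depends on no
  particular solution, which makes the estimate uniform along the scheme.\<close>

definition (in wave) stab_const :: "real \<Rightarrow> real \<Rightarrow> real" where
  "stab_const B T = 2 + 2 * B + 4 * B\<^sup>2 * L B + B * L B + M0 + \<eta> + 4 / m B + m B + T + 2 * B * T + 4 * M0 * B * T"

context wave_pair
begin

abbreviation "K \<equiv> stab_const B T"

lemma K_bounds: "2 \<le> K" "2 * B \<le> K" "4 * B\<^sup>2 * L B \<le> K" "B * L B \<le> K" "M0 \<le> K" "\<eta> \<le> K"
  "4 / m B \<le> K" "m B \<le> K" "T \<le> K" "2 * B * T \<le> K" "4 * M0 * B * T \<le> K"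
proof -
  have "0 \<le> 2 * B" "0 \<le> 4 * B\<^sup>2 * L B" "0 \<le> B * L B" "0 \<le> 4 / m B" "0 \<le> m B" "0 \<le> 2 * B * T" "0 \<le> 4 * M0 * B * T"
    using B_nonneg L_nonneg M0_nonneg T_nonneg m_pos[of B] by (auto intro!: mult_nonneg_nonneg)
  note p = this M0_nonneg eta_nonneg T_nonneg
  show "2 \<le> K" "2 * B \<le> K" "4 * B\<^sup>2 * L B \<le> K" "B * L B \<le> K" "M0 \<le> K" "\<eta> \<le> K"
  "4 / m B \<le> K" "m B \<le> K" "T \<le> K" "2 * B * T \<le> K" "4 * M0 * B * T \<le> K"
    using p unfolding stab_const_def by linarith+
qed

text \<open>Each summand of \<open>F\<close> is expanded at \<open>a\<close>. The first order terms
  combine to the tested equation; every other term is either quadratic in \<open>b - a\<close> or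
  \<open>b - a\<close> times a quadratic expression in the values at \<open>a\<close>.\<close>

lemma F_increment:
  assumes ab: "0 \<le> a" "a < b" "b \<le> T"
  shows "F b - F a \<le> 4 * K ^ 3 * (b - a) * ((norm (d a))\<^sup>2 + (norm (G a))\<^sup>2 + (norm (R a))\<^sup>2) +
     32 * K ^ 5 * (b - a)\<^sup>2 + 8 * K ^ 3 * \<delta> * (b - a)"
proof -
  define h where "h = b - a"
  have h: "0 \<le> h" "h \<le> K" "h \<le> T" using ab K_bounds(9) by (auto simp: h_def)
  define x where "x = norm (d a)"
  define y where "y = norm (G a)"
  define z where "z = norm (R a)"
  have K1: "1 \<le> K" "0 \<le> K" using K_bounds(1) by auto
  have x: "0 \<le> x" "x \<le> K" unfolding x_def using size_bounds(1)[of a] ab K_bounds(2) by auto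
  have y: "0 \<le> y" "y \<le> K" unfolding y_def using size_bounds(2)[of a] ab K_bounds(10) by auto
  have z: "0 \<le> z" "z \<le> K" unfolding z_def using size_bounds(3)[of a] ab K_bounds(11) by auto
  define D where "D = K * h\<^sup>2 + K * h * (x + y)"
  define dd where "dd = d b - d a"
  define dG where "dG = G b - G a"
  define dR where "dR = R b - R a"
  have dd: "norm dd \<le> K * h"
  proof -
    have "norm dd \<le> 2 * B * h" using d_increment[of a b] ab by (simp add: dd_def h_def)
    also have "\<dots> \<le> K * h" using K_bounds(2) h by (intro mult_right_mono)
    finally show ?thesis .
  qed
  have dG: "norm dG \<le> K * h"
  proof -
    have "norm dG \<le> 2 * B * h" using G_lipschitz[of a b] ab by (simp add: dG_def h_def)
    also have "\<dots> \<le> K * h" using K_bounds(2) h by (intro mult_right_mono)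
    finally show ?thesis .
  qed
  have dR: "norm dR \<le> D"
  proof -
    have "norm dR \<le> 4 * B\<^sup>2 * L B * h\<^sup>2 + B * L B * h * (x + y)"
      using R_increment[of a b] ab by (simp add: dR_def h_def x_def y_def)
    also have "\<dots> \<le> D" unfolding D_def using K_bounds(3,4) h x y
      by (intro add_mono mult_right_mono) auto
    finally show ?thesis .
  qed
  have D0: "0 \<le> D" using dR norm_ge_zero order_trans by blast
  have s1: "(norm (d b))\<^sup>2 / 2 - (norm (d a))\<^sup>2 / 2 \<le> d a \<bullet> dd + K\<^sup>2 * h\<^sup>2"
  proof -
    have "d b = d a + dd" by (simp add: dd_def)
    then have "(norm (d b))\<^sup>2 = (norm (d a))\<^sup>2 + 2 * (d a \<bullet> dd) + (norm dd)\<^sup>2"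
      by (simp add: power2_norm_eq_inner inner_add_left inner_add_right inner_commute)
    moreover have "(norm dd)\<^sup>2 \<le> (K * h)\<^sup>2" using dd by (intro power_mono) auto
    moreover have "0 \<le> (K * h)\<^sup>2" by simp
    ultimately show ?thesis unfolding power_mult_distrib by linarith
  qed
  have s2: "(M (f1 b) (G b) \<bullet> G b) / 2 - (M (f1 a) (G a) \<bullet> G a) / 2 \<le> M (f1 a) (G a) \<bullet> dG + (K * h * y\<^sup>2 + 2 * K ^ 4 * h\<^sup>2)"
  proof -
    have Gb: "G b = G a + dG" by (simp add: dG_def)
    have "M (f1 b) (G b) \<bullet> G b - M (f1 a) (G a) \<bullet> G a =
        (M (f1 b) (G b) - M (f1 a) (G b)) \<bullet> G b + 2 * (M (f1 a) (G a) \<bullet> dG) + M (f1 a) dG \<bullet> dG"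
      unfolding Gb by (simp add: M_add inner_add_left inner_add_right inner_diff_left M_sym[of "f1 a" dG "G a"]
          inner_commute[of dG "M (f1 a) (G a)"])
    moreover have "(M (f1 b) (G b) - M (f1 a) (G b)) \<bullet> G b \<le> K * h * (2 * y\<^sup>2 + 2 * K\<^sup>2 * h\<^sup>2)"
    proof -
      have "norm (M (f1 b) (G b) - M (f1 a) (G b)) \<le> L B * norm (f1 b - f1 a) * norm (G b)"
        by (rule M_lipschitz) (use f_bound ab in auto)
      also have "\<dots> \<le> L B * (B * h) * norm (G b)"
        using f_lipschitz[of a b] ab L_nonneg unfolding h_def by (intro mult_right_mono mult_left_mono) auto
      also have "\<dots> \<le> K * h * norm (G b)"
        using mult_right_mono[OF K_bounds(4) h(1)] by (intro mult_right_mono) (auto simp: mult_ac)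
      finally have 1: "(M (f1 b) (G b) - M (f1 a) (G b)) \<bullet> G b \<le> K * h * norm (G b) * norm (G b)"
        by (meson Cauchy_Schwarz_ineq2 abs_le_D1 mult_right_mono norm_ge_zero order_trans)
      have "norm (G b) \<le> y + K * h" unfolding Gb y_def using norm_triangle_ineq[of "G a" dG] dG by simp
      then have "(norm (G b))\<^sup>2 \<le> (y + K * h)\<^sup>2" by (intro power_mono) auto
      also have "\<dots> \<le> 2 * y\<^sup>2 + 2 * K\<^sup>2 * h\<^sup>2" using sum_squares_bound[of y "K * h"]
        unfolding power2_sum power_mult_distrib by linarith
      finally have "K * h * (norm (G b))\<^sup>2 \<le> K * h * (2 * y\<^sup>2 + 2 * K\<^sup>2 * h\<^sup>2)" using K1 h by (intro mult_left_mono) auto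
      with 1 show ?thesis by (simp add: power2_eq_square mult_ac)
    qed
    moreover have "M (f1 a) dG \<bullet> dG \<le> K ^ 3 * h\<^sup>2"
    proof -
      have "M (f1 a) dG \<bullet> dG \<le> norm (M (f1 a) dG) * norm dG" by (rule norm_cauchy_schwarz)
      also have "\<dots> \<le> (K * norm dG) * norm dG"
        using M_bound[of "f1 a" dG] mult_right_mono[OF K_bounds(5), of "norm dG"] by (intro mult_right_mono) auto
      also have "\<dots> \<le> (K * (K * h)) * (K * h)" using dG K1 h by (intro mult_mono mult_left_mono) auto
      finally show ?thesis by (simp add: power2_eq_square power3_eq_cube mult_ac)
    qed
    moreover have "K * h * (2 * y\<^sup>2 + 2 * K\<^sup>2 * h\<^sup>2) = 2 * (K * h * y\<^sup>2) + 2 * (K ^ 3 * h\<^sup>2 * h)"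
      by (simp add: power2_eq_square power3_eq_cube algebra_simps)
    moreover have "K ^ 3 * h\<^sup>2 * h \<le> K ^ 4 * h\<^sup>2"
    proof -
      have "K ^ 3 * h\<^sup>2 * h \<le> K ^ 3 * h\<^sup>2 * K" using h K1 by (intro mult_left_mono) auto
      then show ?thesis by (simp add: eval_nat_numeral mult_ac)
    qed
    moreover have "0 \<le> K ^ 4 * h\<^sup>2" using K1 by simp
    moreover have "K ^ 3 * h\<^sup>2 \<le> K ^ 4 * h\<^sup>2" using K1 by (intro mult_right_mono power_increasing) auto
    ultimately show ?thesis by linarith
  qed
  have s3: "R b \<bullet> G b - R a \<bullet> G a \<le> R a \<bullet> dG + D * (y + K * h)"
  proof -
    have "R b \<bullet> G b - R a \<bullet> G a = R a \<bullet> dG + dR \<bullet> G b"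
      unfolding dR_def dG_def by (simp add: inner_diff_left inner_diff_right)
    moreover have "dR \<bullet> G b \<le> D * (y + K * h)"
    proof -
      have "norm (G b) \<le> y + K * h"
        using norm_triangle_ineq[of "G a" dG] dG unfolding dG_def y_def by simp
      then show ?thesis using dR D0 by (intro order_trans[OF norm_cauchy_schwarz] mult_mono) auto
    qed
    ultimately show ?thesis by simp
  qed
  have s4: "2 / m B * (norm (R b))\<^sup>2 - 2 / m B * (norm (R a))\<^sup>2 \<le> K * (2 * z * D + D\<^sup>2)"
  proof -
    have "norm (R b) \<le> z + D" unfolding z_def
      using norm_triangle_ineq[of "R a" dR] dR unfolding dR_def by simp
    then have "(norm (R b))\<^sup>2 \<le> (z + D)\<^sup>2" by (intro power_mono) auto
    then have 1: "(norm (R b))\<^sup>2 - (norm (R a))\<^sup>2 \<le> 2 * z * D + D\<^sup>2" unfolding z_def by (simp add: power2_sum)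
    have m: "2 / m B \<le> K" "0 \<le> 2 / m B" using K_bounds(7) m_pos[of B] by (auto simp: field_simps)
    have "2 / m B * (norm (R b))\<^sup>2 - 2 / m B * (norm (R a))\<^sup>2 = 2 / m B * ((norm (R b))\<^sup>2 - (norm (R a))\<^sup>2)"
      by (simp add: right_diff_distrib)
    also have "\<dots> \<le> 2 / m B * (2 * z * D + D\<^sup>2)" using 1 m by (intro mult_left_mono)
    also have "\<dots> \<le> K * (2 * z * D + D\<^sup>2)" using m z D0 by (intro mult_right_mono) auto
    finally show ?thesis .
  qed
  have s5: "d a \<bullet> dd + N a \<bullet> dG \<le> 4 * K * \<delta> * h + K\<^sup>2 * h\<^sup>2 + K * h * (x + K * h) * (x + 2 * \<delta> + K * h) + K ^ 3 * h\<^sup>2"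
  proof -
    have "d a \<bullet> dd + N a \<bullet> dG \<le> 8 * B * \<delta> * h + 4 * B\<^sup>2 * h\<^sup>2 + \<eta> * h * (x + 2 * B * h) * (x + 2 * \<delta> + 2 * B * h) + 4 * M0 * B\<^sup>2 * h\<^sup>2"
      using tested_equation[OF ab] unfolding dd_def dG_def h_def x_def by linarith
    also have "8 * B * \<delta> * h \<le> 4 * K * \<delta> * h"
      using K_bounds(2) h \<delta>_nonneg by (intro mult_right_mono) auto
    also have B2: "4 * B\<^sup>2 \<le> K\<^sup>2" using power_mono[OF K_bounds(2), of 2] B_nonneg by (simp add: power_mult_distrib)
    then have "4 * B\<^sup>2 * h\<^sup>2 \<le> K\<^sup>2 * h\<^sup>2" by (intro mult_right_mono) auto
    also have "4 * M0 * B\<^sup>2 * h\<^sup>2 \<le> K ^ 3 * h\<^sup>2"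
    proof -
      have "M0 * (4 * B\<^sup>2) \<le> K * K\<^sup>2" using K_bounds(5) B2 M0_nonneg K1 by (intro mult_mono) auto
      from mult_right_mono[OF this, of "h\<^sup>2"] show ?thesis by (simp add: power2_eq_square power3_eq_cube mult_ac)
    qed
    also have "\<eta> * h * (x + 2 * B * h) * (x + 2 * \<delta> + 2 * B * h) \<le> K * h * (x + K * h) * (x + 2 * \<delta> + K * h)"
    proof -
      have Bh: "2 * B * h \<le> K * h" using K_bounds(2) h by (intro mult_right_mono) auto
      then show ?thesis
        using K_bounds(6) eta_nonneg h x \<delta>_nonneg B_nonneg K1 by (intro mult_mono) (auto intro!: add_nonneg_nonneg mult_nonneg_nonneg)
    qed
    finally show ?thesis by simp
  qed
  have "F b - F a \<le> (d a \<bullet> dd + (M (f1 a) (G a) \<bullet> dG + R a \<bullet> dG)) + (K\<^sup>2 * h\<^sup>2 + (K * h * y\<^sup>2 + 2 * K ^ 4 * h\<^sup>2) + D * (y + K * h) + K * (2 * z * D + D\<^sup>2))"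
    using s1 s2 s3 s4 unfolding F_def by linarith
  \<comment> \<open>The point of introducing \<open>R\<close>: the first order terms of the second
    and third summand add up to the full flux integral \<open>N a\<close>.\<close>
  also have "M (f1 a) (G a) \<bullet> dG + R a \<bullet> dG = N a \<bullet> dG" unfolding R_def by (simp add: inner_diff_left)
  finally have "F b - F a \<le> K\<^sup>2 * h\<^sup>2 + (K * h * y\<^sup>2 + 2 * K ^ 4 * h\<^sup>2) + D * (y + K * h) + K * (2 * z * D + D\<^sup>2) +
     (4 * K * \<delta> * h + K\<^sup>2 * h\<^sup>2 + K * h * (x + K * h) * (x + 2 * \<delta> + K * h) + K ^ 3 * h\<^sup>2)"
    using s5 by linarith
  also have "\<dots> \<le> 4 * K ^ 3 * h * (x\<^sup>2 + y\<^sup>2 + z\<^sup>2) + 32 * K ^ 5 * h\<^sup>2 + 8 * K ^ 3 * \<delta> * h"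
    unfolding D_def by (rule increment_arithmetic) (use K1 h x y z \<delta>_nonneg in auto)
  finally show ?thesis unfolding x_def y_def z_def h_def .
qed

text \<open>Coercivity of \<open>M (f1 t)\<close> and completion of the square in the mixed term
  leave half of \<open>norm (d t)\<close> squared, \<open>m B / 4\<close> times that of
  \<open>G t\<close> and \<open>1 / m B\<close> times that of \<open>R t\<close>; multiplication by
  \<open>K\<close> makes all these weights at least 1.\<close>

lemma F_lower:
  assumes t: "0 \<le> t" "t \<le> T"
  shows "(norm (d t))\<^sup>2 + (norm (G t))\<^sup>2 + (norm (R t))\<^sup>2 \<le> K * F t"
proof -
  define mm where "mm = m B"
  have mm: "mm > 0" unfolding mm_def by (rule m_pos)
  define x where "x = norm (d t)"
  define y where "y = norm (G t)"
  define z where "z = norm (R t)"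
  have K2: "1 / 2 * K \<ge> 1" "mm / 4 * K \<ge> 1" "1 / mm * K \<ge> 1"
    using K_bounds(1,7,8) mm unfolding mm_def[symmetric] by (auto simp: field_simps)
  have "M (f1 t) (G t) \<bullet> G t \<ge> mm * y\<^sup>2" unfolding mm_def y_def
    by (rule M_coercive) (use f_bound t in auto)
  moreover have "R t \<bullet> G t \<ge> - (z * y)" unfolding z_def y_def
    using Cauchy_Schwarz_ineq2[of "R t" "G t"] by linarith
  ultimately have "F t \<ge> x\<^sup>2 / 2 + mm * y\<^sup>2 / 2 - z * y + 2 / mm * z\<^sup>2"
    unfolding F_def x_def z_def mm_def by linarith
  moreover have "mm * y\<^sup>2 / 2 - z * y + 2 / mm * z\<^sup>2 = mm / 4 * y\<^sup>2 + 1 / mm * z\<^sup>2 + (mm * y / 2 - z)\<^sup>2 / mm"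
    using mm by (simp add: power2_eq_square field_simps)
  moreover have "(mm * y / 2 - z)\<^sup>2 / mm \<ge> 0" using mm by simp
  ultimately have "F t \<ge> 1 / 2 * x\<^sup>2 + mm / 4 * y\<^sup>2 + 1 / mm * z\<^sup>2" by linarith
  then have "K * (1 / 2 * x\<^sup>2 + mm / 4 * y\<^sup>2 + 1 / mm * z\<^sup>2) \<le> K * F t" using K_bounds(1) by (intro mult_left_mono) auto
  moreover have "K * (1 / 2 * x\<^sup>2 + mm / 4 * y\<^sup>2 + 1 / mm * z\<^sup>2) = (1 / 2 * K) * x\<^sup>2 + (mm / 4 * K) * y\<^sup>2 + (1 / mm * K) * z\<^sup>2"
    by (simp add: algebra_simps)
  moreover have "x\<^sup>2 \<le> (1 / 2 * K) * x\<^sup>2" "y\<^sup>2 \<le> (mm / 4 * K) * y\<^sup>2" "z\<^sup>2 \<le> (1 / mm * K) * z\<^sup>2"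
    using mult_right_mono[OF K2(1), of "x\<^sup>2"] mult_right_mono[OF K2(2), of "y\<^sup>2"] mult_right_mono[OF K2(3), of "z\<^sup>2"]
    by simp_all
  ultimately show ?thesis unfolding x_def y_def z_def by linarith
qed

text \<open>The growth rate \<open>4 * K ^ 4\<close> is the factor \<open>4 * K ^ 3\<close> of
  \<open>F_increment\<close> times the \<open>K\<close> of \<open>F_lower\<close>. The bound is
  linear in \<delta>: it gives equality for exact solutions and a Cauchy estimate for approximate
  ones.\<close>

theorem stability:
  assumes t: "0 \<le> t" "t \<le> T"
  shows "(norm (f1 t - f2 t))\<^sup>2 \<le> K * (8 * K ^ 3 * T * exp (4 * K ^ 4 * T)) * \<delta>"
proof -
  have K0: "0 \<le> K" using K_bounds(1) by simp
  have "F t \<le> 8 * K ^ 3 * \<delta> * t * exp (4 * K ^ 4 * t)"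
  proof (rule increment_gronwall[where T = T and C = "32 * K ^ 5"])
    fix a b assume ab: "0 \<le> a" "a \<le> b" "b \<le> T"
    show "F b - F a \<le> 4 * K ^ 4 * (b - a) * F a + 32 * K ^ 5 * (b - a)\<^sup>2 + 8 * K ^ 3 * \<delta> * (b - a)"
    proof (cases "a = b")
      case False
      then have "4 * K ^ 3 * (b - a) * ((norm (d a))\<^sup>2 + (norm (G a))\<^sup>2 + (norm (R a))\<^sup>2) \<le> 4 * K ^ 3 * (b - a) * (K * F a)"
        using F_lower[of a] ab K0 by (intro mult_left_mono) auto
      also have "\<dots> = 4 * K ^ 4 * (b - a) * F a" by (simp add: eval_nat_numeral mult_ac)
      finally show ?thesis using F_increment[of a b] ab False by linarith
    qed simp
  qed (use t K0 \<delta>_nonneg zero_at_0 in \<open>auto simp: F_def\<close>)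
  also have "\<dots> \<le> 8 * K ^ 3 * \<delta> * T * exp (4 * K ^ 4 * T)"
    using t K0 \<delta>_nonneg by (intro mult_mono) (auto intro!: mult_left_mono)
  finally have 1: "K * F t \<le> K * (8 * K ^ 3 * \<delta> * T * exp (4 * K ^ 4 * T))" using K0 by (intro mult_left_mono)
  have "(norm (f1 t - f2 t))\<^sup>2 \<le> K * F t"
    using F_lower[OF t] zero_le_power2[of "norm (G t)"] zero_le_power2[of "norm (R t)"] unfolding d_def by linarith
  also note 1
  finally show ?thesis by (simp add: mult_ac)
qed

end

theorem (in wave) approx_sol_stable:
  assumes "approx_sol \<delta> B T f0 f1 u1 w1" "approx_sol \<delta> B T f0 f2 u2 w2" "0 \<le> \<delta>" "0 \<le> t" "t \<le> T"
  shows "(norm (f1 t - f2 t))\<^sup>2 \<le> stab_const B T * (8 * stab_const B T ^ 3 * T * exp (4 * stab_const B T ^ 4 * T)) * \<delta>"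
proof -
  interpret wave_pair V M M0 L m \<eta> \<delta> B T f0 f1 u1 w1 f2 u2 w2
    by unfold_locales (use assms in auto)
  show ?thesis by (rule stability) (use assms in auto)
qed

section \<open>The implicit Euler scheme\<close>

text \<open>The index equals j on the interval from (j - 1) \<tau>, excluded, to j \<tau>, included.
  Hence the sum starts at 1, and \<open>c 0\<close> is attained only at time 0 and does not
  count.\<close>

lemma step_has_integral:
  fixes c :: "nat \<Rightarrow> real"
  assumes "\<tau> > 0"
  shows "((\<lambda>t. c (nat \<lceil>t / \<tau>\<rceil>)) has_integral \<tau> * (\<Sum>j=1..n. c j)) {0..real n * \<tau>}"
proof (induction n)
  case 0
  show ?case using has_integral_refl(2)[of _ "0::real"] by simp
next
  case (Suc n)
  have "((\<lambda>t. c (nat \<lceil>t / \<tau>\<rceil>)) has_integral \<tau> * c (Suc n)) {real n * \<tau>..real (Suc n) * \<tau>}"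
  proof (rule has_integral_spike_finite[of "{real n * \<tau>}" _ _ "\<lambda>t. c (Suc n)"])
    fix t assume t: "t \<in> {real n * \<tau>..real (Suc n) * \<tau>} - {real n * \<tau>}"
    have "\<lceil>t / \<tau>\<rceil> = int (Suc n)" using t assms by (intro ceiling_unique) (auto simp: field_simps)
    then show "c (nat \<lceil>t / \<tau>\<rceil>) = c (Suc n)" by (simp only: nat_int)
  next
    show "((\<lambda>t. c (Suc n)) has_integral \<tau> * c (Suc n)) {real n * \<tau>..real (Suc n) * \<tau>}"
      using has_integral_const_real[of "c (Suc n)" "real n * \<tau>" "real (Suc n) * \<tau>"] assms
      by (simp add: algebra_simps)
  qed simp
  then have "((\<lambda>t. c (nat \<lceil>t / \<tau>\<rceil>)) has_integral \<tau> * (\<Sum>j=1..n. c j) + \<tau> * c (Suc n)) {0..real (Suc n) * \<tau>}"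
    using Suc assms by (intro has_integral_combine[where c = "real n * \<tau>"]) auto
  then show ?case by (simp add: distrib_left)
qed

lemma subspace_closure:
  fixes S :: "'a::real_normed_vector set"
  assumes "subspace S" shows "subspace (closure S)"
  unfolding subspace_def
proof (intro conjI ballI allI)
  show "0 \<in> closure S" using subspace_0[OF assms] closure_subset by blast
  fix x assume "x \<in> closure S"
  then obtain X where X: "\<And>n. X n \<in> S" "X \<longlonglongrightarrow> x" unfolding closure_sequential by blast
  show "c *\<^sub>R x \<in> closure S" for c
    unfolding closure_sequential using X assms
    by (intro exI[of _ "\<lambda>n. c *\<^sub>R X n"]) (auto intro: subspace_scale tendsto_intros)
  fix y assume "y \<in> closure S"
  then obtain Y where Y: "\<And>n. Y n \<in> S" "Y \<longlonglongrightarrow> y" unfolding closure_sequential by blast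
  show "x + y \<in> closure S"
    unfolding closure_sequential using X Y assms
    by (intro exI[of _ "\<lambda>n. X n + Y n"]) (auto intro: subspace_add tendsto_intros)
qed

context wave
begin

lemma M_bounded_linear: "bounded_linear (M f)"
  by (rule bounded_linear_intro[where K = M0])
    (use M_linear[of f] M_bound[of f] in \<open>auto simp: linear_add linear_scale mult.commute\<close>)

lemma M_nonneg: "0 \<le> M f x \<bullet> x"
  using M_coercive[of f "norm f" x] m_pos[of "norm f"]
  by (meson less_imp_le mult_nonneg_nonneg order_refl order_trans zero_le_power2)

text \<open>The coefficient is frozen at the old state, which makes a time step a linear, symmetric
  and coercive problem on \<open>V\<close>. The number \<alpha> collects the factors of
  \<open>fst x\<close> from inertia and damping, so coercivity holds in both components.\<close>

lemma implicit_step_exists: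
  fixes u :: "'h \<times> 'g"
  assumes \<tau>: "\<tau> > 0"
  shows "\<exists>x\<in>V. \<forall>\<phi>\<in>V. (1 / \<tau>) * (((1 / \<tau>) *\<^sub>R (fst x - fst u) - v) \<bullet> fst \<phi>) +
     \<eta> * (((1 / \<tau>) *\<^sub>R (fst x - fst u)) \<bullet> fst \<phi>) + M (fst u) (snd x) \<bullet> snd \<phi> = 0"
proof -
  define \<alpha> where "\<alpha> = 1 / \<tau>\<^sup>2 + \<eta> / \<tau>"
  have \<alpha>: "\<alpha> > 0" unfolding \<alpha>_def using \<tau> eta_nonneg by (intro add_pos_nonneg) auto
  define S where "S z = (\<alpha> *\<^sub>R fst z, M (fst u) (snd z))" for z :: "'h \<times> 'g"
  define l where "l z = (\<alpha> *\<^sub>R fst u + (1 / \<tau>) *\<^sub>R v) \<bullet> fst z" for z :: "'h \<times> 'g"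
  define c where "c = min \<alpha> (m (norm (fst u)))"
  have "\<exists>x\<in>V. \<forall>\<phi>\<in>V. S x \<bullet> \<phi> = l \<phi>"
  proof (rule lax_milgram_symmetric[OF V_subspace V_closed, where c = c])
    show "bounded_linear S" unfolding S_def
      by (intro bounded_linear_Pair bounded_linear_compose[OF bounded_linear_scaleR_right bounded_linear_fst]
          bounded_linear_compose[OF M_bounded_linear bounded_linear_snd])
    show "bounded_linear l" unfolding l_def
      by (rule bounded_linear_compose[OF bounded_linear_inner_right bounded_linear_fst])
    show "S x \<bullet> y = x \<bullet> S y" for x y unfolding S_def by (simp add: inner_prod_def M_sym)
    show "c > 0" unfolding c_def using \<alpha> m_pos by simp
    show "c * (norm x)\<^sup>2 \<le> S x \<bullet> x" for x
    proof -
      have "c * (norm (snd x))\<^sup>2 \<le> m (norm (fst u)) * (norm (snd x))\<^sup>2"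
        unfolding c_def by (intro mult_right_mono) auto
      also have "\<dots> \<le> M (fst u) (snd x) \<bullet> snd x" by (rule M_coercive) simp
      finally have "c * (norm (snd x))\<^sup>2 \<le> M (fst u) (snd x) \<bullet> snd x" .
      moreover have "c * (norm (fst x))\<^sup>2 \<le> \<alpha> * (norm (fst x))\<^sup>2" unfolding c_def by (intro mult_right_mono) auto
      ultimately show ?thesis unfolding S_def
        by (simp add: norm_prod_def inner_prod_def power2_norm_eq_inner distrib_left)
    qed
  qed
  then obtain x where x: "x \<in> V" "\<And>\<phi>. \<phi> \<in> V \<Longrightarrow> S x \<bullet> \<phi> = l \<phi>" by blast
  show ?thesis
  proof (intro bexI ballI)
    fix \<phi> assume "\<phi> \<in> V"
    from x(2)[OF this] have "\<alpha> * (fst x \<bullet> fst \<phi>) + M (fst u) (snd x) \<bullet> snd \<phi> = \<alpha> * (fst u \<bullet> fst \<phi>) + (1 / \<tau>) * (v \<bullet> fst \<phi>)"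
      unfolding S_def l_def by (simp add: inner_prod_def inner_add_left)
    then show "(1 / \<tau>) * (((1 / \<tau>) *\<^sub>R (fst x - fst u) - v) \<bullet> fst \<phi>) +
     \<eta> * (((1 / \<tau>) *\<^sub>R (fst x - fst u)) \<bullet> fst \<phi>) + M (fst u) (snd x) \<bullet> snd \<phi> = 0"
      unfolding \<alpha>_def by (simp add: inner_diff_left power2_eq_square algebra_simps add_divide_distrib diff_divide_distrib)
  qed (rule x(1))
qed

lemma implicit_scheme_exists:
  assumes "\<tau> > 0" "e0 \<in> V"
  shows "\<exists>U v. U 0 = e0 \<and> v 0 = 0 \<and> (\<forall>n. U n \<in> V) \<and> (\<forall>n. v (Suc n) = (1 / \<tau>) *\<^sub>R (fst (U (Suc n)) - fst (U n))) \<and>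
    (\<forall>n. \<forall>\<phi>\<in>V. (1 / \<tau>) * ((v (Suc n) - v n) \<bullet> fst \<phi>) + \<eta> * (v (Suc n) \<bullet> fst \<phi>) +
       M (fst (U n)) (snd (U (Suc n))) \<bullet> snd \<phi> = 0)"
proof -
  obtain X where X: "\<And>(u :: 'h \<times> 'g) v. X u v \<in> V"
     "\<And>(u :: 'h \<times> 'g) v \<phi>. \<phi> \<in> V \<Longrightarrow> (1 / \<tau>) * (((1 / \<tau>) *\<^sub>R (fst (X u v) - fst u) - v) \<bullet> fst \<phi>) +
     \<eta> * (((1 / \<tau>) *\<^sub>R (fst (X u v) - fst u)) \<bullet> fst \<phi>) + M (fst u) (snd (X u v)) \<bullet> snd \<phi> = 0"
    using implicit_step_exists[OF assms(1)] by metis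
  define st where "st = rec_nat (e0, 0) (\<lambda>n (u, v). (X u v, (1 / \<tau>) *\<^sub>R (fst (X u v) - fst u)))"
  have st: "st 0 = (e0, 0)" "st (Suc n) = (X (fst (st n)) (snd (st n)), (1 / \<tau>) *\<^sub>R (fst (X (fst (st n)) (snd (st n))) - fst (fst (st n))))" for n
    unfolding st_def by (simp_all split: prod.split)
  have "fst (st n) \<in> V" for n using X(1) assms(2) st by (cases n) auto
  moreover have "(1 / \<tau>) * ((snd (st (Suc n)) - snd (st n)) \<bullet> fst \<phi>) + \<eta> * (snd (st (Suc n)) \<bullet> fst \<phi>) +
     M (fst (fst (st n))) (snd (fst (st (Suc n)))) \<bullet> snd \<phi> = 0" if "\<phi> \<in> V" for n \<phi>
    using X(2)[OF that, of "fst (st n)" "snd (st n)"] by (simp only: st(2) fst_conv snd_conv)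
  moreover have "snd (st (Suc n)) = (1 / \<tau>) *\<^sub>R (fst (fst (st (Suc n))) - fst (fst (st n)))" for n
    by (simp only: st(2) fst_conv snd_conv)
  ultimately show ?thesis using st(1)
    by (intro exI[of _ "\<lambda>n. fst (st n)"] exI[of _ "\<lambda>n. snd (st n)"]) simp
qed

text \<open>The initial energy is at most \<open>M0 * r\<^sup>2\<close>, as the initial velocity is
  zero; the added 1 is the growth tolerated during the life span. The rate below is a coefficient
  change, \<open>L\<close> times a velocity bound, acting on a squared gradient bounded by energy
  over coercivity, with constants taken on the ball of radius \<open>r + 1\<close>.\<close>

definition "energy_bound r = M0 * r\<^sup>2 + 1"
definition "energy_rate r = L (r + 1) * sqrt (energy_bound r) * energy_bound r / m (r + 1)"
definition "size_bound r = (r + 1) + sqrt (energy_bound r) + sqrt (energy_bound r / m (r + 1))"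
text \<open>The first bound lets the state move by at most 1, so that it stays in the ball where
  \<open>L\<close> and \<open>m\<close> were evaluated; the second lets the energy grow by at most
  1. Adding 1 to the rate avoids a zero denominator.\<close>

definition "life r = min (1 / sqrt (energy_bound r)) (1 / (energy_rate r + 1))"

lemma energy_bound_ge_1: "1 \<le> energy_bound r"
  unfolding energy_bound_def using M0_nonneg by simp

lemma energy_rate_nonneg: "0 \<le> energy_rate r"
  unfolding energy_rate_def using L_nonneg m_pos[of "r + 1"] energy_bound_ge_1[of r] by simp

lemma life_pos: "0 < life r"
  unfolding life_def using energy_bound_ge_1[of r] energy_rate_nonneg[of r] by simp

lemma life_bounds:
  assumes "0 \<le> T" "T < life r"
  shows "T * sqrt (energy_bound r) \<le> 1" "T * energy_rate r \<le> 1"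
proof -
  have s: "0 < sqrt (energy_bound r)" using energy_bound_ge_1[of r] by simp
  have "T \<le> 1 / sqrt (energy_bound r)" using assms unfolding life_def by simp
  then show "T * sqrt (energy_bound r) \<le> 1" using s by (simp add: field_simps)
  have "T \<le> 1 / (energy_rate r + 1)" using assms unfolding life_def by simp
  then have "T * energy_rate r + T \<le> 1" using energy_rate_nonneg[of r] by (simp add: field_simps)
  then show "T * energy_rate r \<le> 1" using assms by simp
qed

text \<open>A pointwise version of \<open>approx_sol\<close>; for \<open>\<delta> = 0\<close> it is an exact solution.\<close>

definition proper_approx ::
  "real \<Rightarrow> real \<Rightarrow> real \<Rightarrow> 'h \<Rightarrow> (real \<Rightarrow> 'h) \<Rightarrow> (real \<Rightarrow> 'h \<times> 'g) \<Rightarrow> (real \<Rightarrow> 'h) \<Rightarrow> bool" where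
  "proper_approx \<delta> B T f0 f u w \<longleftrightarrow>
     (\<forall>t\<in>{0..T}. u t \<in> V \<and> norm (f t) \<le> B \<and> norm (f t - fst (u t)) \<le> \<delta>) \<and>
     wintble B 0 T u \<and> wintble B 0 T w \<and>
     (\<forall>t\<in>{0..T}. \<forall>h. f t \<bullet> h = f0 \<bullet> h + integral {0..t} (\<lambda>s. w s \<bullet> h)) \<and>
     (\<forall>t\<in>{0..T}. \<forall>\<phi>\<in>V. \<bar>w t \<bullet> fst \<phi> + \<eta> * ((f t - f0) \<bullet> fst \<phi>) +
            integral {0..t} (\<lambda>s. M (f s) (snd (u s)) \<bullet> snd \<phi>)\<bar> \<le> \<delta> * norm \<phi>)"

lemma proper_approx_continuous:
  assumes "proper_approx \<delta> B T f0 f u w" shows "continuous_on {0..T} f"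
proof (rule lipschitz_continuous_on)
  fix a b assume "0 \<le> a" "a \<le> b" "b \<le> T"
  then show "norm (f b - f a) \<le> B * (b - a)"
    using assms unfolding proper_approx_def by (intro primitive_lipschitz[of B T w f f0]) auto
qed

lemma proper_approx_imp_approx_sol:
  assumes p: "proper_approx \<delta> B T f0 f u w"
  shows "approx_sol \<delta> B T f0 f u w"
proof -
  have w: "wintble B 0 T w" and u: "wintble B 0 T u" using p unfolding proper_approx_def by auto
  have f: "continuous_on {0..T} f" by (rule proper_approx_continuous[OF p])
  have Mg: "wintble (M0 * B) 0 T (\<lambda>s. M (f s) (snd (u s)))"
    by (rule wintble_M[OF wintble_snd[OF u] f]) (use p in \<open>auto simp: proper_approx_def\<close>)
  have 1: "\<bar>integral {a..b} (\<lambda>t. (f t - fst (u t)) \<bullet> h)\<bar> \<le> \<delta> * (b - a) * norm h"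
    if ab: "0 \<le> a" "a \<le> b" "b \<le> T" for a b h
  proof -
    have "continuous_on {a..b} f" by (rule continuous_on_subset[OF f]) (use ab in auto)
    then have i1: "(\<lambda>t. f t \<bullet> h) integrable_on {a..b}"
      by (intro integrable_continuous_interval continuous_intros)
    have i2: "(\<lambda>t. fst (u t) \<bullet> h) integrable_on {a..b}"
      using wintble_subinterval[OF wintble_fst[OF u]] ab unfolding wintble_def by auto
    have "norm (integral {a..b} (\<lambda>t. (f t - fst (u t)) \<bullet> h)) \<le> integral {a..b} (\<lambda>t. \<delta> * norm h)"
    proof (rule integral_norm_bound_integral)
      show "(\<lambda>t. (f t - fst (u t)) \<bullet> h) integrable_on {a..b}" using integrable_diff[OF i1 i2] by (simp add: inner_diff_left)
      fix t assume "t \<in> {a..b}"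
      then have "norm (f t - fst (u t)) \<le> \<delta>" using p ab unfolding proper_approx_def by auto
      then show "norm ((f t - fst (u t)) \<bullet> h) \<le> \<delta> * norm h"
        unfolding real_norm_def by (meson Cauchy_Schwarz_ineq2 mult_right_mono norm_ge_zero order_trans)
    qed auto
    then show ?thesis using ab by (simp add: mult_ac)
  qed
  have 2: "\<bar>integral {a..b} (\<lambda>t. w t \<bullet> fst \<phi> + \<eta> * ((f t - f0) \<bullet> fst \<phi>) +
            integral {0..t} (\<lambda>s. M (f s) (snd (u s)) \<bullet> snd \<phi>))\<bar> \<le> \<delta> * (b - a) * norm \<phi>"
    if ab: "0 \<le> a" "a \<le> b" "b \<le> T" and \<phi>: "\<phi> \<in> V" for a b \<phi>
  proof -
    note i = equation_integrable[OF f w Mg ab(1,3)]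
    have "norm (integral {a..b} (\<lambda>t. w t \<bullet> fst \<phi> + \<eta> * ((f t - f0) \<bullet> fst \<phi>) +
            integral {0..t} (\<lambda>s. M (f s) (snd (u s)) \<bullet> snd \<phi>))) \<le> integral {a..b} (\<lambda>t. \<delta> * norm \<phi>)"
    proof (rule integral_norm_bound_integral)
      show "(\<lambda>t. w t \<bullet> fst \<phi> + \<eta> * ((f t - f0) \<bullet> fst \<phi>) +
            integral {0..t} (\<lambda>s. M (f s) (snd (u s)) \<bullet> snd \<phi>)) integrable_on {a..b}"
        by (intro integrable_add i)
    qed (use p ab \<phi> in \<open>auto simp: proper_approx_def\<close>)
    then show ?thesis using ab by (simp add: mult_ac)
  qed
  show ?thesis unfolding approx_sol_def
    using p 1 2 unfolding proper_approx_def by blast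
qed

end

section \<open>Energy estimate and residual of the implicit Euler scheme\<close>

locale rothe = wave +
  fixes e0 U v \<tau> N T r
  assumes e0: "e0 \<in> V" "norm e0 \<le> r" and \<tau>: "\<tau> > 0" and T: "T = real N * \<tau>"
    and U0: "U 0 = e0" and v0: "v 0 = 0" and UV: "\<And>n. U n \<in> V"
    and v_Suc: "\<And>n. v (Suc n) = (1 / \<tau>) *\<^sub>R (fst (U (Suc n)) - fst (U n))"
    and scheme: "\<And>n \<phi>. \<phi> \<in> V \<Longrightarrow> (1 / \<tau>) * ((v (Suc n) - v n) \<bullet> fst \<phi>) + \<eta> * (v (Suc n) \<bullet> fst \<phi>) +
       M (fst (U n)) (snd (U (Suc n))) \<bullet> snd \<phi> = 0"
    and small: "T * sqrt (energy_bound r) \<le> 1" "T * energy_rate r \<le> 1"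
begin

lemma r_nonneg: "0 \<le> r" using e0(2) norm_ge_zero order_trans by blast

lemma fst_U_Suc: "fst (U (Suc n)) = fst (U n) + \<tau> *\<^sub>R v (Suc n)"
  using \<tau> by (simp add: v_Suc)

lemma energy_step:
  "(norm (v (Suc n)))\<^sup>2 + M (fst (U n)) (snd (U (Suc n))) \<bullet> snd (U (Suc n)) \<le>
   (norm (v n))\<^sup>2 + M (fst (U n)) (snd (U n)) \<bullet> snd (U n)"
proof -
  define g where "g = snd (U n)"
  define g' where "g' = snd (U (Suc n))"
  define A where "A = M (fst (U n))"
  have "U (Suc n) - U n \<in> V" using UV V_subspace by (intro subspace_diff)
  from scheme[OF this, of n] have "(v (Suc n) - v n) \<bullet> v (Suc n) + \<eta> * \<tau> * (v (Suc n) \<bullet> v (Suc n)) + A g' \<bullet> (g' - g) = 0"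
    using \<tau> unfolding A_def g_def g'_def by (simp add: fst_U_Suc)
  moreover have "0 \<le> \<eta> * \<tau> * (v (Suc n) \<bullet> v (Suc n))" using eta_nonneg \<tau> by simp
  moreover have "2 * ((v (Suc n) - v n) \<bullet> v (Suc n)) = (norm (v (Suc n)))\<^sup>2 - (norm (v n))\<^sup>2 + (norm (v (Suc n) - v n))\<^sup>2"
    by (simp add: power2_norm_eq_inner inner_diff_left inner_diff_right inner_commute)
  moreover have "A g \<bullet> g' = A g' \<bullet> g" unfolding A_def by (metis M_sym inner_commute)
  then have "2 * (A g' \<bullet> (g' - g)) = A g' \<bullet> g' - A g \<bullet> g + A (g' - g) \<bullet> (g' - g)"
    unfolding A_def by (simp add: M_diff inner_diff_left inner_diff_right)
  moreover have "0 \<le> A (g' - g) \<bullet> (g' - g)" unfolding A_def by (rule M_nonneg)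
  ultimately show ?thesis unfolding g_def g'_def A_def using zero_le_power2[of "norm (v (Suc n) - v n)"] by linarith
qed

lemma time_le: "n \<le> N \<Longrightarrow> real n * \<tau> \<le> T"
  unfolding T using \<tau> by (intro mult_right_mono) auto

text \<open>Both bounds have to be carried together: the energy bounds the velocity and thus the
  displacement, while the displacement keeps the state in the ball whose constants
  \<open>L (r + 1)\<close> and \<open>m (r + 1)\<close> control the growth of the energy.\<close>

lemma energy_estimate:
  "n \<le> N \<Longrightarrow> norm (fst (U n)) \<le> r + real n * \<tau> * sqrt (energy_bound r) \<and>
    (norm (v n))\<^sup>2 + M (fst (U n)) (snd (U n)) \<bullet> snd (U n) \<le> M0 * r\<^sup>2 + real n * \<tau> * energy_rate r"
proof (induction n)
  case 0
  have n: "norm (fst e0) \<le> r" "norm (snd e0) \<le> r"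
    using e0(2) norm_fst_le[of "fst e0" "snd e0"] norm_snd_le[of "snd e0" "fst e0"] by auto
  have "M (fst e0) (snd e0) \<bullet> snd e0 \<le> (M0 * norm (snd e0)) * norm (snd e0)"
    by (intro order_trans[OF norm_cauchy_schwarz] mult_right_mono M_bound) auto
  also have "\<dots> \<le> (M0 * r) * r" using n M0_nonneg r_nonneg by (intro mult_mono mult_left_mono) auto
  finally show ?case using n by (simp add: U0 v0 power2_eq_square)
next
  case (Suc n)
  let ?E = "energy_bound r"
  have IH: "norm (fst (U n)) \<le> r + real n * \<tau> * sqrt ?E"
    "(norm (v n))\<^sup>2 + M (fst (U n)) (snd (U n)) \<bullet> snd (U n) \<le> M0 * r\<^sup>2 + real n * \<tau> * energy_rate r"
    using Suc by auto
  have s0: "0 \<le> sqrt ?E" using energy_bound_ge_1[of r] by simp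
  have tn: "real n * \<tau> * sqrt ?E \<le> 1" "real (Suc n) * \<tau> * sqrt ?E \<le> 1"
    using mult_right_mono[OF time_le[of n] s0] mult_right_mono[OF time_le[of "Suc n"] s0] small(1) Suc(2) by auto
  have rn: "real n * \<tau> * energy_rate r \<le> 1"
    using mult_right_mono[OF time_le[of n] energy_rate_nonneg[of r]] small(2) Suc(2) by auto
  have fn: "norm (fst (U n)) \<le> r + 1" using IH(1) tn by simp
  have E: "(norm (v (Suc n)))\<^sup>2 + M (fst (U n)) (snd (U (Suc n))) \<bullet> snd (U (Suc n)) \<le> M0 * r\<^sup>2 + real n * \<tau> * energy_rate r"
    using energy_step[of n] IH(2) by linarith
  then have E1: "(norm (v (Suc n)))\<^sup>2 + M (fst (U n)) (snd (U (Suc n))) \<bullet> snd (U (Suc n)) \<le> ?E"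
    using rn unfolding energy_bound_def by linarith
  then have "(norm (v (Suc n)))\<^sup>2 \<le> ?E" using M_nonneg[of "fst (U n)" "snd (U (Suc n))"] by linarith
  then have v': "norm (v (Suc n)) \<le> sqrt ?E" by (rule real_le_rsqrt)
  have "m (r + 1) * (norm (snd (U (Suc n))))\<^sup>2 \<le> ?E"
    using M_coercive[OF fn, of "snd (U (Suc n))"] E1 zero_le_power2[of "norm (v (Suc n))"] by linarith
  then have g': "(norm (snd (U (Suc n))))\<^sup>2 \<le> ?E / m (r + 1)" using m_pos[of "r + 1"] by (simp add: field_simps)
  have "norm (fst (U (Suc n))) \<le> norm (fst (U n)) + \<tau> * norm (v (Suc n))"
    unfolding fst_U_Suc using norm_triangle_ineq[of "fst (U n)" "\<tau> *\<^sub>R v (Suc n)"] \<tau> by simp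
  also have "\<dots> \<le> (r + real n * \<tau> * sqrt ?E) + \<tau> * sqrt ?E"
    using IH(1) v' \<tau> by (intro add_mono mult_left_mono) auto
  finally have f': "norm (fst (U (Suc n))) \<le> r + real (Suc n) * \<tau> * sqrt ?E" by (simp add: algebra_simps)
  then have f'': "norm (fst (U (Suc n))) \<le> r + 1" using tn by simp
  have "norm (fst (U (Suc n)) - fst (U n)) = \<tau> * norm (v (Suc n))" using \<tau> by (simp add: fst_U_Suc)
  then have df: "norm (fst (U (Suc n)) - fst (U n)) \<le> \<tau> * sqrt ?E" using v' \<tau> by simp
  \<comment> \<open>\<open>energy_step\<close> keeps the coefficient of the old state; updating it
    to the new state is the only source of energy growth.\<close>
  have "(M (fst (U (Suc n))) (snd (U (Suc n))) - M (fst (U n)) (snd (U (Suc n)))) \<bullet> snd (U (Suc n))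
     \<le> (L (r + 1) * norm (fst (U (Suc n)) - fst (U n)) * norm (snd (U (Suc n)))) * norm (snd (U (Suc n)))"
    by (intro order_trans[OF norm_cauchy_schwarz] mult_right_mono M_lipschitz f'' fn) auto
  also have "\<dots> = L (r + 1) * norm (fst (U (Suc n)) - fst (U n)) * (norm (snd (U (Suc n))))\<^sup>2"
    by (simp add: power2_eq_square)
  also have "\<dots> \<le> L (r + 1) * (\<tau> * sqrt ?E) * (?E / m (r + 1))"
    using df g' L_nonneg s0 \<tau> by (intro mult_mono mult_left_mono) auto
  also have "\<dots> = \<tau> * energy_rate r" unfolding energy_rate_def by simp
  finally have "M (fst (U (Suc n))) (snd (U (Suc n))) \<bullet> snd (U (Suc n)) \<le> M (fst (U n)) (snd (U (Suc n))) \<bullet> snd (U (Suc n)) + \<tau> * energy_rate r"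
    by (simp add: inner_diff_left)
  with E have "(norm (v (Suc n)))\<^sup>2 + M (fst (U (Suc n))) (snd (U (Suc n))) \<bullet> snd (U (Suc n)) \<le> M0 * r\<^sup>2 + real (Suc n) * \<tau> * energy_rate r"
    by (simp add: algebra_simps)
  with f' show ?case by blast
qed

abbreviation "B \<equiv> size_bound r"

lemma discrete_bounds:
  assumes n: "n \<le> N"
  shows "norm (fst (U n)) \<le> r + 1" "norm (v n) \<le> sqrt (energy_bound r)" "norm (U n) \<le> B"
proof -
  let ?E = "energy_bound r"
  have s0: "0 \<le> sqrt ?E" using energy_bound_ge_1[of r] by simp
  have tn: "real n * \<tau> * sqrt ?E \<le> 1" using mult_right_mono[OF time_le[OF n] s0] small(1) by auto
  have rn: "real n * \<tau> * energy_rate r \<le> 1"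
    using mult_right_mono[OF time_le[OF n] energy_rate_nonneg[of r]] small(2) by auto
  show f: "norm (fst (U n)) \<le> r + 1" using energy_estimate[OF n] tn by linarith
  have E1: "(norm (v n))\<^sup>2 + M (fst (U n)) (snd (U n)) \<bullet> snd (U n) \<le> ?E"
    using energy_estimate[OF n] rn unfolding energy_bound_def by linarith
  then have "(norm (v n))\<^sup>2 \<le> ?E" using M_nonneg[of "fst (U n)" "snd (U n)"] by linarith
  then show "norm (v n) \<le> sqrt ?E" by (rule real_le_rsqrt)
  have "m (r + 1) * (norm (snd (U n)))\<^sup>2 \<le> ?E"
    using M_coercive[OF f, of "snd (U n)"] E1 zero_le_power2[of "norm (v n)"] by linarith
  then have "(norm (snd (U n)))\<^sup>2 \<le> ?E / m (r + 1)" using m_pos[of "r + 1"] by (simp add: field_simps)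
  then have "norm (snd (U n)) \<le> sqrt (?E / m (r + 1))" by (rule real_le_rsqrt)
  moreover have "norm (U n) \<le> norm (fst (U n)) + norm (snd (U n))"
    using norm_Pair_le[of "fst (U n)" "snd (U n)"] by simp
  ultimately show "norm (U n) \<le> B" using f s0 unfolding size_bound_def by linarith
qed

lemma B_ge: "sqrt (energy_bound r) \<le> B" "r + 1 \<le> B" "0 \<le> B"
proof -
  have "0 \<le> sqrt (energy_bound r)" "0 \<le> sqrt (energy_bound r / m (r + 1))"
    using energy_bound_ge_1[of r] m_pos[of "r + 1"] by auto
  then show "sqrt (energy_bound r) \<le> B" "r + 1 \<le> B" "0 \<le> B" unfolding size_bound_def using r_nonneg by linarith+
qed

definition "idx t = nat \<lceil>t / \<tau>\<rceil>"
definition "w t = v (idx t)"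
definition "u t = U (idx t)"
text \<open>This is the piecewise affine interpolant of the states (\<open>f_grid\<close>). Written
  as a weak integral of \<open>w\<close> it satisfies the primitive identity by
  construction.\<close>

definition "f t = fst e0 + wint 0 t w"

lemma T_nonneg: "0 \<le> T" unfolding T using \<tau> by simp

lemma idx_le: "t \<le> T \<Longrightarrow> idx t \<le> N"
  unfolding idx_def T using \<tau> by (simp add: ceiling_le_iff pos_divide_le_eq nat_le_iff)

lemma idx_bounds: 
  assumes "0 < t" shows "1 \<le> idx t" "real (idx t - 1) * \<tau> < t" "t \<le> real (idx t) * \<tau>"
proof -
  have c: "1 \<le> \<lceil>t / \<tau>\<rceil>" using assms \<tau> by (simp add: one_le_ceiling)
  show 1: "1 \<le> idx t" using nat_mono[OF c] unfolding idx_def by (simp only: nat_1 One_nat_def)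
  have r: "real (idx t) = of_int \<lceil>t / \<tau>\<rceil>" unfolding idx_def using c by simp
  have "t / \<tau> \<le> real (idx t)" "real (idx t) < t / \<tau> + 1" unfolding r by linarith+
  then show "real (idx t - 1) * \<tau> < t" "t \<le> real (idx t) * \<tau>"
    using 1 \<tau> by (auto simp: field_simps of_nat_diff)
qed

lemma step_wintble:
  fixes X :: "nat \<Rightarrow> 'x::real_inner"
  assumes "\<And>n. n \<le> N \<Longrightarrow> norm (X n) \<le> C"
  shows "wintble C 0 T (\<lambda>t. X (idx t))"
  unfolding wintble_def
proof (intro conjI ballI allI)
  show "norm (X (idx t)) \<le> C" if "t \<in> {0..T}" for t using that idx_le assms by auto
  show "(\<lambda>t. X (idx t) \<bullet> h) integrable_on {0..T}" for h
    using step_has_integral[OF \<tau>, of "\<lambda>n. X n \<bullet> h" N] unfolding T idx_def by (rule has_integral_integrable)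
qed

lemma w_wintble': "wintble (sqrt (energy_bound r)) 0 T w"
  unfolding w_def by (rule step_wintble) (rule discrete_bounds)

lemma w_wintble: "wintble B 0 T w"
  using w_wintble' B_ge(1) unfolding wintble_def by (meson order_trans)

lemma u_wintble: "wintble B 0 T u"
  unfolding u_def by (rule step_wintble) (rule discrete_bounds)

lemma f_inner: "t \<in> {0..T} \<Longrightarrow> f t \<bullet> h = fst e0 \<bullet> h + integral {0..t} (\<lambda>s. w s \<bullet> h)"
  unfolding f_def using wint_inner[OF wintble_subinterval[OF w_wintble]] by (simp add: inner_add_left)

lemma f_bound: "t \<in> {0..T} \<Longrightarrow> norm (f t) \<le> B"
proof -
  assume t: "t \<in> {0..T}"
  have s0: "0 \<le> sqrt (energy_bound r)" using energy_bound_ge_1[of r] by simp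
  have "norm (wint 0 t w) \<le> sqrt (energy_bound r) * (t - 0)"
    by (rule norm_wint[OF wintble_subinterval[OF w_wintble']]) (use t in auto)
  also have "\<dots> \<le> sqrt (energy_bound r) * T" using t s0 by (intro mult_left_mono) auto
  finally have "norm (wint 0 t w) \<le> 1" using small(1) by (simp add: mult.commute)
  moreover have "norm (fst e0) \<le> r" using e0(2) norm_fst_le[of "fst e0" "snd e0"] by simp
  ultimately show ?thesis unfolding f_def using norm_triangle_ineq[of "fst e0" "wint 0 t w"] B_ge(2) by linarith
qed

lemma f_grid: "n \<le> N \<Longrightarrow> f (real n * \<tau>) = fst (U n)"
proof -
  assume n: "n \<le> N"
  have tele: "\<tau> * (\<Sum>j=1..k. v j \<bullet> h) = fst (U k) \<bullet> h - fst e0 \<bullet> h" for k h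
    by (induction k) (simp_all add: U0 distrib_left fst_U_Suc inner_add_left)
  have "f (real n * \<tau>) \<bullet> h = fst (U n) \<bullet> h" for h
  proof -
    have "integral {0..real n * \<tau>} (\<lambda>s. w s \<bullet> h) = \<tau> * (\<Sum>j=1..n. v j \<bullet> h)"
      using step_has_integral[OF \<tau>, of "\<lambda>n. v n \<bullet> h" n] unfolding w_def idx_def by (rule integral_unique)
    then show ?thesis using f_inner[of "real n * \<tau>" h] tele[where k = n and h = h] time_le[OF n] \<tau> by simp
  qed
  then show ?thesis by (metis vector_eq_rdot inner_commute)
qed

lemma f_lipschitz: "0 \<le> a \<Longrightarrow> a \<le> b \<Longrightarrow> b \<le> T \<Longrightarrow> norm (f b - f a) \<le> B * (b - a)"
  by (rule primitive_lipschitz[OF w_wintble]) (use f_inner in auto)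

lemma idx_0: "idx 0 = 0" unfolding idx_def by simp

text \<open>The time \<open>t\<close> lies between two grid points at distance \<tau>, and
  \<open>f\<close> is Lipschitz. The right grid point is the one seen by \<open>u\<close>, the left
  one is where the scheme freezes its coefficient.\<close>

lemma f_near:
  assumes t: "t \<in> {0..T}"
  shows "norm (f t - fst (u t)) \<le> B * \<tau>" "norm (f t - fst (U (idx t - 1))) \<le> B * \<tau>"
proof -
  have "norm (f t - fst (u t)) \<le> B * \<tau> \<and> norm (f t - fst (U (idx t - 1))) \<le> B * \<tau>"
  proof (cases "t = 0")
    case True
    then show ?thesis using f_grid[of 0] B_ge \<tau> by (simp add: u_def idx_0)
  next
    case False
    then have t0: "0 < t" using t by auto
    note ib = idx_bounds[OF t0]
    have le: "idx t \<le> N" using t idx_le by auto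
    have "real (idx t) * \<tau> = real (idx t - 1) * \<tau> + \<tau>" using ib(1) by (simp add: of_nat_diff algebra_simps)
    then have d: "real (idx t) * \<tau> - t \<le> \<tau>" "t - real (idx t - 1) * \<tau> \<le> \<tau>" using ib by linarith+
    have "norm (f (real (idx t) * \<tau>) - f t) \<le> B * (real (idx t) * \<tau> - t)"
      using t0 ib time_le[OF le] by (intro f_lipschitz) auto
    also have "\<dots> \<le> B * \<tau>" using d B_ge by (intro mult_left_mono) auto
    finally have 1: "norm (f t - fst (u t)) \<le> B * \<tau>" unfolding f_grid[OF le] u_def by (simp add: norm_minus_commute)
    have "norm (f t - f (real (idx t - 1) * \<tau>)) \<le> B * (t - real (idx t - 1) * \<tau>)"
      using ib \<tau> t by (intro f_lipschitz) auto
    also have "\<dots> \<le> B * \<tau>" using d B_ge by (intro mult_left_mono) auto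
    finally have "norm (f t - fst (U (idx t - 1))) \<le> B * \<tau>" using f_grid[of "idx t - 1"] le by simp
    with 1 show ?thesis by simp
  qed
  then show "norm (f t - fst (u t)) \<le> B * \<tau>" "norm (f t - fst (U (idx t - 1))) \<le> B * \<tau>" by auto
qed

text \<open>Summation over the steps is the discrete counterpart of integrating the equation in
  time; the boundary term vanishes because \<open>v 0 = 0\<close>.\<close>

lemma summed_scheme:
  assumes \<phi>: "\<phi> \<in> V"
  shows "v n \<bullet> fst \<phi> + \<eta> * ((fst (U n) - fst e0) \<bullet> fst \<phi>) + \<tau> * (\<Sum>j=1..n. M (fst (U (j - 1))) (snd (U j)) \<bullet> snd \<phi>) = 0"
proof (induction n)
  case 0
  then show ?case by (simp add: U0 v0)
next
  case (Suc n)
  have "\<tau> * ((1 / \<tau>) * ((v (Suc n) - v n) \<bullet> fst \<phi>) + \<eta> * (v (Suc n) \<bullet> fst \<phi>) + M (fst (U n)) (snd (U (Suc n))) \<bullet> snd \<phi>) = 0"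
    using scheme[OF \<phi>, of n] by simp
  then have "(v (Suc n) - v n) \<bullet> fst \<phi> + \<eta> * \<tau> * (v (Suc n) \<bullet> fst \<phi>) + \<tau> * (M (fst (U n)) (snd (U (Suc n))) \<bullet> snd \<phi>) = 0"
    using \<tau> by (simp add: algebra_simps)
  with Suc show ?case by (simp add: fst_U_Suc inner_add_left inner_diff_left distrib_left algebra_simps)
qed

theorem proper: "proper_approx ((B + \<eta> * B + T * L B * B\<^sup>2 + M0 * B) * \<tau>) B T (fst e0) f u w"
proof -
  define C where "C = B + \<eta> * B + T * L B * B\<^sup>2 + M0 * B"
  have pos: "0 \<le> B" "0 \<le> \<eta> * B" "0 \<le> T * L B * B\<^sup>2" "0 \<le> M0 * B"
    using B_ge T_nonneg L_nonneg M0_nonneg eta_nonneg by auto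
  have fcont: "continuous_on {0..T} f" by (rule lipschitz_continuous_on[OF f_lipschitz])
  have Mw: "wintble (M0 * B) 0 T (\<lambda>s. M (f s) (snd (u s)))"
    by (rule wintble_M[OF wintble_snd[OF u_wintble] fcont f_bound])
  have eq: "\<bar>w t \<bullet> fst \<phi> + \<eta> * ((f t - fst e0) \<bullet> fst \<phi>) + integral {0..t} (\<lambda>s. M (f s) (snd (u s)) \<bullet> snd \<phi>)\<bar> \<le> C * \<tau> * norm \<phi>"
    if t: "t \<in> {0..T}" and \<phi>: "\<phi> \<in> V" for t \<phi>
  proof -
    define n where "n = idx t"
    have n: "n \<le> N" unfolding n_def using t idx_le by auto
    have nt: "t \<le> real n * \<tau>" "real n * \<tau> - t \<le> \<tau>"
    proof -
      show "t \<le> real n * \<tau>" using idx_bounds(3)[of t] t unfolding n_def by (cases "t = 0") (auto simp: idx_0)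
      show "real n * \<tau> - t \<le> \<tau>"
      proof (cases "t = 0")
        case False
        then have "0 < t" using t by auto
        from idx_bounds[OF this] show ?thesis unfolding n_def by (auto simp: of_nat_diff algebra_simps)
      qed (use \<tau> in \<open>auto simp: n_def idx_0\<close>)
    qed
    have nT: "real n * \<tau> \<le> T" by (rule time_le[OF n])
    define c where "c j = M (fst (U (j - 1))) (snd (U j)) \<bullet> snd \<phi>" for j
    have cI: "((\<lambda>s. c (idx s)) has_integral \<tau> * (\<Sum>j=1..n. c j)) {0..real n * \<tau>}"
      unfolding idx_def by (rule step_has_integral[OF \<tau>])
    \<comment> \<open>The summed scheme is the integrated equation at the right end of the current
      step, where the velocity equals \<open>w t\<close>. The estimates \<open>e1\<close>,
      \<open>e2\<close> and \<open>e3\<close> carry it over to time \<open>t\<close> and to the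
      unfrozen coefficient.\<close>
    have sum: "w t \<bullet> fst \<phi> + \<eta> * ((fst (U n) - fst e0) \<bullet> fst \<phi>) + integral {0..real n * \<tau>} (\<lambda>s. c (idx s)) = 0"
      using summed_scheme[OF \<phi>, of n] integral_unique[OF cI] unfolding w_def n_def c_def by simp
    have cint: "(\<lambda>s. c (idx s)) integrable_on {0..real n * \<tau>}" using cI by (rule has_integral_integrable)
    have csub: "(\<lambda>s. c (idx s)) integrable_on {0..t}" "(\<lambda>s. c (idx s)) integrable_on {t..real n * \<tau>}"
      using integrable_on_subinterval[OF cint] nt t by auto
    have comb: "integral {0..t} (\<lambda>s. c (idx s)) + integral {t..real n * \<tau>} (\<lambda>s. c (idx s)) = integral {0..real n * \<tau>} (\<lambda>s. c (idx s))"
      using nt t cint by (intro Henstock_Kurzweil_Integration.integral_combine) auto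
    have n\<phi>: "norm (fst \<phi>) \<le> norm \<phi>" "norm (snd \<phi>) \<le> norm \<phi>"
      using norm_fst_le[of "fst \<phi>" "snd \<phi>"] norm_snd_le[of "snd \<phi>" "fst \<phi>"] by auto
    have nU: "norm (snd (U j)) \<le> B" if "j \<le> N" for j
      using discrete_bounds(3)[OF that] norm_snd_le[of "snd (U j)" "fst (U j)"] by simp
    have cb: "\<bar>c j\<bar> \<le> M0 * B * norm \<phi>" if "j \<le> N" for j
    proof -
      have "\<bar>c j\<bar> \<le> norm (M (fst (U (j - 1))) (snd (U j))) * norm (snd \<phi>)" unfolding c_def by (rule Cauchy_Schwarz_ineq2)
      also have "\<dots> \<le> (M0 * B) * norm \<phi>"
        using M_bound[of "fst (U (j - 1))" "snd (U j)"] nU[OF that] M0_nonneg n\<phi> pos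
        by (intro mult_mono) (auto intro: order_trans mult_left_mono)
      finally show ?thesis .
    qed
    have e1: "\<bar>\<eta> * ((f t - fst (U n)) \<bullet> fst \<phi>)\<bar> \<le> \<eta> * B * \<tau> * norm \<phi>"
    proof -
      have "\<bar>(f t - fst (U n)) \<bullet> fst \<phi>\<bar> \<le> (B * \<tau>) * norm \<phi>"
        using f_near(1)[OF t] n\<phi>(1) \<tau> B_ge unfolding u_def n_def
        by (intro order_trans[OF Cauchy_Schwarz_ineq2] mult_mono) auto
      from mult_left_mono[OF this eta_nonneg] show ?thesis using eta_nonneg by (simp add: abs_mult mult_ac)
    qed
    have e2: "\<bar>integral {t..real n * \<tau>} (\<lambda>s. c (idx s))\<bar> \<le> M0 * B * \<tau> * norm \<phi>"
    proof -
      have "norm (integral {t..real n * \<tau>} (\<lambda>s. c (idx s))) \<le> integral {t..real n * \<tau>} (\<lambda>s. M0 * B * norm \<phi>)"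
        using cb idx_le nT csub(2) by (intro integral_norm_bound_integral) auto
      also have "\<dots> = (real n * \<tau> - t) * (M0 * B * norm \<phi>)" using nt by simp
      also have "\<dots> \<le> \<tau> * (M0 * B * norm \<phi>)" using nt pos by (intro mult_right_mono) auto
      finally show ?thesis by (simp add: mult_ac)
    qed
    have Mi: "(\<lambda>s. M (f s) (snd (u s)) \<bullet> snd \<phi>) integrable_on {0..t}"
      using wintble_subinterval[OF Mw, of 0 t] t unfolding wintble_def by auto
    have e3: "\<bar>integral {0..t} (\<lambda>s. M (f s) (snd (u s)) \<bullet> snd \<phi>) - integral {0..t} (\<lambda>s. c (idx s))\<bar> \<le> T * L B * B\<^sup>2 * \<tau> * norm \<phi>"
    proof -
      have "integral {0..t} (\<lambda>s. M (f s) (snd (u s)) \<bullet> snd \<phi>) - integral {0..t} (\<lambda>s. c (idx s))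
        = integral {0..t} (\<lambda>s. M (f s) (snd (u s)) \<bullet> snd \<phi> - c (idx s))"
        by (rule integral_diff[OF Mi csub(1), symmetric])
      moreover have "norm (integral {0..t} (\<lambda>s. M (f s) (snd (u s)) \<bullet> snd \<phi> - c (idx s))) \<le> integral {0..t} (\<lambda>s. L B * (B * \<tau>) * B * norm \<phi>)"
      proof (rule integral_norm_bound_integral[OF integrable_diff[OF Mi csub(1)]])
        fix s assume s: "s \<in> {0..t}"
        then have sT: "s \<in> {0..T}" using t by auto
        have "norm (M (f s) (snd (u s)) - M (fst (U (idx s - 1))) (snd (u s))) \<le> L B * norm (f s - fst (U (idx s - 1))) * norm (snd (u s))"
        proof (rule M_lipschitz)
          show "norm (fst (U (idx s - 1))) \<le> B"
            using order_trans[OF discrete_bounds(1)[of "idx s - 1"] B_ge(2)] idx_le[of s] sT by auto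
        qed (rule f_bound[OF sT])
        also have "\<dots> \<le> L B * (B * \<tau>) * B"
          using f_near(2)[OF sT] nU[of "idx s"] idx_le[of s] sT L_nonneg B_ge \<tau> unfolding u_def
          by (intro mult_mono mult_left_mono) auto
        finally have "\<bar>(M (f s) (snd (u s)) - M (fst (U (idx s - 1))) (snd (u s))) \<bullet> snd \<phi>\<bar> \<le> L B * (B * \<tau>) * B * norm \<phi>"
          using n\<phi>(2) L_nonneg B_ge \<tau> by (intro order_trans[OF Cauchy_Schwarz_ineq2] mult_mono) auto
        then show "norm (M (f s) (snd (u s)) \<bullet> snd \<phi> - c (idx s)) \<le> L B * (B * \<tau>) * B * norm \<phi>"
          unfolding c_def u_def by (simp add: inner_diff_left)
      qed auto
      moreover have "integral {0..t} (\<lambda>s. L B * (B * \<tau>) * B * norm \<phi>) \<le> T * L B * B\<^sup>2 * \<tau> * norm \<phi>"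
      proof -
        have "integral {0..t} (\<lambda>s. L B * (B * \<tau>) * B * norm \<phi>) = t * (L B * (B * \<tau>) * B * norm \<phi>)" using t by simp
        also have "\<dots> \<le> T * (L B * (B * \<tau>) * B * norm \<phi>)"
          using t L_nonneg B_ge \<tau> by (intro mult_right_mono) auto
        finally show ?thesis by (simp add: power2_eq_square mult_ac)
      qed
      ultimately show ?thesis by simp
    qed
    have "\<eta> * ((f t - fst e0) \<bullet> fst \<phi>) = \<eta> * ((f t - fst (U n)) \<bullet> fst \<phi>) + \<eta> * ((fst (U n) - fst e0) \<bullet> fst \<phi>)"
      by (simp add: inner_diff_left algebra_simps)
    then have "\<bar>w t \<bullet> fst \<phi> + \<eta> * ((f t - fst e0) \<bullet> fst \<phi>) + integral {0..t} (\<lambda>s. M (f s) (snd (u s)) \<bullet> snd \<phi>)\<bar>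
       \<le> \<eta> * B * \<tau> * norm \<phi> + M0 * B * \<tau> * norm \<phi> + T * L B * B\<^sup>2 * \<tau> * norm \<phi>"
      using e1 e2 e3 sum comb by linarith
    also have "\<dots> \<le> C * \<tau> * norm \<phi>"
      using mult_nonneg_nonneg[OF mult_nonneg_nonneg[OF pos(1) less_imp_le[OF \<tau>]], of "norm \<phi>"]
      unfolding C_def by (simp add: algebra_simps)
    finally show ?thesis .
  qed
  have "B * \<tau> \<le> C * \<tau>" unfolding C_def using pos \<tau> by (intro mult_right_mono) linarith+
  then have near: "norm (f t - fst (u t)) \<le> C * \<tau>" if "t \<in> {0..T}" for t using f_near(1)[OF that] by simp
  show ?thesis unfolding C_def[symmetric] proper_approx_def
    using eq near f_bound f_inner u_wintble w_wintble UV by (auto simp: u_def)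
qed

text \<open>The equation determines weak limits of velocities only against first components of
  elements of \<open>V\<close>. Since the velocities stay in that subspace, this is enough to
  identify their limit.\<close>

lemma w_range: "w t \<in> fst ` V"
proof (cases "idx t")
  case 0
  then show ?thesis using V_subspace v0 subspace_0 unfolding w_def by force
next
  case (Suc n)
  have "(1 / \<tau>) *\<^sub>R (U (Suc n) - U n) \<in> V" using UV V_subspace by (intro subspace_scale subspace_diff)
  then show ?thesis using v_Suc[of n] Suc unfolding w_def by (metis fst_diff fst_scaleR image_eqI)
qed

end

section \<open>Passage to the limit in the scheme\<close>

context wave
begin

lemma weak_limit_in_V:
  assumes xV: "\<And>k. x k \<in> V" and B: "\<And>k. norm (x k) \<le> B" and lim: "(\<lambda>k. fst (x k)) \<longlonglongrightarrow> p"
  shows "\<exists>u\<in>V. norm u \<le> B \<and> fst u = p \<and> (\<forall>y. (\<lambda>k. x k \<bullet> y) \<longlonglongrightarrow> u \<bullet> y)"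
proof -
  \<comment> \<open>The functionals on \<open>V\<close> that only see the first component are dense, since that component determines the second.\<close>
  define D where "D = {y \<in> V. \<exists>h. \<forall>z\<in>V. z \<bullet> y = fst z \<bullet> h}"
  have "\<exists>u\<in>V. norm u \<le> B \<and> (\<forall>y. (\<lambda>k. x k \<bullet> y) \<longlonglongrightarrow> u \<bullet> y)"
  proof (rule weak_limit[OF V_subspace V_closed xV B])
    fix d assume "d \<in> D"
    then obtain h where "\<And>z. z \<in> V \<Longrightarrow> z \<bullet> d = fst z \<bullet> h" unfolding D_def by blast
    then have "(\<lambda>k. x k \<bullet> d) = (\<lambda>k. fst (x k) \<bullet> h)" using xV by blast
    moreover have "(\<lambda>k. fst (x k) \<bullet> h) \<longlonglongrightarrow> p \<bullet> h" using lim by (intro tendsto_intros)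
    ultimately show "convergent (\<lambda>k. x k \<bullet> d)" by (auto simp: convergent_def)
  next
    fix z assume z: "z \<in> V" "\<And>d. d \<in> D \<Longrightarrow> z \<bullet> d = 0"
    have "fst z \<bullet> h = 0" for h
    proof -
      have "bounded_linear (\<lambda>y. (h, 0) \<bullet> y :: real)" for h :: 'h
        by (rule bounded_linear_inner_right)
      then obtain y where y: "y \<in> V" "\<And>x. x \<in> V \<Longrightarrow> y \<bullet> x = (h, 0) \<bullet> x"
        using riesz_on_subspace[OF V_subspace V_closed, of "\<lambda>y. (h, 0) \<bullet> y"] by blast
      have "x \<bullet> y = fst x \<bullet> h" if "x \<in> V" for x using y(2)[OF that] by (simp add: inner_prod_def inner_commute)
      then have "y \<in> D" "z \<bullet> y = fst z \<bullet> h" using y(1) z(1) unfolding D_def by auto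
      then show ?thesis using z(2) by simp
    qed
    then have "fst z = 0" using inner_eq_zero_iff by blast
    then have "(0, snd z) \<in> V" using z(1) by (metis prod.collapse)
    then show "z = 0" using V_inj \<open>fst z = 0\<close> by (simp add: prod_eq_iff)
  qed
  then obtain u where u: "u \<in> V" "norm u \<le> B" "\<And>y. (\<lambda>k. x k \<bullet> y) \<longlonglongrightarrow> u \<bullet> y" by blast
  have "fst u \<bullet> h = p \<bullet> h" for h
  proof (rule LIMSEQ_unique)
    show "(\<lambda>k. fst (x k) \<bullet> h) \<longlonglongrightarrow> fst u \<bullet> h" using u(3)[of "(h, 0)"] by (simp add: inner_prod_def)
    show "(\<lambda>k. fst (x k) \<bullet> h) \<longlonglongrightarrow> p \<bullet> h" using lim by (intro tendsto_intros)
  qed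
  then have "fst u = p" by (metis vector_eq_rdot inner_commute)
  with u show ?thesis by blast
qed

text \<open>Only the states converge in norm; gradients and velocities converge weakly at each time.
  The nonlinear term survives because the coefficient depends on the state alone, and integrals in
  time pass to the limit by dominated convergence against fixed vectors.\<close>

lemma proper_approx_limit:
  assumes \<delta>: "\<delta> \<longlonglongrightarrow> 0" and p: "\<And>k. proper_approx (\<delta> k) B T f0 (f k) (u k) (w k)"
    and wV: "\<And>k t. t \<in> {0..T} \<Longrightarrow> w k t \<in> fst ` V"
    and conv: "\<And>t. t \<in> {0..T} \<Longrightarrow> convergent (\<lambda>k. f k t)"
  shows "\<exists>f u w. proper_approx 0 B T f0 f u w"
proof -
  have uV: "u k t \<in> V" and fB: "norm (f k t) \<le> B" and fu: "norm (f k t - fst (u k t)) \<le> \<delta> k"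
    and uB: "norm (u k t) \<le> B" and wB: "norm (w k t) \<le> B" if "t \<in> {0..T}" for k t
    using p[of k] that unfolding proper_approx_def wintble_def by auto
  define F where "F t = lim (\<lambda>k. f k t)" for t
  have F: "(\<lambda>k. f k t) \<longlonglongrightarrow> F t" if "t \<in> {0..T}" for t
    using conv[OF that] unfolding F_def by (simp add: convergent_LIMSEQ_iff)
  have fst_u: "(\<lambda>k. fst (u k t)) \<longlonglongrightarrow> F t" if t: "t \<in> {0..T}" for t
  proof -
    have "(\<lambda>k. f k t - fst (u k t)) \<longlonglongrightarrow> 0"
      by (rule Lim_null_comparison[OF _ \<delta>]) (use fu[OF t] in auto)
    from tendsto_diff[OF F[OF t] this] show ?thesis by simp
  qed
  have "\<forall>t\<in>{0..T}. \<exists>x. x \<in> V \<and> norm x \<le> B \<and> fst x = F t \<and> (\<forall>y. (\<lambda>k. u k t \<bullet> y) \<longlonglongrightarrow> x \<bullet> y)"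
    using weak_limit_in_V[OF uV uB fst_u] by blast
  from bchoice[OF this] obtain Z where Z: "\<And>t. t \<in> {0..T} \<Longrightarrow> Z t \<in> V" "\<And>t. t \<in> {0..T} \<Longrightarrow> norm (Z t) \<le> B"
    "\<And>t. t \<in> {0..T} \<Longrightarrow> fst (Z t) = F t" "\<And>t y. t \<in> {0..T} \<Longrightarrow> (\<lambda>k. u k t \<bullet> y) \<longlonglongrightarrow> Z t \<bullet> y"
    by blast
  have FB: "norm (F t) \<le> B" if "t \<in> {0..T}" for t
    by (rule LIMSEQ_le_const2[OF tendsto_norm[OF F[OF that]]]) (use fB[OF that] in auto)
  \<comment> \<open>By symmetry the term is a weakly convergent gradient paired with
    \<open>M (f k s) y\<close>, which converges in norm by the Lipschitz bound.\<close>
  have Mconv: "(\<lambda>k. M (f k s) (snd (u k s)) \<bullet> y) \<longlonglongrightarrow> M (F s) (snd (Z s)) \<bullet> y" if s: "s \<in> {0..T}" for s y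
  proof -
    have 1: "(\<lambda>k. snd (u k s) \<bullet> M (F s) y) \<longlonglongrightarrow> snd (Z s) \<bullet> M (F s) y"
      using Z(4)[OF s, of "(0, M (F s) y)"] by (simp add: inner_prod_def)
    have 2: "(\<lambda>k. snd (u k s) \<bullet> (M (f k s) y - M (F s) y)) \<longlonglongrightarrow> 0"
    proof (rule Lim_null_comparison)
      have "(\<lambda>k. B * (L B * norm (f k s - F s) * norm y)) \<longlonglongrightarrow> B * (L B * norm (F s - F s) * norm y)"
        using F[OF s] by (intro tendsto_intros)
      then show "(\<lambda>k. B * (L B * norm (f k s - F s) * norm y)) \<longlonglongrightarrow> 0" by simp
      have "norm (snd (u k s) \<bullet> (M (f k s) y - M (F s) y)) \<le> B * (L B * norm (f k s - F s) * norm y)" for k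
      proof -
        have "norm (snd (u k s)) \<le> B" using uB[OF s, of k] norm_snd_le[of "snd (u k s)" "fst (u k s)"] by simp
        moreover have "0 \<le> B" using FB[OF s] norm_ge_zero order_trans by blast
        ultimately show ?thesis unfolding real_norm_def
          using M_lipschitz[OF fB[OF s] FB[OF s]] by (intro order_trans[OF Cauchy_Schwarz_ineq2] mult_mono) auto
      qed
      then show "\<forall>\<^sub>F k in sequentially. norm (snd (u k s) \<bullet> (M (f k s) y - M (F s) y)) \<le> B * (L B * norm (f k s - F s) * norm y)"
        by simp
    qed
    have "(\<lambda>k. snd (u k s) \<bullet> M (F s) y + snd (u k s) \<bullet> (M (f k s) y - M (F s) y)) \<longlonglongrightarrow> snd (Z s) \<bullet> M (F s) y + 0"
      by (rule tendsto_add[OF 1 2])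
    then show ?thesis by (simp add: M_sym inner_diff_right)
  qed
  have Mw: "wintble (M0 * B) 0 T (\<lambda>s. M (f k s) (snd (u k s)))" for k
    by (rule wintble_M[OF wintble_snd proper_approx_continuous[OF p[of k]]])
      (use p[of k] in \<open>auto simp: proper_approx_def\<close>)
  have Iconv: "(\<lambda>k. integral {0..t} (\<lambda>s. M (f k s) (snd (u k s)) \<bullet> y)) \<longlonglongrightarrow> integral {0..t} (\<lambda>s. M (F s) (snd (Z s)) \<bullet> y)"
    if t: "t \<in> {0..T}" for t y
  proof (rule dominated_convergence(2)[where h = "\<lambda>s. M0 * B * norm y"])
    show "(\<lambda>s. M (f k s) (snd (u k s)) \<bullet> y) integrable_on {0..t}" for k
      using wintble_subinterval[OF Mw[of k], of 0 t] t unfolding wintble_def by auto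
    show "norm (M (f k s) (snd (u k s)) \<bullet> y) \<le> M0 * B * norm y" if "s \<in> {0..t}" for k s
      using Mw[of k] that t unfolding wintble_def real_norm_def
      by (intro order_trans[OF Cauchy_Schwarz_ineq2] mult_right_mono) auto
    show "(\<lambda>k. M (f k s) (snd (u k s)) \<bullet> y) \<longlonglongrightarrow> M (F s) (snd (Z s)) \<bullet> y" if "s \<in> {0..t}" for s
      using that t by (intro Mconv) auto
  qed auto
  \<comment> \<open>The equation itself identifies the limit of the velocities against \<open>fst ` V\<close>.\<close>
  have Econv: "(\<lambda>k. w k t \<bullet> fst \<phi>) \<longlonglongrightarrow> - (\<eta> * ((F t - f0) \<bullet> fst \<phi>) + integral {0..t} (\<lambda>s. M (F s) (snd (Z s)) \<bullet> snd \<phi>))"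
    if t: "t \<in> {0..T}" and \<phi>: "\<phi> \<in> V" for t \<phi>
  proof -
    define e where "e k = w k t \<bullet> fst \<phi> + \<eta> * ((f k t - f0) \<bullet> fst \<phi>) + integral {0..t} (\<lambda>s. M (f k s) (snd (u k s)) \<bullet> snd \<phi>)" for k
    have "e \<longlonglongrightarrow> 0"
    proof (rule Lim_null_comparison)
      show "(\<lambda>k. \<delta> k * norm \<phi>) \<longlonglongrightarrow> 0" using tendsto_mult_right[OF \<delta>, of "norm \<phi>"] by simp
      show "\<forall>\<^sub>F k in sequentially. norm (e k) \<le> \<delta> k * norm \<phi>"
        using p t \<phi> unfolding e_def proper_approx_def by auto
    qed
    moreover have "(\<lambda>k. \<eta> * ((f k t - f0) \<bullet> fst \<phi>) + integral {0..t} (\<lambda>s. M (f k s) (snd (u k s)) \<bullet> snd \<phi>)) \<longlonglongrightarrow>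
        \<eta> * ((F t - f0) \<bullet> fst \<phi>) + integral {0..t} (\<lambda>s. M (F s) (snd (Z s)) \<bullet> snd \<phi>)"
      using F[OF t] Iconv[OF t] by (intro tendsto_intros)
    ultimately have "(\<lambda>k. e k - (\<eta> * ((f k t - f0) \<bullet> fst \<phi>) + integral {0..t} (\<lambda>s. M (f k s) (snd (u k s)) \<bullet> snd \<phi>))) \<longlonglongrightarrow>
       0 - (\<eta> * ((F t - f0) \<bullet> fst \<phi>) + integral {0..t} (\<lambda>s. M (F s) (snd (Z s)) \<bullet> snd \<phi>))"
      by (rule tendsto_diff)
    then show ?thesis unfolding e_def by simp
  qed
  have sub: "subspace (closure (fst ` V))"
    by (intro subspace_closure linear_subspace_image V_subspace bounded_linear.linear bounded_linear_fst)
  have "\<forall>t\<in>{0..T}. \<exists>x. norm x \<le> B \<and> (\<forall>y. (\<lambda>k. w k t \<bullet> y) \<longlonglongrightarrow> x \<bullet> y)"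
  proof
    fix t assume t: "t \<in> {0..T}"
    have "\<exists>x\<in>closure (fst ` V). norm x \<le> B \<and> (\<forall>y. (\<lambda>k. w k t \<bullet> y) \<longlonglongrightarrow> x \<bullet> y)"
    proof (rule weak_limit[OF sub closed_closure, where D = "fst ` V"])
      show "w k t \<in> closure (fst ` V)" for k using wV[OF t] closure_subset by blast
      show "convergent (\<lambda>k. w k t \<bullet> d)" if "d \<in> fst ` V" for d
        using Econv[OF t] that unfolding convergent_def by blast
      show "z = 0" if z: "z \<in> closure (fst ` V)" "\<And>d. d \<in> fst ` V \<Longrightarrow> z \<bullet> d = 0" for z
      proof -
        have "closed {y. z \<bullet> y = 0}" by (intro closed_Collect_eq continuous_intros)
        then have "closure (fst ` V) \<subseteq> {y. z \<bullet> y = 0}" using z(2) by (intro closure_minimal) auto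
        then have "z \<bullet> z = 0" using z(1) by blast
        then show ?thesis by simp
      qed
    qed (use wB[OF t] in auto)
    then show "\<exists>x. norm x \<le> B \<and> (\<forall>y. (\<lambda>k. w k t \<bullet> y) \<longlonglongrightarrow> x \<bullet> y)" by blast
  qed
  from bchoice[OF this] obtain W where W: "\<And>t. t \<in> {0..T} \<Longrightarrow> norm (W t) \<le> B"
    "\<And>t y. t \<in> {0..T} \<Longrightarrow> (\<lambda>k. w k t \<bullet> y) \<longlonglongrightarrow> W t \<bullet> y" by blast
  have Wint: "(\<lambda>s. W s \<bullet> y) integrable_on {0..t}" "(\<lambda>k. integral {0..t} (\<lambda>s. w k s \<bullet> y)) \<longlonglongrightarrow> integral {0..t} (\<lambda>s. W s \<bullet> y)"
    if t: "t \<in> {0..T}" for t y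
  proof -
    have 1: "(\<lambda>s. w k s \<bullet> y) integrable_on {0..t}" for k
      using p[of k] wintble_subinterval[of B 0 T "w k" 0 t] t unfolding proper_approx_def wintble_def by auto
    have 2: "norm (w k s \<bullet> y) \<le> B * norm y" if "s \<in> {0..t}" for k s
      using wB[of s k] that t unfolding real_norm_def
      by (intro order_trans[OF Cauchy_Schwarz_ineq2] mult_right_mono) auto
    have 3: "(\<lambda>k. w k s \<bullet> y) \<longlonglongrightarrow> W s \<bullet> y" if "s \<in> {0..t}" for s using W(2) that t by auto
    show "(\<lambda>s. W s \<bullet> y) integrable_on {0..t}" "(\<lambda>k. integral {0..t} (\<lambda>s. w k s \<bullet> y)) \<longlonglongrightarrow> integral {0..t} (\<lambda>s. W s \<bullet> y)"
      using dominated_convergence[OF 1 integrable_const_ivl 2 3] by auto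
  qed
  have Zint: "(\<lambda>s. Z s \<bullet> y) integrable_on {0..T}" for y
  proof (rule dominated_convergence(1)[where f = "\<lambda>k s. u k s \<bullet> y" and h = "\<lambda>s. B * norm y"])
    show "(\<lambda>s. u k s \<bullet> y) integrable_on {0..T}" for k using p[of k] unfolding proper_approx_def wintble_def by blast
    show "norm (u k s \<bullet> y) \<le> B * norm y" if "s \<in> {0..T}" for k s
      using uB[OF that] unfolding real_norm_def by (intro order_trans[OF Cauchy_Schwarz_ineq2] mult_right_mono) auto
    show "(\<lambda>k. u k s \<bullet> y) \<longlonglongrightarrow> Z s \<bullet> y" if "s \<in> {0..T}" for s by (rule Z(4)[OF that])
  qed (rule integrable_const_ivl)
  have "proper_approx 0 B T f0 F Z W"
    unfolding proper_approx_def
  proof (intro conjI ballI allI)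
    fix t assume t: "t \<in> {0..T}"
    show "Z t \<in> V" "norm (F t) \<le> B" "norm (F t - fst (Z t)) \<le> 0" using Z t FB by auto
    show "F t \<bullet> h = f0 \<bullet> h + integral {0..t} (\<lambda>s. W s \<bullet> h)" for h
    proof (rule LIMSEQ_unique)
      show "(\<lambda>k. f k t \<bullet> h) \<longlonglongrightarrow> F t \<bullet> h" using F[OF t] by (intro tendsto_intros)
      have "(\<lambda>k. f k t \<bullet> h) = (\<lambda>k. f0 \<bullet> h + integral {0..t} (\<lambda>s. w k s \<bullet> h))"
        using p t unfolding proper_approx_def by auto
      then show "(\<lambda>k. f k t \<bullet> h) \<longlonglongrightarrow> f0 \<bullet> h + integral {0..t} (\<lambda>s. W s \<bullet> h)"
        using tendsto_add[OF tendsto_const Wint(2)[OF t]] by simp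
    qed
    show "\<bar>W t \<bullet> fst \<phi> + \<eta> * ((F t - f0) \<bullet> fst \<phi>) + integral {0..t} (\<lambda>s. M (F s) (snd (Z s)) \<bullet> snd \<phi>)\<bar> \<le> 0 * norm \<phi>"
      if "\<phi> \<in> V" for \<phi>
      using LIMSEQ_unique[OF W(2)[OF t] Econv[OF t that]] by simp
  next
    show "wintble B 0 T Z" using Z(2) Zint unfolding wintble_def by auto
    show "wintble B 0 T W" unfolding wintble_def using W(1) Wint(1)[of T]
      by (cases "0 \<le> T") auto
  qed
  then show ?thesis by blast
qed

text \<open>The number of steps grows through all positive integers, so the residual is
  \<open>C\<close> over that number; the factor \<open>T\<close> in \<open>C\<close> comes from the
  step length.\<close>

theorem exact_solution_exists:
  assumes e0: "e0 \<in> V" "norm e0 \<le> r" and T: "0 < T" "T < life r"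
  shows "\<exists>B f u w. proper_approx 0 B T (fst e0) f u w"
proof -
  define B where "B = size_bound r"
  define C where "C = (B + \<eta> * B + T * L B * B\<^sup>2 + M0 * B) * T"
  have "\<exists>f u w. proper_approx (C * (1 / real (Suc k))) B T (fst e0) f u w \<and> (\<forall>t. w t \<in> fst ` V)" for k
  proof -
    define \<tau> where "\<tau> = T / real (Suc k)"
    have \<tau>: "\<tau> > 0" unfolding \<tau>_def using T by simp
    have TN: "T = real (Suc k) * \<tau>" unfolding \<tau>_def by simp
    obtain U v where Uv: "U 0 = e0" "v 0 = 0" "\<And>n. U n \<in> V" "\<And>n. v (Suc n) = (1 / \<tau>) *\<^sub>R (fst (U (Suc n)) - fst (U n))"
      "\<And>n \<phi>. \<phi> \<in> V \<Longrightarrow> (1 / \<tau>) * ((v (Suc n) - v n) \<bullet> fst \<phi>) + \<eta> * (v (Suc n) \<bullet> fst \<phi>) +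
       M (fst (U n)) (snd (U (Suc n))) \<bullet> snd \<phi> = 0"
      using implicit_scheme_exists[OF \<tau> e0(1)] by blast
    interpret rothe V M M0 L m \<eta> e0 U v \<tau> "Suc k" T r
      using e0 \<tau> TN Uv life_bounds[OF less_imp_le[OF T(1)] T(2)] by unfold_locales auto
    have "(B + \<eta> * B + T * L B * B\<^sup>2 + M0 * B) * \<tau> = C * (1 / real (Suc k))" unfolding C_def \<tau>_def by simp
    then show ?thesis using proper w_range unfolding B_def by metis
  qed
  then obtain f u w where p: "\<And>k. proper_approx (C * (1 / real (Suc k))) B T (fst e0) (f k) (u k) (w k)"
    and w: "\<And>k t. w k t \<in> fst ` V" by metis
  have C0: "0 \<le> C"
  proof -
    have "0 \<le> norm (f 0 0 - fst (u 0 0))" by simp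
    also have "\<dots> \<le> C * (1 / real (Suc 0))" using p[of 0] T unfolding proper_approx_def by auto
    finally show ?thesis by simp
  qed
  have lim0: "(\<lambda>k. C * (1 / real (Suc k))) \<longlonglongrightarrow> 0"
    using tendsto_mult_right_zero[OF LIMSEQ_Suc[OF lim_1_over_n]] by auto
  have "convergent (\<lambda>k. f k t)" if t: "t \<in> {0..T}" for t
  proof -
    define A where "A = stab_const B T * (8 * stab_const B T ^ 3 * T * exp (4 * stab_const B T ^ 4 * T)) * C"
    \<comment> \<open>Beyond index \<open>N\<close> all approximations have residual at most that of
      index \<open>N\<close>. With this common residual, stability compares interpolants belonging
      to different time steps.\<close>
    have A: "(norm (f j t - f k t))\<^sup>2 \<le> \<bar>A\<bar> * (1 / real (Suc N))" if "N \<le> j" "N \<le> k" for j k N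
    proof -
      have le: "C * (1 / real (Suc i)) \<le> C * (1 / real (Suc N))" if "N \<le> i" for i
        using that C0 by (intro mult_left_mono divide_left_mono) auto
      have ap: "approx_sol (C * (1 / real (Suc N))) B T (fst e0) (f i) (u i) (w i)" if "N \<le> i" for i
        using approx_sol_mono[OF proper_approx_imp_approx_sol[OF p] le[OF that]] .
      have "(norm (f j t - f k t))\<^sup>2 \<le> A * (1 / real (Suc N))"
        using approx_sol_stable[OF ap[OF \<open>N \<le> j\<close>] ap[OF \<open>N \<le> k\<close>], of t] t C0 unfolding A_def by (simp add: mult_ac)
      also have "\<dots> \<le> \<bar>A\<bar> * (1 / real (Suc N))" by (intro mult_right_mono) auto
      finally show ?thesis .
    qed
    have "Cauchy (\<lambda>k. f k t)"
    proof (rule metric_CauchyI)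
      fix e :: real assume e: "e > 0"
      have "(\<lambda>N. \<bar>A\<bar> * (1 / real (Suc N))) \<longlonglongrightarrow> 0"
        using tendsto_mult_right_zero[OF LIMSEQ_Suc[OF lim_1_over_n]] by auto
      then have "\<forall>\<^sub>F N in sequentially. \<bar>A\<bar> * (1 / real (Suc N)) < e\<^sup>2" using e by (intro order_tendstoD(2)) auto
      then obtain N where N: "\<bar>A\<bar> * (1 / real (Suc N)) < e\<^sup>2" by (auto simp: eventually_sequentially)
      have "dist (f j t) (f k t) < e" if "N \<le> j" "N \<le> k" for j k
      proof -
        have "(norm (f j t - f k t))\<^sup>2 < e\<^sup>2" using A[OF that] N by linarith
        then show ?thesis using e unfolding dist_norm by (simp add: power_less_imp_less_base)
      qed
      then show "\<exists>M. \<forall>m\<ge>M. \<forall>n\<ge>M. dist (f m t) (f n t) < e" by blast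
    qed
    then show ?thesis by (rule Cauchy_convergent)
  qed
  from proper_approx_limit[OF lim0 p w this] show ?thesis by blast
qed

end

section \<open>Functions vanishing weakly\<close>

text \<open>Rational corners keep the boxes stable under intersection, as the Dynkin argument needs,
  and make them countable, so that null sets belonging to single boxes can be united.\<close>

definition rational_vectors :: "'a::euclidean_space set" where
  "rational_vectors = {x. \<forall>i\<in>Basis. x \<bullet> i \<in> \<rat>}"

lemma countable_rational_vectors: "countable (rational_vectors :: 'a::euclidean_space set)"
proof -
  have "rational_vectors \<subseteq> (\<lambda>f. \<Sum>i\<in>Basis. f i *\<^sub>R i) ` (Basis \<rightarrow>\<^sub>E (\<rat> :: real set) :: ('a \<Rightarrow> real) set)"
  proof
    fix x :: 'a assume "x \<in> rational_vectors"
    then have "restrict (\<lambda>i. x \<bullet> i) Basis \<in> Basis \<rightarrow>\<^sub>E \<rat>" by (auto simp: rational_vectors_def)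
    moreover have "x = (\<Sum>i\<in>Basis. restrict (\<lambda>i. x \<bullet> i) Basis i *\<^sub>R i)" by (simp add: euclidean_representation)
    ultimately show "x \<in> (\<lambda>f. \<Sum>i\<in>Basis. f i *\<^sub>R i) ` (Basis \<rightarrow>\<^sub>E \<rat>)" by (intro image_eqI)
  qed
  moreover have "countable (Basis \<rightarrow>\<^sub>E (\<rat> :: real set) :: ('a \<Rightarrow> real) set)"
    by (intro countable_PiE) (auto simp: countable_rat)
  ultimately show ?thesis by (meson countable_image countable_subset)
qed

definition rational_boxes :: "'a::euclidean_space set set" where
  "rational_boxes = (\<lambda>(a, b). box a b) ` (rational_vectors \<times> rational_vectors)"

text \<open>Asking for the closed box inside \<open>U\<close> leaves room for test functions that
  vanish outside it and so have compact support in \<open>U\<close>.\<close>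

lemma rational_box_around:
  fixes x :: "'a::euclidean_space"
  assumes "open U" "x \<in> U"
  shows "\<exists>a\<in>rational_vectors. \<exists>b\<in>rational_vectors. x \<in> box a b \<and> cbox a b \<subseteq> U"
proof -
  obtain e where e: "e > 0" "cball x e \<subseteq> U" using assms open_contains_cball by blast
  have "x \<in> ball x e" using e by simp
  then obtain f where f: "f \<in> Basis \<rightarrow>\<^sub>E \<rat> \<times> \<rat>" and
    fb: "x \<in> box (\<Sum>i\<in>Basis. fst (f i) *\<^sub>R i) (\<Sum>i\<in>Basis. snd (f i) *\<^sub>R i)"
     "box (\<Sum>i\<in>Basis. fst (f i) *\<^sub>R i) (\<Sum>i\<in>Basis. snd (f i) *\<^sub>R i) \<subseteq> ball x e"
    using open_UNION_box[OF open_ball[of x e]] by blast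
  let ?a = "\<Sum>i\<in>Basis. fst (f i) *\<^sub>R i" and ?b = "\<Sum>i\<in>Basis. snd (f i) *\<^sub>R i"
  have r: "?a \<in> rational_vectors" "?b \<in> rational_vectors"
    using f unfolding rational_vectors_def by (auto simp: PiE_def Pi_def mem_Times_iff)
  have "box ?a ?b \<noteq> {}" using fb(1) by blast
  then have "cbox ?a ?b = closure (box ?a ?b)" by (rule closure_box[symmetric])
  also have "\<dots> \<subseteq> cball x e" by (rule closure_minimal[OF subset_trans[OF fb(2) ball_subset_cball] closed_cball])
  finally have "cbox ?a ?b \<subseteq> U" using e(2) by (rule subset_trans)
  with r fb(1) show ?thesis by (intro bexI[of _ ?a] bexI[of _ ?b] conjI)
qed

lemma sets_borel_rational_boxes: "sets (borel :: 'a::euclidean_space measure) = sigma_sets UNIV rational_boxes"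
proof -
  have open_sets: "M \<in> sets (sigma UNIV rational_boxes)" if M: "open M" for M :: "'a set"
  proof -
    define C where "C = {B \<in> rational_boxes. B \<subseteq> M}"
    have "countable (rational_boxes :: 'a set set)" unfolding rational_boxes_def
      using countable_rational_vectors by (intro countable_image countable_SIGMA)
    then have "countable C" unfolding C_def by (rule countable_subset[rotated]) auto
    moreover have "M = \<Union>C"
    proof
      show "M \<subseteq> \<Union>C"
      proof
        fix x assume "x \<in> M"
        from rational_box_around[OF M this] obtain a b where "a \<in> rational_vectors" "b \<in> rational_vectors" "x \<in> box a b" "cbox a b \<subseteq> M"
          by blast
        then show "x \<in> \<Union>C" unfolding C_def rational_boxes_def using box_subset_cbox by fastforce
      qed
    qed (auto simp: C_def)
    moreover have "C \<subseteq> sets (sigma UNIV rational_boxes)" unfolding C_def by auto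
    ultimately show ?thesis using sets.countable_Union by metis
  qed
  have "borel = sigma UNIV (rational_boxes :: 'a set set)"
    by (subst rational_boxes_def, rule borel_eq_sigmaI1[OF borel_def], fold rational_boxes_def)
      (auto dest!: open_sets)
  moreover have "sets (sigma UNIV (rational_boxes :: 'a set set)) = sigma_sets UNIV rational_boxes"
    by (rule sets_measure_of) simp
  ultimately show ?thesis by metis
qed

lemma Int_stable_rational_boxes: "Int_stable (rational_boxes :: 'a::euclidean_space set set)"
proof (rule Int_stableI)
  fix A B :: "'a set" assume "A \<in> rational_boxes" "B \<in> rational_boxes"
  then obtain a b c d where "a \<in> rational_vectors" "b \<in> rational_vectors" "c \<in> rational_vectors" "d \<in> rational_vectors"
    and AB: "A = box a b" "B = box c d" unfolding rational_boxes_def by auto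
  moreover have "(\<Sum>i\<in>Basis. max (a\<bullet>i) (c\<bullet>i) *\<^sub>R i) \<in> rational_vectors" "(\<Sum>i\<in>Basis. min (b\<bullet>i) (d\<bullet>i) *\<^sub>R i) \<in> rational_vectors"
    using calculation unfolding rational_vectors_def by (auto simp: max_def min_def)
  ultimately show "A \<inter> B \<in> rational_boxes" unfolding AB box_Int_box rational_boxes_def by auto
qed

text \<open>Inside one box \<open>S\<close> the vanishing of the integrals extends from boxes to all
  Borel sets by a Dynkin argument. Integrating over the sets where the function has a fixed sign
  then shows that it vanishes almost everywhere in \<open>S\<close>, and countably many boxes cover
  \<open>U\<close>.\<close>

lemma AE_zero_if_box_integrals_zero:
  fixes h :: "'a::euclidean_space \<Rightarrow> real"
  assumes h: "integrable lebesgue h" and U: "open U"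
    and zero: "\<And>a b. a \<in> rational_vectors \<Longrightarrow> b \<in> rational_vectors \<Longrightarrow> cbox a b \<subseteq> U \<Longrightarrow> (LINT x:box a b|lebesgue. h x) = 0"
  shows "AE x in lebesgue. x \<in> U \<longrightarrow> h x = 0"
proof -
  have si: "set_integrable lebesgue A h" if "A \<in> sets borel" for A
    unfolding set_integrable_def using h that by (intro integrable_mult_indicator) auto
  have box_zero: "AE x in lebesgue. x \<in> box a b \<longrightarrow> h x = 0"
    if ab: "a \<in> rational_vectors" "b \<in> rational_vectors" "cbox a b \<subseteq> U" for a b
  proof -
    define S where "S = box a b"
    have S: "S \<in> sets borel" by (simp add: S_def)
    have z: "(LINT x:A \<inter> S|lebesgue. h x) = 0" if "A \<in> sets borel" for A
    proof -
      have subset_Pow_UNIV: "rational_boxes \<subseteq> Pow (UNIV :: 'a set)" by simp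
      have "A \<in> sigma_sets UNIV rational_boxes" using that sets_borel_rational_boxes by auto
      then show ?thesis
      proof (induction A rule: sigma_sets_induct_disjoint[OF Int_stable_rational_boxes subset_Pow_UNIV,
            consumes 1, case_names basic empty compl union])
        case (basic A)
        then obtain c d where cd: "c \<in> rational_vectors" "d \<in> rational_vectors" "A = box c d"
          unfolding rational_boxes_def by auto
        have r: "(\<Sum>i\<in>Basis. max (c\<bullet>i) (a\<bullet>i) *\<^sub>R i) \<in> rational_vectors" "(\<Sum>i\<in>Basis. min (d\<bullet>i) (b\<bullet>i) *\<^sub>R i) \<in> rational_vectors"
          using cd ab unfolding rational_vectors_def by (auto simp: max_def min_def)
        have "cbox c d \<inter> cbox a b = cbox (\<Sum>i\<in>Basis. max (c\<bullet>i) (a\<bullet>i) *\<^sub>R i) (\<Sum>i\<in>Basis. min (d\<bullet>i) (b\<bullet>i) *\<^sub>R i)"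
          by (rule Int_interval)
        then have "cbox (\<Sum>i\<in>Basis. max (c\<bullet>i) (a\<bullet>i) *\<^sub>R i) (\<Sum>i\<in>Basis. min (d\<bullet>i) (b\<bullet>i) *\<^sub>R i) \<subseteq> U"
          using ab(3) by blast
        from zero[OF r this] show ?case unfolding cd(3) S_def box_Int_box .
      next
        case empty
        show ?case by (simp add: set_lebesgue_integral_def)
      next
        case (compl A)
        have A: "A \<in> sets borel" using compl(1) sets_borel_rational_boxes by auto
        have S0: "(LINT x:S|lebesgue. h x) = 0" unfolding S_def by (rule zero[OF ab])
        have "(LINT x:(A \<inter> S) \<union> ((UNIV - A) \<inter> S)|lebesgue. h x) = (LINT x:A \<inter> S|lebesgue. h x) + (LINT x:(UNIV - A) \<inter> S|lebesgue. h x)"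
          using A S by (intro set_integral_Un si) auto
        moreover have "(A \<inter> S) \<union> ((UNIV - A) \<inter> S) = S" by blast
        ultimately show ?case using S0 compl(2) by simp
      next
        case (union A)
        have A: "A i \<in> sets borel" for i using union(2) sets_borel_rational_boxes by auto
        have "(LINT x:(\<Union>i. A i \<inter> S)|lebesgue. h x) = (\<Sum>i. LINT x:A i \<inter> S|lebesgue. h x)"
        proof (rule lebesgue_integral_countable_add)
          show "A i \<inter> S \<in> sets lebesgue" for i using A S by auto
          show "A i \<inter> S \<inter> (A j \<inter> S) = {}" if "i \<noteq> j" for i j
            using union(1) that unfolding disjoint_family_on_def by auto
          show "set_integrable lebesgue (\<Union>i. A i \<inter> S) h" using A S by (intro si) auto
        qed
        also have "\<dots> = 0" unfolding union(3) by simp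
        finally have "(LINT x:(\<Union>i. A i \<inter> S)|lebesgue. h x) = 0" .
        moreover have "(\<Union>i. A i) \<inter> S = (\<Union>i. A i \<inter> S)" by blast
        ultimately show ?case by (simp only:)
      qed
    qed
    \<comment> \<open>The sign sets must be Borel for the preceding step, while \<open>h\<close> is
      only Lebesgue measurable; they are taken from a Borel version \<open>g\<close>.\<close>
    have "h \<in> borel_measurable (completion lborel)" using h by auto
    from completion_ex_borel_measurable_real[OF this]
    obtain g where g: "g \<in> borel_measurable lborel" "AE x in lborel. h x = g x" by blast
    have hg: "AE x in lebesgue. h x = g x" by (rule AE_completion[OF g(2)])
    have AEz: "AE x in lebesgue. indicator (A \<inter> S) x * g x = 0"
      if A: "A \<in> sets borel" and c: "c = 1 \<or> c = -1" and nn: "\<And>x. x \<in> A \<Longrightarrow> c * g x \<ge> 0" for A and c :: real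
    proof -
      have ih: "integrable lebesgue (\<lambda>x. indicator (A \<inter> S) x * h x)"
        using si[of "A \<inter> S"] A S unfolding set_integrable_def by auto
      have AEe: "AE x in lebesgue. c * (indicator (A \<inter> S) x * h x) = c * (indicator (A \<inter> S) x * g x)" using hg by eventually_elim simp
      have gm: "g \<in> borel_measurable lebesgue" using g(1) by (rule measurable_completion)
      have m: "(\<lambda>x. c * (indicator (A \<inter> S) x * g x)) \<in> borel_measurable lebesgue" 
        using A S by (intro borel_measurable_times borel_measurable_const borel_measurable_indicator gm) auto
      have m2: "(\<lambda>x. c * (indicator (A \<inter> S) x * h x)) \<in> borel_measurable lebesgue" using ih by auto
      have ig: "integrable lebesgue (\<lambda>x. c * (indicator (A \<inter> S) x * g x))"
        using integrable_cong_AE[OF m2 m AEe] ih by simp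
      have "integral\<^sup>L lebesgue (\<lambda>x. c * (indicator (A \<inter> S) x * g x)) = integral\<^sup>L lebesgue (\<lambda>x. c * (indicator (A \<inter> S) x * h x))"
        by (rule integral_cong_AE[OF m2 m AEe, symmetric])
      also have "\<dots> = c * (LINT x:A \<inter> S|lebesgue. h x)" unfolding set_lebesgue_integral_def by simp
      also have "\<dots> = 0" using z[OF A] by simp
      finally have "AE x in lebesgue. c * (indicator (A \<inter> S) x * g x) = 0"
        using integral_nonneg_eq_0_iff_AE[OF ig] nn by (auto simp: indicator_def)
      then show ?thesis by eventually_elim (use c in auto)
    qed
    have gb: "g \<in> borel_measurable borel" using g(1) by simp
    have "{x. 0 \<le> g x} \<in> sets borel" "{x. g x \<le> 0} \<in> sets borel" using gb by measurable
    from AEz[OF this(1), of 1] AEz[OF this(2), of "-1"]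
    have "AE x in lebesgue. indicator ({x. 0 \<le> g x} \<inter> S) x * g x = 0" "AE x in lebesgue. indicator ({x. g x \<le> 0} \<inter> S) x * g x = 0" by auto
    with hg show ?thesis unfolding S_def[symmetric]
      by eventually_elim (auto simp: indicator_def split: if_splits)
  qed
  define I where "I = {(a, b) \<in> rational_vectors \<times> rational_vectors. cbox a b \<subseteq> U}"
  have cI: "countable I" unfolding I_def
    by (rule countable_subset[of _ "rational_vectors \<times> rational_vectors"]) (auto intro: countable_SIGMA countable_rational_vectors)
  have "AE x in lebesgue. x \<in> box (fst p) (snd p) \<longrightarrow> h x = 0" if "p \<in> I" for p
    using box_zero[of "fst p" "snd p"] that unfolding I_def by auto
  then have "AE x in lebesgue. \<forall>p\<in>I. x \<in> box (fst p) (snd p) \<longrightarrow> h x = 0"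
    unfolding AE_ball_countable[OF cI] by blast
  then show ?thesis
  proof eventually_elim
    case (elim x)
    show ?case
    proof
      assume "x \<in> U"
      from rational_box_around[OF U this] elim show "h x = 0" unfolding I_def by fastforce
    qed
  qed
qed

section \<open>Test functions\<close>

lemma pd_eqI: "(f has_derivative f') (at x) \<Longrightarrow> pd j f x = f' (axis j 1)"
  unfolding pd_def using frechet_derivative_at by metis

lemma C1_has_derivative: "C1_on UNIV f \<Longrightarrow> (f has_derivative frechet_derivative f (at x)) (at x)"
  unfolding C1_on_def using frechet_derivative_works by blast

lemma C1_onI:
  assumes "\<And>x. (f has_derivative f' x) (at x)" "\<And>j. continuous_on UNIV (\<lambda>x. f' x (axis j 1))"
  shows "C1_on UNIV f"
proof -
  have "pd j f = (\<lambda>x. f' x (axis j 1))" for j using pd_eqI[OF assms(1)] by blast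
  then show ?thesis using assms unfolding C1_on_def by (auto simp: differentiable_def)
qed

lemma C1_continuous: "C1_on UNIV f \<Longrightarrow> continuous_on UNIV f"
  unfolding C1_on_def by (meson continuous_at_imp_continuous_on differentiable_imp_continuous_within)

lemma C1_mult:
  assumes f: "C1_on UNIV f" and g: "C1_on UNIV g"
  shows "C1_on UNIV (\<lambda>x. f x * g x)"
proof (rule C1_onI)
  show "((\<lambda>x. f x * g x) has_derivative (\<lambda>h. f x * frechet_derivative g (at x) h + frechet_derivative f (at x) h * g x)) (at x)" for x
    by (rule has_derivative_mult[OF C1_has_derivative[OF f] C1_has_derivative[OF g]])
  have "continuous_on UNIV (\<lambda>x. f x * pd j g x + pd j f x * g x)" for j
    using f g C1_continuous[OF f] C1_continuous[OF g] unfolding C1_on_def by (intro continuous_intros) auto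
  then show "continuous_on UNIV (\<lambda>x. f x * frechet_derivative g (at x) (axis j 1) + frechet_derivative f (at x) (axis j 1) * g x)" for j
    unfolding pd_def .
qed

lemma C1_compose_real:
  fixes \<theta> :: "real \<Rightarrow> real"
  assumes f: "C1_on UNIV f" and \<theta>: "\<And>s. (\<theta> has_real_derivative \<theta>' s) (at s)" and c: "continuous_on UNIV \<theta>'"
  shows "C1_on UNIV (\<lambda>x. \<theta> (f x))"
proof (rule C1_onI)
  have "(\<theta> has_derivative (\<lambda>h. \<theta>' s * h)) (at s)" for s
    using \<theta>[of s] unfolding has_field_derivative_def .
  from has_derivative_compose[OF C1_has_derivative[OF f] this]
  show "((\<lambda>x. \<theta> (f x)) has_derivative (\<lambda>h. \<theta>' (f x) * frechet_derivative f (at x) h)) (at x)" for x .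
  have "continuous_on UNIV (\<lambda>x. \<theta>' (f x))"
    using continuous_on_compose2[OF c C1_continuous[OF f]] by auto
  then have "continuous_on UNIV (\<lambda>x. \<theta>' (f x) * pd j f x)" for j
    using f unfolding C1_on_def by (intro continuous_intros) auto
  then show "continuous_on UNIV (\<lambda>x. \<theta>' (f x) * frechet_derivative f (at x) (axis j 1))" for j
    unfolding pd_def .
qed

lemma C1_nth: "C1_on UNIV (\<lambda>x. x $ i)"
proof (rule C1_onI)
  show "((\<lambda>x. x $ i) has_derivative (\<lambda>h. h $ i)) (at x)" for x :: "real^'a"
    by (rule bounded_linear.has_derivative[OF bounded_linear_vec_nth has_derivative_ident])
qed auto

lemma C1_const: "C1_on UNIV (\<lambda>x. c)"
  by (rule C1_onI[where f' = "\<lambda>_ _. 0"]) auto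

lemma C1_prod:
  assumes "finite A" "\<And>i. i \<in> A \<Longrightarrow> C1_on UNIV (F i)" shows "C1_on UNIV (\<lambda>x. \<Prod>i\<in>A. F i x)"
  using assms by (induction A rule: finite_induct) (auto intro: C1_mult C1_const)

text \<open>The squared positive part is continuously differentiable, which is all the smoothness
  that \<open>test_fun\<close> demands; it cuts polynomials off to bumps with compact
  support.\<close>

lemma pos_square_derivative:
  "((\<lambda>s. (max 0 s)\<^sup>2) has_real_derivative 2 * max 0 s) (at (s :: real))"
proof (cases "s = 0")
  case True
  have "((\<lambda>h. ((max 0 h)\<^sup>2) / h) \<longlongrightarrow> 0) (at (0::real))"
  proof (rule Lim_null_comparison)
    show "\<forall>\<^sub>F h in at 0. norm ((max 0 h)\<^sup>2 / h) \<le> \<bar>h\<bar>"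
      by (rule always_eventually) (auto simp: max_def power2_eq_square)
    show "(abs \<longlongrightarrow> 0) (at (0::real))" by (intro tendsto_rabs_zero tendsto_ident_at)
  qed
  then show ?thesis unfolding True DERIV_def by simp
next
  case False
  show ?thesis
  proof (cases "s > 0")
    case True
    have "((\<lambda>s. s\<^sup>2) has_real_derivative 2 * max 0 s) (at s)"
      using True by (auto intro!: derivative_eq_intros)
    moreover have ev: "\<forall>\<^sub>F x in nhds s. (max 0 x)\<^sup>2 = x\<^sup>2"
      using eventually_nhds_in_open[of "{0<..}" s] True by (auto elim!: eventually_mono simp: max_def)
    ultimately show ?thesis by (simp add: DERIV_cong_ev[OF refl ev refl])
  next
    case neg: False
    have "((\<lambda>s. 0) has_real_derivative 2 * max 0 s) (at s)"
      using neg by (auto intro!: derivative_eq_intros)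
    moreover have ev: "\<forall>\<^sub>F x in nhds s. (max 0 x)\<^sup>2 = (0::real)"
      using eventually_nhds_in_open[of "{..<0}" s] neg False by (auto elim!: eventually_mono simp: max_def)
    ultimately show ?thesis by (simp add: DERIV_cong_ev[OF refl ev refl])
  qed
qed

definition box_bump :: "real^'n::finite \<Rightarrow> real^'n \<Rightarrow> real^'n \<Rightarrow> real" where
  "box_bump a b x = (\<Prod>i\<in>UNIV. (max 0 ((x $ i - a $ i) * (b $ i - x $ i)))\<^sup>2)"

lemma C1_box_bump: "C1_on UNIV (box_bump a b)"
proof -
  have "C1_on UNIV (\<lambda>x. (max 0 ((x $ i - a $ i) * (b $ i - x $ i)))\<^sup>2)" for i
  proof -
    have "C1_on UNIV (\<lambda>x. (\<lambda>s. (s - a $ i) * (b $ i - s)) (x $ i))"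
      by (rule C1_compose_real[OF C1_nth, where \<theta>' = "\<lambda>s. (b $ i - s) - (s - a $ i)"])
        (auto intro!: derivative_eq_intros continuous_intros)
    then have "C1_on UNIV (\<lambda>x. (\<lambda>s. (max 0 s)\<^sup>2) ((x $ i - a $ i) * (b $ i - x $ i)))"
      by (rule C1_compose_real[OF _ pos_square_derivative]) (auto intro!: continuous_intros)
    then show ?thesis by simp
  qed
  then show ?thesis unfolding box_bump_def[abs_def] by (intro C1_prod) auto
qed

lemma box_bump_nonneg: "0 \<le> box_bump a b x"
  unfolding box_bump_def by (intro prod_nonneg) auto

lemma box_bump_pos_iff:
  assumes "box a b \<noteq> {}"
  shows "0 < box_bump a b x \<longleftrightarrow> x \<in> box a b"
proof -
  have ab: "a $ i < b $ i" for i using assms by (simp add: box_ne_empty Basis_vec_def inner_axis' ) (metis inner_axis inner_commute mult_1 inner_real_def)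
  have "(x $ i - a $ i) * (b $ i - x $ i) > 0 \<longleftrightarrow> a $ i < x $ i \<and> x $ i < b $ i" for i
    using ab[of i] by (auto simp: zero_less_mult_iff)
  then have "x \<in> box a b \<longleftrightarrow> (\<forall>i. (x $ i - a $ i) * (b $ i - x $ i) > 0)" by (auto simp: mem_box_cart)
  also have "\<dots> \<longleftrightarrow> box_bump a b x \<noteq> 0"
  proof -
    have eq: "(max 0 y)\<^sup>2 = 0 \<longleftrightarrow> \<not> 0 < y" for y :: real by (auto simp: max_def)
    have "box_bump a b x = 0 \<longleftrightarrow> (\<exists>i. (max 0 ((x $ i - a $ i) * (b $ i - x $ i)))\<^sup>2 = 0)"
      unfolding box_bump_def by (subst prod_zero_iff) simp_all
    then show ?thesis unfolding eq by blast
  qed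
  also have "\<dots> \<longleftrightarrow> 0 < box_bump a b x" using box_bump_nonneg[of a b x] by auto
  finally show ?thesis by simp
qed

text \<open>As \<open>c\<close> tends to infinity these functions tend to the indicator of the open
  box while staying between 0 and 1 for nonnegative \<open>c\<close>, so integrals over boxes are
  limits of integrals against test functions.\<close>

lemma box_test_fun:
  assumes ab: "box a b \<noteq> {}" and sub: "cbox a b \<subseteq> \<Omega>"
  shows "test_fun \<Omega> (\<lambda>x. 1 - exp (- (c * box_bump a b x)))"
proof -
  have C1: "C1_on UNIV (\<lambda>x. (\<lambda>s. 1 - exp (- (c * s))) (box_bump a b x))"
    by (rule C1_compose_real[OF C1_box_bump, where \<theta>' = "\<lambda>s. c * exp (- (c * s))"])
      (auto intro!: derivative_eq_intros continuous_intros)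
  have "{x. 1 - exp (- (c * box_bump a b x)) \<noteq> 0} \<subseteq> cbox a b"
  proof
    fix x assume "x \<in> {x. 1 - exp (- (c * box_bump a b x)) \<noteq> 0}"
    then have "box_bump a b x \<noteq> 0" by auto
    then have "x \<in> box a b" using box_bump_pos_iff[OF ab, of x] box_bump_nonneg[of a b x] by simp
    then show "x \<in> cbox a b" using box_subset_cbox by blast
  qed
  then have cl: "closure {x. 1 - exp (- (c * box_bump a b x)) \<noteq> 0} \<subseteq> cbox a b"
    and "compact (closure {x. 1 - exp (- (c * box_bump a b x)) \<noteq> 0})"
    using closure_minimal[OF _ closed_cbox] bounded_subset[OF bounded_cbox] by (simp_all only: compact_closure)
  then show ?thesis unfolding test_fun_def using C1 cl sub by auto
qed

text \<open>Stated for any continuous nonnegative \<open>Q\<close>, because it serves in space with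
  \<open>box_bump\<close> and in time with its analogue in one variable.\<close>

lemma bump_limit:
  fixes h Q :: "'a::euclidean_space \<Rightarrow> real"
  assumes h: "integrable lebesgue h" and c: "continuous_on UNIV Q" and nn: "\<And>x. 0 \<le> Q x"
  shows "(\<lambda>k. LINT x|lebesgue. h x * (1 - exp (- (real k * Q x)))) \<longlonglongrightarrow> (LINT x:{x. 0 < Q x}|lebesgue. h x)"
  unfolding set_lebesgue_integral_def
proof (rule integral_dominated_convergence[where w = "\<lambda>x. norm (h x)"])
  have ce: "continuous_on UNIV (\<lambda>x. 1 - exp (- (real k * Q x)))" for k by (intro continuous_intros c)
  have "(\<lambda>x. 1 - exp (- (real k * Q x))) \<in> borel_measurable lebesgue" for k
    using borel_measurable_continuous_onI[OF ce[of k]] by (intro measurable_completion) simp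
  then show "(\<lambda>x. h x * (1 - exp (- (real k * Q x)))) \<in> borel_measurable lebesgue" for k
    using h by (intro borel_measurable_times) auto
  have "open {x. 0 < Q x}" by (intro open_Collect_less continuous_intros c)
  then show "(\<lambda>x. indicator {x. 0 < Q x} x *\<^sub>R h x) \<in> borel_measurable lebesgue"
    by (intro borel_measurable_scaleR[OF borel_measurable_indicator borel_measurable_integrable[OF h]]) simp
  show "integrable lebesgue (\<lambda>x. norm (h x))" using h by (rule integrable_norm)
  have "(\<lambda>k. h x * (1 - exp (- (real k * Q x)))) \<longlonglongrightarrow> indicator {x. 0 < Q x} x *\<^sub>R h x" for x
  proof (cases "0 < Q x")
    case True
    have "(\<lambda>k. exp (- Q x) ^ k) \<longlonglongrightarrow> 0" using True by (intro LIMSEQ_power_zero) auto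
    moreover have "exp (- Q x) ^ k = exp (- (real k * Q x))" for k
      by (simp add: exp_of_nat_mult[symmetric])
    ultimately have "(\<lambda>k. 1 - exp (- (real k * Q x))) \<longlonglongrightarrow> 1 - 0" by (intro tendsto_diff) auto
    from tendsto_mult_left[OF this, of "h x"] show ?thesis using True by simp
  next
    case False
    then have "Q x = 0" using nn[of x] by simp
    then show ?thesis by simp
  qed
  then show "AE x in lebesgue. (\<lambda>k. h x * (1 - exp (- (real k * Q x)))) \<longlonglongrightarrow> indicator {x. 0 < Q x} x *\<^sub>R h x" by simp
  have "norm (h x * (1 - exp (- (real k * Q x)))) \<le> norm (h x)" for k x
  proof -
    have "\<bar>h x\<bar> * \<bar>1 - exp (- (real k * Q x))\<bar> \<le> \<bar>h x\<bar> * 1" using nn[of x] by (intro mult_left_mono) auto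
    then show ?thesis by (simp add: abs_mult)
  qed
  then show "AE x in lebesgue. norm (h x * (1 - exp (- (real k * Q x)))) \<le> norm (h x)" for k by simp
qed

lemma fundamental_lemma:
  fixes h :: "real^'n::finite \<Rightarrow> real"
  assumes \<Omega>: "open \<Omega>" and h: "integrable (lebesgue_on \<Omega>) h"
    and zero: "\<And>\<phi>. test_fun \<Omega> \<phi> \<Longrightarrow> (LINT x|lebesgue_on \<Omega>. h x * \<phi> x) = 0"
  shows "AE x in lebesgue_on \<Omega>. h x = 0"
proof -
  have \<Omega>s: "\<Omega> \<inter> space lebesgue \<in> sets lebesgue" "\<Omega> \<in> sets lebesgue" using \<Omega> by auto
  have hl: "integrable lebesgue (\<lambda>x. indicator \<Omega> x *\<^sub>R h x)"
    using h integrable_restrict_space[OF \<Omega>s(1)] by blast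
  have "AE x in lebesgue. x \<in> \<Omega> \<longrightarrow> indicator \<Omega> x *\<^sub>R h x = 0"
  proof (rule AE_zero_if_box_integrals_zero[OF hl \<Omega>])
    fix a b :: "real^'n" assume sub: "cbox a b \<subseteq> \<Omega>"
    show "(LINT x:box a b|lebesgue. indicator \<Omega> x *\<^sub>R h x) = 0"
    proof (cases "box a b = {}")
      case True then show ?thesis by (simp add: set_lebesgue_integral_def)
    next
      case ab: False
      have "(LINT x|lebesgue. (indicator \<Omega> x *\<^sub>R h x) * (1 - exp (- (real k * box_bump a b x)))) = 0" for k
        using zero[OF box_test_fun[OF ab sub, of "real k"]]
          integral_restrict_space[OF \<Omega>s(1), of "\<lambda>x. h x * (1 - exp (- (real k * box_bump a b x)))"]
        by (simp add: mult.assoc)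
      moreover have "{x. 0 < box_bump a b x} = box a b" using box_bump_pos_iff[OF ab] by blast
      ultimately show ?thesis
        using bump_limit[OF hl C1_continuous[OF C1_box_bump] box_bump_nonneg, of a b] by (simp add: LIMSEQ_const_iff)
    qed
  qed
  then show ?thesis unfolding AE_restrict_space_iff[OF \<Omega>s(1)] by eventually_elim auto
qed

section \<open>The Hilbert space of square integrable functions\<close>

definition sq_int :: "(real^'n::finite \<Rightarrow> real) \<Rightarrow> bool" where
  "sq_int f \<longleftrightarrow> f \<in> borel_measurable lebesgue \<and> integrable lebesgue (\<lambda>x. (f x)\<^sup>2)"

lemma sq_int_mult_integrable:
  assumes "sq_int f" "sq_int g" shows "integrable lebesgue (\<lambda>x. f x * g x)"
proof (rule Bochner_Integration.integrable_bound)
  show "integrable lebesgue (\<lambda>x. (f x)\<^sup>2 + (g x)\<^sup>2)" using assms unfolding sq_int_def by auto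
  show "(\<lambda>x. f x * g x) \<in> borel_measurable lebesgue" using assms unfolding sq_int_def by auto
  have "\<bar>f x * g x\<bar> \<le> (f x)\<^sup>2 + (g x)\<^sup>2" for x
    using sum_squares_bound[of "\<bar>f x\<bar>" "\<bar>g x\<bar>"] mult_nonneg_nonneg[of "\<bar>f x\<bar>" "\<bar>g x\<bar>"]
    unfolding abs_mult power2_abs by linarith
  then show "AE x in lebesgue. norm (f x * g x) \<le> norm ((f x)\<^sup>2 + (g x)\<^sup>2)" by simp
qed

lemma sq_int_scale: "sq_int f \<Longrightarrow> sq_int (\<lambda>x. c * f x)"
  unfolding sq_int_def by (auto simp: power_mult_distrib)

lemma sq_int_add:
  assumes "sq_int f" "sq_int g" shows "sq_int (\<lambda>x. f x + g x)"
proof -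
  have "integrable lebesgue (\<lambda>x. (f x)\<^sup>2 + 2 * (f x * g x) + (g x)\<^sup>2)"
    using assms sq_int_mult_integrable[OF assms] unfolding sq_int_def by auto
  then have "integrable lebesgue (\<lambda>x. (f x + g x)\<^sup>2)" by (simp add: power2_sum mult.assoc add_ac)
  then show ?thesis using assms unfolding sq_int_def by auto
qed

lemma sq_int_zero: "sq_int (\<lambda>x. 0)"
  unfolding sq_int_def by simp

lemma sq_int_bounded_mult:
  assumes f: "sq_int f" and c: "c \<in> borel_measurable lebesgue" "\<And>x. \<bar>c x\<bar> \<le> K"
  shows "sq_int (\<lambda>x. c x * f x)"
proof -
  have "integrable lebesgue (\<lambda>x. (c x * f x)\<^sup>2)"
  proof (rule Bochner_Integration.integrable_bound)
    show "integrable lebesgue (\<lambda>x. K\<^sup>2 * (f x)\<^sup>2)" using f unfolding sq_int_def by auto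
    show "(\<lambda>x. (c x * f x)\<^sup>2) \<in> borel_measurable lebesgue" using f c unfolding sq_int_def by auto
    have "(c x)\<^sup>2 \<le> K\<^sup>2" for x using c(2)[of x] by (metis abs_ge_zero power2_abs power_mono)
    then show "AE x in lebesgue. norm ((c x * f x)\<^sup>2) \<le> norm (K\<^sup>2 * (f x)\<^sup>2)"
      by (intro AE_I2) (simp add: power_mult_distrib mult_right_mono)
  qed
  then show ?thesis using f c unfolding sq_int_def by auto
qed

\<comment> \<open>The Hilbert space consists of classes on the whole space, so that one type serves
  every domain; functions on \<Omega> enter it extended by zero. The relation is partial since only
  square integrable functions have a class.\<close>
quotient_type (overloaded) 'n lsq = "real^'n::finite \<Rightarrow> real" / partial:
  "\<lambda>f g. sq_int f \<and> sq_int g \<and> (AE x in lebesgue. f x = g x)"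
proof (rule part_equivpI)
  show "\<exists>f. sq_int f \<and> sq_int f \<and> (AE x in lebesgue. f x = f x)" using sq_int_zero by auto
  show "symp (\<lambda>f g. sq_int f \<and> sq_int g \<and> (AE x in lebesgue. f x = g x))"
    by (rule sympI) (auto elim: eventually_mono)
  show "transp (\<lambda>f g. sq_int f \<and> sq_int g \<and> (AE x in lebesgue. f x = g x))"
  proof (rule transpI)
    fix f g h assume a: "sq_int f \<and> sq_int g \<and> (AE x in lebesgue. f x = g x)" "sq_int g \<and> sq_int h \<and> (AE x in lebesgue. g x = h x)"
    have "AE x in lebesgue. f x = h x" using a[THEN conjunct2, THEN conjunct2] by eventually_elim simp
    with a show "sq_int f \<and> sq_int h \<and> (AE x in lebesgue. f x = h x)" by blast
  qed
qed

instantiation lsq :: (finite) real_inner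
begin

lift_definition zero_lsq :: "'a lsq" is "\<lambda>x. 0" by (simp add: sq_int_zero)

lift_definition plus_lsq :: "'a lsq \<Rightarrow> 'a lsq \<Rightarrow> 'a lsq" is "\<lambda>f g x. f x + g x"
proof (intro conjI)
  fix f f' g g' :: "real^'a \<Rightarrow> real"
  assume a: "sq_int f \<and> sq_int f' \<and> (AE x in lebesgue. f x = f' x)" "sq_int g \<and> sq_int g' \<and> (AE x in lebesgue. g x = g' x)"
  show "AE x in lebesgue. f x + g x = f' x + g' x" using a[THEN conjunct2, THEN conjunct2] by eventually_elim simp
qed (auto intro: sq_int_add)

lift_definition scaleR_lsq :: "real \<Rightarrow> 'a lsq \<Rightarrow> 'a lsq" is "\<lambda>c f x. c * f x"
proof (intro conjI)
  fix c and f f' :: "real^'a \<Rightarrow> real"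
  assume a: "sq_int f \<and> sq_int f' \<and> (AE x in lebesgue. f x = f' x)"
  then have "AE x in lebesgue. f x = f' x" by blast
  then show "AE x in lebesgue. c * f x = c * f' x" by eventually_elim simp
qed (auto intro: sq_int_scale)

definition uminus_lsq :: "'a lsq \<Rightarrow> 'a lsq" where "uminus_lsq f = (-1) *\<^sub>R f"
definition minus_lsq :: "'a lsq \<Rightarrow> 'a lsq \<Rightarrow> 'a lsq" where "minus_lsq f g = f + (- g)"

lift_definition inner_lsq :: "'a lsq \<Rightarrow> 'a lsq \<Rightarrow> real" is "\<lambda>f g. LINT x|lebesgue. f x * g x"
proof -
  fix f f' g g' :: "real^'a \<Rightarrow> real"
  assume a: "sq_int f \<and> sq_int f' \<and> (AE x in lebesgue. f x = f' x)" "sq_int g \<and> sq_int g' \<and> (AE x in lebesgue. g x = g' x)"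
  then have m: "(\<lambda>x. f x * g x) \<in> borel_measurable lebesgue" "(\<lambda>x. f' x * g' x) \<in> borel_measurable lebesgue"
    unfolding sq_int_def by auto
  have "AE x in lebesgue. f x * g x = f' x * g' x" using a[THEN conjunct2, THEN conjunct2] by eventually_elim simp
  then show "(LINT x|lebesgue. f x * g x) = (LINT x|lebesgue. f' x * g' x)" by (rule integral_cong_AE[OF m])
qed

definition norm_lsq :: "'a lsq \<Rightarrow> real" where "norm_lsq f = sqrt (inner f f)"
definition dist_lsq :: "'a lsq \<Rightarrow> 'a lsq \<Rightarrow> real" where "dist_lsq f g = norm (f - g)"
definition sgn_lsq :: "'a lsq \<Rightarrow> 'a lsq" where "sgn_lsq f = inverse (norm f) *\<^sub>R f"
definition uniformity_lsq :: "('a lsq \<times> 'a lsq) filter" where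
  "uniformity_lsq = (INF e\<in>{0<..}. principal {(x, y). dist x y < e})"
definition open_lsq :: "'a lsq set \<Rightarrow> bool" where
  "open_lsq U \<longleftrightarrow> (\<forall>x\<in>U. \<forall>\<^sub>F (x', y) in uniformity. x' = x \<longrightarrow> y \<in> U)"

instance
proof
  fix f g h :: "'a lsq" and a b :: real
  show "f + g + h = f + (g + h)" by transfer (auto intro: sq_int_add simp: add.assoc)
  show "f + g = g + f" by transfer (auto intro: sq_int_add simp: add.commute)
  show "0 + f = f" by transfer auto
  show "- f + f = 0" unfolding uminus_lsq_def by transfer (auto intro!: sq_int_add sq_int_scale sq_int_zero)
  show "f - g = f + (- g)" by (rule minus_lsq_def)
  show "a *\<^sub>R (f + g) = a *\<^sub>R f + a *\<^sub>R g"
    by transfer (auto intro!: sq_int_add sq_int_scale simp: distrib_left)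
  show "(a + b) *\<^sub>R f = a *\<^sub>R f + b *\<^sub>R f"
    by transfer (auto intro!: sq_int_add sq_int_scale simp: distrib_right)
  show "a *\<^sub>R b *\<^sub>R f = (a * b) *\<^sub>R f"
    by transfer (auto intro!: sq_int_scale simp: mult.assoc)
  show "1 *\<^sub>R f = f" by transfer auto
  show "dist f g = norm (f - g)" by (rule dist_lsq_def)
  show "sgn f = inverse (norm f) *\<^sub>R f" by (rule sgn_lsq_def)
  show "(uniformity :: ('a lsq \<times> 'a lsq) filter) = (INF e\<in>{0<..}. principal {(x, y). dist x y < e})"
    by (rule uniformity_lsq_def)
  show "open U = (\<forall>x\<in>U. \<forall>\<^sub>F (x', y) in uniformity. x' = x \<longrightarrow> y \<in> U)" for U :: "'a lsq set"
    by (rule open_lsq_def)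
  show "inner f g = inner g f" by transfer (simp add: mult.commute)
  show "inner (f + g) h = inner f h + inner g h"
    by transfer (simp add: distrib_right sq_int_mult_integrable)
  show "inner (a *\<^sub>R f) g = a * inner f g" by transfer (simp add: mult.assoc)
  show "0 \<le> inner f f" by transfer (auto intro: integral_nonneg_AE)
  show "inner f f = 0 \<longleftrightarrow> f = 0"
  proof transfer
    fix f :: "real^'a \<Rightarrow> real" assume "sq_int f \<and> sq_int f \<and> (AE x in lebesgue. f x = f x)"
    then have f: "sq_int f" by blast
    have "(LINT x|lebesgue. f x * f x) = 0 \<longleftrightarrow> (AE x in lebesgue. f x * f x = 0)"
      by (rule integral_nonneg_eq_0_iff_AE[OF sq_int_mult_integrable[OF f f]]) auto
    then show "(LINT x|lebesgue. f x * f x) = 0 \<longleftrightarrow> sq_int f \<and> sq_int (\<lambda>x. 0) \<and> (AE x in lebesgue. f x = 0)"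
      using f sq_int_zero by auto
  qed
  show "norm f = sqrt (inner f f)" by (rule norm_lsq_def)
qed

end

definition cls :: "(real^'n::finite \<Rightarrow> real) \<Rightarrow> 'n lsq" where "cls = abs_lsq"
definition rep :: "'n::finite lsq \<Rightarrow> real^'n \<Rightarrow> real" where "rep = rep_lsq"

lemma rep_sq_int: "sq_int (rep f)"
  unfolding rep_def using Quotient_rel_rep[OF Quotient_lsq] by (metis (no_types, lifting))

lemma cls_rep: "cls (rep f) = f"
  unfolding cls_def rep_def using Quotient_abs_rep[OF Quotient_lsq] .

lemma cls_eq_iff: "sq_int f \<Longrightarrow> sq_int g \<Longrightarrow> cls f = cls g \<longleftrightarrow> (AE x in lebesgue. f x = g x)"
  unfolding cls_def using Quotient_rel[OF Quotient_lsq, of f g] by auto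

lemma rep_cls: "sq_int f \<Longrightarrow> AE x in lebesgue. rep (cls f) x = f x"
  using cls_eq_iff[OF rep_sq_int] cls_rep by blast

lemma cls_inner: "sq_int f \<Longrightarrow> sq_int g \<Longrightarrow> cls f \<bullet> cls g = (LINT x|lebesgue. f x * g x)"
  unfolding cls_def by (rule inner_lsq.abs_eq) auto

lemma cls_add: "sq_int f \<Longrightarrow> sq_int g \<Longrightarrow> cls f + cls g = cls (\<lambda>x. f x + g x)"
  unfolding cls_def by (rule plus_lsq.abs_eq) auto

lemma cls_scale: "sq_int f \<Longrightarrow> c *\<^sub>R cls f = cls (\<lambda>x. c * f x)"
  unfolding cls_def by (rule scaleR_lsq.abs_eq) auto

lemma cls_diff: "sq_int f \<Longrightarrow> sq_int g \<Longrightarrow> cls f - cls g = cls (\<lambda>x. f x - g x)"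
proof -
  assume f: "sq_int f" and g: "sq_int g"
  have "cls f - cls g = cls f + (-1) *\<^sub>R cls g" by simp
  also have "\<dots> = cls (\<lambda>x. f x + (-1) * g x)" 
    by (simp only: cls_scale[OF g] cls_add[OF f sq_int_scale[OF g]])
  finally show ?thesis by simp
qed

lemma sq_int_diff: "sq_int f \<Longrightarrow> sq_int g \<Longrightarrow> sq_int (\<lambda>x. f x - g x)"
  using sq_int_add[of f "\<lambda>x. (-1) * g x"] sq_int_scale[of g "-1"] by simp

lemma norm_cls: "sq_int f \<Longrightarrow> (norm (cls f))\<^sup>2 = (LINT x|lebesgue. (f x)\<^sup>2)"
  unfolding power2_norm_eq_inner by (simp add: cls_inner power2_eq_square)

lemma nn_norm_cls: "sq_int f \<Longrightarrow> (\<integral>\<^sup>+x. ennreal ((f x)\<^sup>2) \<partial>lebesgue) = ennreal ((norm (cls f))\<^sup>2)"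
  by (simp add: norm_cls nn_integral_eq_integral sq_int_def)

text \<open>For a fast Cauchy sequence the sums of the absolute increments are bounded in L2, hence
  finite almost everywhere by monotone convergence. So the functions converge pointwise, and Fatou's
  lemma estimates the distance to the limit.\<close>

lemma riesz_fischer:
  fixes X :: "nat \<Rightarrow> 'n::finite lsq"
  assumes fast: "\<And>k j. k \<le> j \<Longrightarrow> norm (X j - X k) \<le> 2 * (1/2) ^ k"
  shows "convergent X"
proof -
  define f where "f k = rep (X k)" for k
  have f: "sq_int (f k)" and Xf: "X k = cls (f k)" for k unfolding f_def by (simp_all add: rep_sq_int cls_rep)
  have fm: "f k \<in> borel_measurable lebesgue" for k using f[of k] unfolding sq_int_def by blast
  define D where "D k x = \<bar>f (Suc k) x - f k x\<bar>" for k x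
  have D: "sq_int (D k)" for k
  proof -
    have d: "sq_int (\<lambda>x. f (Suc k) x - f k x)" by (rule sq_int_diff[OF f f])
    then show ?thesis unfolding sq_int_def D_def by auto
  qed
  have nD: "norm (cls (D k)) \<le> 2 * (1/2) ^ k" for k
  proof -
    have "(norm (cls (D k)))\<^sup>2 = (norm (X (Suc k) - X k))\<^sup>2"
      unfolding Xf cls_diff[OF f f] norm_cls[OF D] norm_cls[OF sq_int_diff[OF f f]] D_def by simp
    then have "norm (cls (D k)) = norm (X (Suc k) - X k)" by (simp add: power2_eq_iff_nonneg)
    then show ?thesis using fast[of k "Suc k"] by simp
  qed
  define S where "S N x = (\<Sum>k<N. D k x)" for N x
  \<comment> \<open>\<open>4 - 4 * (1/2) ^ N\<close> is the geometric sum of the first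
    \<open>N\<close> bounds in \<open>nD\<close>.\<close>
  have S: "sq_int (S N) \<and> norm (cls (S N)) \<le> 4 - 4 * (1/2) ^ N" for N
  proof (induction N)
    case 0
    have "cls (\<lambda>x. 0) = (0 :: 'n lsq)" unfolding cls_def zero_lsq_def ..
    then show ?case unfolding S_def by (simp add: sq_int_zero)
  next
    case (Suc N)
    have eq: "S (Suc N) = (\<lambda>x. S N x + D N x)" unfolding S_def by auto
    have "norm (cls (S (Suc N))) \<le> norm (cls (S N)) + norm (cls (D N))"
      unfolding eq using cls_add[of "S N" "D N"] Suc D norm_triangle_ineq by metis
    then show ?case using Suc nD[of N] D sq_int_add unfolding eq by auto
  qed
  have Sm: "S N \<in> borel_measurable lebesgue" for N using S[of N] unfolding sq_int_def by blast
  have D0: "0 \<le> D k x" for k x unfolding D_def by simp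
  have S0: "0 \<le> S N x" for N x unfolding S_def by (intro sum_nonneg D0)
  have Sinc: "S N x \<le> S (Suc N) x" for N x unfolding S_def using D0 by simp
  have "(\<integral>\<^sup>+x. (SUP N. ennreal ((S N x)\<^sup>2)) \<partial>lebesgue) = (SUP N. \<integral>\<^sup>+x. ennreal ((S N x)\<^sup>2) \<partial>lebesgue)"
  proof (rule nn_integral_monotone_convergence_SUP)
    show "incseq (\<lambda>N x. ennreal ((S N x)\<^sup>2))"
      by (intro incseq_SucI le_funI ennreal_leI power_mono Sinc S0)
  qed (use Sm in measurable)
  also have "\<dots> \<le> ennreal 16"
  proof (rule SUP_least)
    fix N
    have "(0 :: real) \<le> (1/2) ^ N" by simp
    then have "norm (cls (S N)) \<le> 4" using S[of N] by linarith
    then have "(norm (cls (S N)))\<^sup>2 \<le> 4\<^sup>2" by (intro power_mono) auto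
    then show "(\<integral>\<^sup>+x. ennreal ((S N x)\<^sup>2) \<partial>lebesgue) \<le> ennreal 16"
      unfolding nn_norm_cls[OF S[THEN conjunct1]] by (intro ennreal_leI) simp
  qed
  finally have fin: "(\<integral>\<^sup>+x. (SUP N. ennreal ((S N x)\<^sup>2)) \<partial>lebesgue) \<noteq> \<infinity>" by (auto simp: top_unique)
  have "AE x in lebesgue. (SUP N. ennreal ((S N x)\<^sup>2)) \<noteq> \<infinity>"
    by (rule nn_integral_PInf_AE[OF _ fin]) (use Sm in measurable)
  then have conv: "AE x in lebesgue. convergent (\<lambda>k. f k x)"
  proof eventually_elim
    case (elim x)
    have "summable (\<lambda>k. D k x)"
    proof (rule bounded_imp_summable[OF D0])
      fix N
      obtain r where r: "(SUP N. ennreal ((S N x)\<^sup>2)) = ennreal r" "0 \<le> r"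
        using elim by (cases "SUP N. ennreal ((S N x)\<^sup>2)") auto
      have "ennreal ((S (Suc N) x)\<^sup>2) \<le> ennreal r" unfolding r(1)[symmetric] by (rule SUP_upper) simp
      then have "(S (Suc N) x)\<^sup>2 \<le> r" using r(2) by (simp add: ennreal_le_iff)
      then have "S (Suc N) x \<le> sqrt r" by (rule real_le_rsqrt)
      \<comment> \<open>Summability needs one bound for all \<open>N\<close>. It is written as a
        choice depending on \<open>x\<close> alone, because \<open>r\<close> was obtained after
        \<open>N\<close> was fixed.\<close>
      then show "(\<Sum>k\<le>N. D k x) \<le> sqrt (SOME r. (SUP N. ennreal ((S N x)\<^sup>2)) = ennreal r \<and> 0 \<le> r)"
        using someI[of "\<lambda>r. (SUP N. ennreal ((S N x)\<^sup>2)) = ennreal r \<and> 0 \<le> r" r] r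
        unfolding S_def by (metis (no_types, lifting) ennreal_inj lessThan_Suc_atMost)
    qed
    then have "summable (\<lambda>k. f (Suc k) x - f k x)" unfolding D_def by (rule summable_rabs_cancel)
    then have "convergent (\<lambda>n. \<Sum>k<n. f (Suc k) x - f k x)" by (simp add: summable_iff_convergent)
    then have "convergent (\<lambda>n. f n x - f 0 x)" by (simp only: sum_lessThan_telescope[of "\<lambda>k. f k x"])
    then show ?case using convergent_diff_const_right_iff by blast
  qed
  define g where "g x = lim (\<lambda>k. f k x)" for x
  have gm: "g \<in> borel_measurable lebesgue" unfolding g_def using fm by measurable
  \<comment> \<open>Fatou's lemma turns the estimate between two members of the sequence into one
    for the limit. It also yields the square integrability of \<open>g - f k\<close>, and with it
    that of \<open>g\<close>.\<close>
  have bound: "(\<integral>\<^sup>+x. ennreal ((g x - f k x)\<^sup>2) \<partial>lebesgue) \<le> ennreal ((2 * (1/2) ^ k)\<^sup>2)" for k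
  proof -
    have "(\<integral>\<^sup>+x. ennreal ((g x - f k x)\<^sup>2) \<partial>lebesgue) = (\<integral>\<^sup>+x. liminf (\<lambda>j. ennreal ((f j x - f k x)\<^sup>2)) \<partial>lebesgue)"
    proof (rule nn_integral_cong_AE)
      show "AE x in lebesgue. ennreal ((g x - f k x)\<^sup>2) = liminf (\<lambda>j. ennreal ((f j x - f k x)\<^sup>2))"
        using conv
      proof eventually_elim
        case (elim x)
        have "(\<lambda>j. f j x) \<longlonglongrightarrow> g x" using elim unfolding g_def by (simp add: convergent_LIMSEQ_iff)
        then have "(\<lambda>j. ennreal ((f j x - f k x)\<^sup>2)) \<longlonglongrightarrow> ennreal ((g x - f k x)\<^sup>2)"
          by (intro tendsto_ennrealI tendsto_intros)
        then show ?case by (intro lim_imp_Liminf[symmetric]) auto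
      qed
    qed
    also have "\<dots> \<le> liminf (\<lambda>j. \<integral>\<^sup>+x. ennreal ((f j x - f k x)\<^sup>2) \<partial>lebesgue)"
      by (rule nn_integral_liminf) (use fm in measurable)
    also have "\<dots> \<le> ennreal ((2 * (1/2) ^ k)\<^sup>2)"
    proof (rule Liminf_le)
      show "\<forall>\<^sub>F j in sequentially. (\<integral>\<^sup>+x. ennreal ((f j x - f k x)\<^sup>2) \<partial>lebesgue) \<le> ennreal ((2 * (1/2) ^ k)\<^sup>2)"
        using eventually_ge_at_top[of k]
      proof eventually_elim
        case (elim j)
        have "(\<integral>\<^sup>+x. ennreal ((f j x - f k x)\<^sup>2) \<partial>lebesgue) = ennreal ((norm (X j - X k))\<^sup>2)"
          unfolding Xf cls_diff[OF f f] by (rule nn_norm_cls[OF sq_int_diff[OF f f]])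
        then show ?case using fast[OF elim] by (simp only: ennreal_leI power_mono norm_ge_zero)
      qed
    qed simp
    finally show ?thesis .
  qed
  have gf: "sq_int (\<lambda>x. g x - f k x)" for k
    unfolding sq_int_def
  proof
    show "(\<lambda>x. g x - f k x) \<in> borel_measurable lebesgue" using gm fm by auto
    then show "integrable lebesgue (\<lambda>x. (g x - f k x)\<^sup>2)"
      using bound[of k] by (intro integrableI_nonneg) (auto intro: le_less_trans)
  qed
  have g: "sq_int g" using sq_int_add[OF gf[of 0] f[of 0]] by simp
  have "norm (X k - cls g) \<le> 2 * (1/2) ^ k" for k
  proof -
    have "cls g - X k = cls (\<lambda>x. g x - f k x)" unfolding Xf by (rule cls_diff[OF g f])
    then have "ennreal ((norm (cls g - X k))\<^sup>2) \<le> ennreal ((2 * (1/2) ^ k)\<^sup>2)"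
      using bound[of k] nn_norm_cls[OF gf[of k]] by simp
    then have "(norm (cls g - X k))\<^sup>2 \<le> (2 * (1/2) ^ k)\<^sup>2" by (simp add: ennreal_le_iff)
    then have "norm (cls g - X k) \<le> 2 * (1/2) ^ k" by (rule power2_le_imp_le) simp
    then show ?thesis by (simp add: norm_minus_commute)
  qed
  moreover have "(\<lambda>k. 2 * (1/2 :: real) ^ k) \<longlonglongrightarrow> 0"
    by (intro tendsto_mult_right_zero LIMSEQ_power_zero) auto
  ultimately have "(\<lambda>k. X k - cls g) \<longlonglongrightarrow> 0"
    by (intro Lim_null_comparison[of "\<lambda>k. X k - cls g" "\<lambda>k. 2 * (1/2) ^ k"] always_eventually allI)
  then show ?thesis using LIM_zero_iff convergentI by blast
qed

instance lsq :: (finite) complete_space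
proof
  fix X :: "nat \<Rightarrow> 'a lsq" assume X: "Cauchy X"
  have "\<exists>N. \<forall>m\<ge>N. \<forall>n\<ge>N. norm (X m - X n) < (1/2) ^ k" for k :: nat
    using X unfolding Cauchy_def dist_norm by simp
  then obtain N where N: "\<And>k m n. m \<ge> N k \<Longrightarrow> n \<ge> N k \<Longrightarrow> norm (X m - X n) < (1/2) ^ k" by metis
  define r where "r = rec_nat (N 0) (\<lambda>k rk. max (N (Suc k)) (Suc rk))"
  have r0: "r 0 = N 0" and rS: "r (Suc k) = max (N (Suc k)) (Suc (r k))" for k unfolding r_def by simp_all
  have rN: "N k \<le> r k" for k by (cases k) (auto simp: r0 rS)
  have "strict_mono r" by (rule strict_mono_Suc_iff[THEN iffD2]) (auto simp: rS)
  have "convergent (X \<circ> r)"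
  proof (rule riesz_fischer)
    fix k j :: nat assume "k \<le> j"
    then have "r k \<le> r j" using \<open>strict_mono r\<close> by (simp add: strict_mono_less_eq)
    then have "norm (X (r j) - X (r k)) < (1/2) ^ k" using N[of k "r j" "r k"] rN[of k] by linarith
    also have "\<dots> \<le> 2 * (1/2) ^ k" by simp
    finally show "norm ((X \<circ> r) j - (X \<circ> r) k) \<le> 2 * (1/2) ^ k" by simp
  qed
  then obtain l where l: "(X \<circ> r) \<longlonglongrightarrow> l" unfolding convergent_def by blast
  have "X \<longlonglongrightarrow> l"
    using Cauchy_converges_subseq[OF X \<open>strict_mono r\<close> l] .
  then show "convergent X" unfolding convergent_def by blast
qed

section \<open>Square integrable functions on a domain\<close>

definition res :: "(real^'n::finite) set \<Rightarrow> (real^'n \<Rightarrow> real) \<Rightarrow> real^'n \<Rightarrow> real" where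
  "res \<Omega> f x = (if x \<in> \<Omega> then f x else 0)"

definition cls_on :: "(real^'n::finite) set \<Rightarrow> (real^'n \<Rightarrow> real) \<Rightarrow> 'n lsq" where
  "cls_on \<Omega> f = cls (res \<Omega> f)"

locale domain =
  fixes \<Omega> :: "(real^'n::finite) set"
  assumes op: "open \<Omega>" and bd: "bounded \<Omega>"
begin

lemma \<Omega>_sets: "\<Omega> \<inter> space lebesgue \<in> sets lebesgue" "\<Omega> \<in> sets lebesgue"
  using op by auto

lemma L2_iff: "L2 \<Omega> f \<longleftrightarrow> sq_int (res \<Omega> f)"
proof -
  have 1: "f \<in> borel_measurable (lebesgue_on \<Omega>) \<longleftrightarrow> res \<Omega> f \<in> borel_measurable lebesgue"
  proof -
    have eq: "res \<Omega> f = (\<lambda>x. indicator \<Omega> x *\<^sub>R f x)" by (auto simp: res_def)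
    show ?thesis unfolding eq by (rule borel_measurable_restrict_space_iff[OF \<Omega>_sets(1)])
  qed
  have 2: "integrable (lebesgue_on \<Omega>) (\<lambda>x. (f x)\<^sup>2) \<longleftrightarrow> integrable lebesgue (\<lambda>x. (res \<Omega> f x)\<^sup>2)"
  proof -
    have eq: "(\<lambda>x. (res \<Omega> f x)\<^sup>2) = (\<lambda>x. indicator \<Omega> x *\<^sub>R (f x)\<^sup>2)" by (auto simp: res_def)
    show ?thesis unfolding eq by (rule integrable_restrict_space[OF \<Omega>_sets(1)])
  qed
  show ?thesis unfolding L2_def sq_int_def 1 2 ..
qed

lemma integral_on: "(LINT x|lebesgue_on \<Omega>. f x) = (LINT x|lebesgue. res \<Omega> f x)"
proof -
  have eq: "res \<Omega> f = (\<lambda>x. indicator \<Omega> x *\<^sub>R f x)" by (auto simp: res_def)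
  show ?thesis unfolding eq by (rule integral_restrict_space[OF \<Omega>_sets(1)])
qed

lemma cls_on_inner: "L2 \<Omega> f \<Longrightarrow> L2 \<Omega> g \<Longrightarrow> cls_on \<Omega> f \<bullet> cls_on \<Omega> g = (LINT x|lebesgue_on \<Omega>. f x * g x)"
  unfolding cls_on_def L2_iff integral_on by (subst cls_inner) (auto intro!: Bochner_Integration.integral_cong simp: res_def)

lemma cls_cls_on_inner:
  assumes "sq_int f" "L2 \<Omega> g" shows "cls f \<bullet> cls_on \<Omega> g = (LINT x|lebesgue_on \<Omega>. f x * g x)"
  using assms unfolding cls_on_def L2_iff integral_on
  by (subst cls_inner) (auto intro!: Bochner_Integration.integral_cong simp: res_def)

lemma L2_integrable_mult: "L2 \<Omega> f \<Longrightarrow> L2 \<Omega> g \<Longrightarrow> integrable (lebesgue_on \<Omega>) (\<lambda>x. f x * g x)"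
proof -
  assume "L2 \<Omega> f" "L2 \<Omega> g"
  then have "integrable lebesgue (\<lambda>x. res \<Omega> f x * res \<Omega> g x)" unfolding L2_iff by (rule sq_int_mult_integrable)
  moreover have eq: "(\<lambda>x. res \<Omega> f x * res \<Omega> g x) = (\<lambda>x. indicator \<Omega> x *\<^sub>R (f x * g x))" by (auto simp: res_def)
  ultimately show ?thesis unfolding eq by (subst integrable_restrict_space[OF \<Omega>_sets(1)])
qed

lemma L2_lin: "L2 \<Omega> f \<Longrightarrow> L2 \<Omega> g \<Longrightarrow> L2 \<Omega> (\<lambda>x. a * f x + b * g x)"
proof -
  assume "L2 \<Omega> f" "L2 \<Omega> g"
  then have "sq_int (\<lambda>x. a * res \<Omega> f x + b * res \<Omega> g x)" unfolding L2_iff by (intro sq_int_add sq_int_scale)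
  moreover have "(\<lambda>x. a * res \<Omega> f x + b * res \<Omega> g x) = res \<Omega> (\<lambda>x. a * f x + b * g x)" by (auto simp: res_def)
  ultimately show ?thesis unfolding L2_iff by simp
qed

lemma cls_on_lin: "L2 \<Omega> f \<Longrightarrow> L2 \<Omega> g \<Longrightarrow> cls_on \<Omega> (\<lambda>x. a * f x + b * g x) = a *\<^sub>R cls_on \<Omega> f + b *\<^sub>R cls_on \<Omega> g"
proof -
  assume fg: "L2 \<Omega> f" "L2 \<Omega> g"
  have "res \<Omega> (\<lambda>x. a * f x + b * g x) = (\<lambda>x. a * res \<Omega> f x + b * res \<Omega> g x)" by (auto simp: res_def)
  then show ?thesis using fg unfolding cls_on_def L2_iff by (simp add: cls_scale cls_add sq_int_scale)
qed

lemma sq_int_res: "sq_int f \<Longrightarrow> sq_int (res \<Omega> f)"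
proof -
  assume f: "sq_int f"
  have "sq_int (\<lambda>x. indicator \<Omega> x * f x)"
    by (rule sq_int_bounded_mult[OF f borel_measurable_indicator[OF \<Omega>_sets(2)], of 1]) (simp add: indicator_def)
  moreover have "(\<lambda>x. indicator \<Omega> x * f x) = res \<Omega> f" by (auto simp: res_def)
  ultimately show ?thesis by simp
qed

lemma L2_rep: "L2 \<Omega> (rep F)"
  unfolding L2_iff by (rule sq_int_res[OF rep_sq_int])

lemma inner_cls_on: "L2 \<Omega> g \<Longrightarrow> F \<bullet> cls_on \<Omega> g = (LINT x|lebesgue_on \<Omega>. rep F x * g x)"
  using cls_cls_on_inner[OF rep_sq_int, of g F] by (simp add: cls_rep)

lemma cls_on_rep_inner: "L2 \<Omega> f \<Longrightarrow> cls_on \<Omega> f \<bullet> F = (LINT x|lebesgue_on \<Omega>. f x * rep F x)"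
  using inner_cls_on[of f F] by (simp add: inner_commute mult.commute)

lemma finite_\<Omega>: "emeasure lebesgue \<Omega> < \<infinity>"
  using bd op emeasure_bounded_finite[OF bd] by (simp add: emeasure_completion)

lemma L2_continuous:
  assumes "continuous_on UNIV c" shows "L2 \<Omega> c"
proof -
  have "compact (closure \<Omega>)" using bd by (simp add: compact_closure)
  then have "compact (c ` closure \<Omega>)" using assms by (intro compact_continuous_image) (auto intro: continuous_on_subset)
  then have "bounded (c ` closure \<Omega>)" by (rule compact_imp_bounded)
  then obtain K where "\<forall>y\<in>c ` closure \<Omega>. norm y \<le> K" unfolding bounded_iff by blast
  then have K: "\<bar>c x\<bar> \<le> K" if "x \<in> \<Omega>" for x using that closure_subset[of \<Omega>] by auto
  have m: "res \<Omega> c \<in> borel_measurable lebesgue"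
  proof -
    have "c \<in> borel_measurable lebesgue" using borel_measurable_continuous_onI[OF assms] by (intro measurable_completion) simp
    then have "(\<lambda>x. indicator \<Omega> x *\<^sub>R c x) \<in> borel_measurable lebesgue"
      using \<Omega>_sets(2) by (intro borel_measurable_scaleR borel_measurable_indicator)
    moreover have "(\<lambda>x. indicator \<Omega> x *\<^sub>R c x) = res \<Omega> c" by (auto simp: res_def)
    ultimately show ?thesis by simp
  qed
  have "integrable lebesgue (\<lambda>x. (res \<Omega> c x)\<^sup>2)"
  proof (rule Bochner_Integration.integrable_bound)
    show "integrable lebesgue (\<lambda>x. K\<^sup>2 * indicator \<Omega> x)"
      using \<Omega>_sets(2) finite_\<Omega> by (intro integrable_mult_right integrable_real_indicator) auto
    show "(\<lambda>x. (res \<Omega> c x)\<^sup>2) \<in> borel_measurable lebesgue" using m by auto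
    have "(c x)\<^sup>2 \<le> K\<^sup>2" if "x \<in> \<Omega>" for x using K[OF that] by (metis abs_ge_zero power2_abs power_mono)
    then show "AE x in lebesgue. norm ((res \<Omega> c x)\<^sup>2) \<le> norm (K\<^sup>2 * indicator \<Omega> x)"
      by (intro AE_I2) (simp add: res_def)
  qed
  with m show ?thesis unfolding L2_iff sq_int_def by blast
qed

lemma L2_integrable: "L2 \<Omega> f \<Longrightarrow> integrable (lebesgue_on \<Omega>) f"
  using L2_integrable_mult[of f "\<lambda>x. 1"] L2_continuous[of "\<lambda>x. 1"] by simp

lemma cls_on_eq_iff: "L2 \<Omega> f \<Longrightarrow> L2 \<Omega> g \<Longrightarrow> cls_on \<Omega> f = cls_on \<Omega> g \<longleftrightarrow> (AE x in lebesgue_on \<Omega>. f x = g x)"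
  unfolding cls_on_def L2_iff cls_eq_iff AE_restrict_space_iff[OF \<Omega>_sets(1)]
  by (auto simp: res_def cls_eq_iff elim!: eventually_mono)

lemma test_L2: "test_fun \<Omega> \<phi> \<Longrightarrow> L2 \<Omega> \<phi>" "test_fun \<Omega> \<phi> \<Longrightarrow> L2 \<Omega> (pd j \<phi>)"
  unfolding test_fun_def using C1_continuous by (auto intro!: L2_continuous simp: C1_on_def)

text \<open>\<open>F\<close> is an element of L2 of the whole space and may be nonzero outside
  \<Omega>; hence the conclusion is orthogonality to functions on \<Omega> rather than
  \<open>F = 0\<close>.\<close>

lemma weak_fundamental:
  assumes "\<And>\<phi>. test_fun \<Omega> \<phi> \<Longrightarrow> F \<bullet> cls_on \<Omega> \<phi> = 0" and v: "L2 \<Omega> v"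
  shows "F \<bullet> cls_on \<Omega> v = 0"
proof -
  have "AE x in lebesgue_on \<Omega>. rep F x = 0"
  proof (rule fundamental_lemma[OF op L2_integrable[OF L2_rep]])
    fix \<phi> assume "test_fun \<Omega> \<phi>"
    then show "(LINT x|lebesgue_on \<Omega>. rep F x * \<phi> x) = 0" using assms(1)[of \<phi>] inner_cls_on[OF test_L2(1)] by simp
  qed
  then have "AE x in lebesgue_on \<Omega>. rep F x * v x = 0" by eventually_elim simp
  then show ?thesis unfolding inner_cls_on[OF v] by (rule integral_eq_zero_AE)
qed

lemma L2_indicator_box: "L2 \<Omega> (indicator (box a b))"
proof -
  have "sq_int (\<lambda>x. indicator (box a b) x * res \<Omega> (\<lambda>x. 1) x)"
  proof (rule sq_int_bounded_mult[OF _ borel_measurable_indicator, of _ _ 1])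
    show "sq_int (res \<Omega> (\<lambda>x. 1))" using L2_continuous[of "\<lambda>x. 1"] by (simp add: L2_iff)
  qed (auto simp: indicator_def)
  moreover have "(\<lambda>x. indicator (box a b) x * res \<Omega> (\<lambda>x. 1) x) = res \<Omega> (indicator (box a b))" by (auto simp: res_def)
  ultimately show ?thesis unfolding L2_iff by simp
qed

text \<open>Countable counterpart of \<open>weak_fundamental\<close>. For time dependent functions
  each test element comes with its own null set of times, and countably many of these can be
  united.\<close>

lemma weak_box_fundamental:
  assumes box: "\<And>a b. a \<in> rational_vectors \<Longrightarrow> b \<in> rational_vectors \<Longrightarrow> F \<bullet> cls_on \<Omega> (indicator (box a b)) = 0"
    and v: "L2 \<Omega> v"
  shows "F \<bullet> cls_on \<Omega> v = 0"
proof -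
  have int: "integrable lebesgue (res \<Omega> (rep F))"
  proof -
    have eq: "res \<Omega> (rep F) = (\<lambda>x. indicator \<Omega> x *\<^sub>R rep F x)" by (auto simp: res_def)
    show ?thesis unfolding eq using L2_integrable[OF L2_rep, of F]
      by (subst (asm) integrable_restrict_space[OF \<Omega>_sets(1)])
  qed
  have "AE x in lebesgue. x \<in> \<Omega> \<longrightarrow> res \<Omega> (rep F) x = 0"
  proof (rule AE_zero_if_box_integrals_zero[OF int op])
    fix a b :: "real^'n" assume "a \<in> rational_vectors" "b \<in> rational_vectors"
    then have "0 = F \<bullet> cls_on \<Omega> (indicator (box a b))" using box by simp
    also have "\<dots> = (LINT x|lebesgue. res \<Omega> (\<lambda>x. rep F x * indicator (box a b) x) x)"
      unfolding inner_cls_on[OF L2_indicator_box] integral_on ..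
    also have "\<dots> = (LINT x:box a b|lebesgue. res \<Omega> (rep F) x)"
      unfolding set_lebesgue_integral_def by (rule Bochner_Integration.integral_cong) (auto simp: res_def)
    finally show "(LINT x:box a b|lebesgue. res \<Omega> (rep F) x) = 0" by simp
  qed
  then have "AE x in lebesgue_on \<Omega>. rep F x * v x = 0" unfolding AE_restrict_space_iff[OF \<Omega>_sets(1)]
    by eventually_elim (simp add: res_def)
  then show ?thesis unfolding inner_cls_on[OF v] by (rule integral_eq_zero_AE)
qed

section \<open>The graph of the weak gradient\<close>

text \<open>The first condition says that the function and its gradient, as elements of L2 of the whole space,
  vanish outside \<open>\<Omega>\<close>; all conditions are orthogonality relations, so that \<open>V\<close> is closed.\<close>

definition V :: "('n lsq \<times> (('n lsq)^'n)) set" where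
  "V = {p. (\<forall>h. sq_int h \<and> (\<forall>x\<in>\<Omega>. h x = 0) \<longrightarrow> fst p \<bullet> cls h = 0 \<and> (\<forall>j. snd p $ j \<bullet> cls h = 0)) \<and>
      (\<forall>\<phi> j. test_fun \<Omega> \<phi> \<longrightarrow> fst p \<bullet> cls_on \<Omega> (pd j \<phi>) + snd p $ j \<bullet> cls_on \<Omega> \<phi> = 0)}"

lemma V_subspace: "subspace V"
  unfolding subspace_def V_def
proof (intro conjI ballI allI; clarsimp)
qed (simp_all add: inner_add_left algebra_simps, simp_all flip: distrib_left add: add.assoc add.left_commute)

lemma V_closed: "closed V"
  unfolding V_def
  by (intro closed_Collect_conj closed_Collect_all closed_Collect_imp open_Collect_const closed_Collect_eq
      continuous_intros)

text \<open>The difference of \<open>F\<close> and its restriction to \<Omega> is the class of a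
  function vanishing on \<Omega>. It is orthogonal to both, hence to itself.\<close>

lemma supported_unique:
  assumes "\<And>h. sq_int h \<Longrightarrow> (\<forall>x\<in>\<Omega>. h x = 0) \<Longrightarrow> F \<bullet> cls h = 0" shows "F = cls_on \<Omega> (rep F)"
proof -
  define h where "h x = rep F x - res \<Omega> (rep F) x" for x
  have h: "sq_int h" unfolding h_def by (rule sq_int_diff[OF rep_sq_int sq_int_res[OF rep_sq_int]])
  have h0: "\<forall>x\<in>\<Omega>. h x = 0" unfolding h_def by (simp add: res_def)
  have "F - cls_on \<Omega> (rep F) = cls h"
    unfolding cls_on_def h_def using cls_diff[OF rep_sq_int sq_int_res[OF rep_sq_int]] by (metis cls_rep)
  moreover have "cls_on \<Omega> (rep F) \<bullet> cls h = 0"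
  proof -
    have "cls_on \<Omega> (rep F) \<bullet> cls h = (LINT x|lebesgue. res \<Omega> (rep F) x * h x)"
      unfolding cls_on_def by (rule cls_inner[OF sq_int_res[OF rep_sq_int] h])
    also have "\<dots> = (LINT x|(lebesgue :: (real^'n) measure). 0)"
      by (rule Bochner_Integration.integral_cong) (use h0 in \<open>auto simp: res_def\<close>)
    finally show ?thesis by simp
  qed
  ultimately have "(F - cls_on \<Omega> (rep F)) \<bullet> (F - cls_on \<Omega> (rep F)) = 0"
    using assms[OF h h0] by (metis inner_diff_left diff_zero)
  then show ?thesis by simp
qed

lemma cls_on_supported:
  assumes "L2 \<Omega> f" "sq_int h" "\<forall>x\<in>\<Omega>. h x = 0" shows "cls_on \<Omega> f \<bullet> cls h = 0"
proof -
  have "cls_on \<Omega> f \<bullet> cls h = (LINT x|lebesgue. res \<Omega> f x * h x)"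
    using assms unfolding cls_on_def L2_iff by (intro cls_inner)
  also have "\<dots> = (LINT x|(lebesgue :: (real^'n) measure). 0)"
    by (rule Bochner_Integration.integral_cong) (use assms in \<open>auto simp: res_def\<close>)
  finally show ?thesis by simp
qed

text \<open>Over the zero function the derivative relation makes each component orthogonal to all
  test functions, so it vanishes in \<Omega>; the support condition in \<open>V\<close> excludes
  anything outside.\<close>

lemma V_inj: "(0, g) \<in> V \<Longrightarrow> g = 0"
proof -
  assume g: "(0, g) \<in> V"
  have "g $ j = 0" for j
  proof -
    have s: "g $ j = cls_on \<Omega> (rep (g $ j))" using g unfolding V_def by (intro supported_unique) auto
    have z: "g $ j \<bullet> cls_on \<Omega> \<phi> = 0" if "test_fun \<Omega> \<phi>" for \<phi>
      using g that unfolding V_def by simp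
    have "g $ j \<bullet> cls_on \<Omega> (rep (g $ j)) = 0" by (rule weak_fundamental[OF z L2_rep])
    then show ?thesis using s by simp
  qed
  then show ?thesis by (simp add: vec_eq_iff)
qed

lemma V_unique: "p \<in> V \<Longrightarrow> q \<in> V \<Longrightarrow> fst p = fst q \<Longrightarrow> p = q"
proof -
  assume pq: "p \<in> V" "q \<in> V" "fst p = fst q"
  have "p - q \<in> V" by (rule subspace_diff[OF V_subspace pq(1,2)])
  moreover have "p - q = (0, snd p - snd q)" using pq(3) by (simp add: prod_eq_iff)
  ultimately have "snd p - snd q = 0" using V_inj by metis
  with pq(3) show ?thesis by (simp add: prod_eq_iff)
qed

text \<open>The isometry of H1 onto \<open>V\<close> (\<open>norm_emb\<close>, \<open>V_H1\<close>).
  The derivatives in \<open>wpd\<close> are arbitrary choices, but uniqueness of the gradient makes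
  their classes, and so \<open>emb\<close>, independent of these choices.\<close>

definition emb :: "(real^'n \<Rightarrow> real) \<Rightarrow> 'n lsq \<times> (('n lsq)^'n)" where
  "emb f = (cls_on \<Omega> f, \<chi> j. cls_on \<Omega> (wpd \<Omega> j f))"

lemma H1_wpd: "H1 \<Omega> f \<Longrightarrow> L2 \<Omega> (wpd \<Omega> j f)" "H1 \<Omega> f \<Longrightarrow> weak_deriv \<Omega> j f (wpd \<Omega> j f)"
proof -
  assume "H1 \<Omega> f"
  then have "\<exists>g. L2 \<Omega> g \<and> weak_deriv \<Omega> j f g" unfolding H1_def by blast
  from someI_ex[OF this] show "L2 \<Omega> (wpd \<Omega> j f)" "weak_deriv \<Omega> j f (wpd \<Omega> j f)" unfolding wpd_def by auto
qed

lemma H1_L2: "H1 \<Omega> f \<Longrightarrow> L2 \<Omega> f"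
  unfolding H1_def by blast

lemma weak_deriv_iff:
  assumes "L2 \<Omega> f" "L2 \<Omega> g"
  shows "weak_deriv \<Omega> j f g \<longleftrightarrow> (\<forall>\<phi>. test_fun \<Omega> \<phi> \<longrightarrow> cls_on \<Omega> f \<bullet> cls_on \<Omega> (pd j \<phi>) + cls_on \<Omega> g \<bullet> cls_on \<Omega> \<phi> = 0)"
  unfolding weak_deriv_def using assms test_L2 by (auto simp: cls_on_inner eq_neg_iff_add_eq_0)

lemma emb_in_V: "H1 \<Omega> f \<Longrightarrow> emb f \<in> V"
proof -
  assume f: "H1 \<Omega> f"
  show ?thesis unfolding V_def emb_def
    using cls_on_supported[OF H1_L2[OF f]] cls_on_supported[OF H1_wpd(1)[OF f]]
      H1_wpd(2)[OF f] weak_deriv_iff[OF H1_L2[OF f] H1_wpd(1)[OF f]] by auto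
qed

text \<open>The second component of \<open>p\<close> has representatives that are weak derivatives
  of \<open>f\<close>, and by \<open>V_unique\<close> the derivatives selected in \<open>wpd\<close>
  have the same classes. This is the way back from the abstract solution to functions.\<close>

lemma H1I:
  assumes f: "L2 \<Omega> f" and p: "p \<in> V" "fst p = cls_on \<Omega> f"
  shows "H1 \<Omega> f" "emb f = p"
proof -
  have sn: "snd p $ j = cls_on \<Omega> (rep (snd p $ j))" for j
    using p(1) unfolding V_def by (intro supported_unique) auto
  have "weak_deriv \<Omega> j f (rep (snd p $ j))" for j
    unfolding weak_deriv_iff[OF f L2_rep] sn[symmetric] using p unfolding V_def by auto
  then show H: "H1 \<Omega> f" unfolding H1_def using f L2_rep by blast
  show "emb f = p" by (rule V_unique[OF emb_in_V[OF H] p(1)]) (simp add: emb_def p(2))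
qed

lemma V_H1:
  assumes "p \<in> V" shows "H1 \<Omega> (rep (fst p))" "emb (rep (fst p)) = p"
proof -
  have "fst p = cls_on \<Omega> (rep (fst p))" using assms unfolding V_def by (intro supported_unique) auto
  from H1I[OF L2_rep assms this] show "H1 \<Omega> (rep (fst p))" "emb (rep (fst p)) = p" .
qed

lemma emb_lin:
  assumes "H1 \<Omega> f" "H1 \<Omega> g"
  shows "emb (\<lambda>x. a * f x + b * g x) = a *\<^sub>R emb f + b *\<^sub>R emb g"
proof (rule H1I(2)[OF L2_lin[OF H1_L2 H1_L2]])
  show "a *\<^sub>R emb f + b *\<^sub>R emb g \<in> V"
    using assms by (intro subspace_add subspace_scale V_subspace emb_in_V)
  show "fst (a *\<^sub>R emb f + b *\<^sub>R emb g) = cls_on \<Omega> (\<lambda>x. a * f x + b * g x)"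
    using assms by (simp add: emb_def cls_on_lin H1_L2)
qed (use assms in auto)

lemma norm_emb: "H1 \<Omega> f \<Longrightarrow> norm (emb f) = H1_norm \<Omega> f"
proof -
  assume f: "H1 \<Omega> f"
  have "emb f \<bullet> emb f = (LINT x|lebesgue_on \<Omega>. (f x)\<^sup>2) + (\<Sum>j\<in>UNIV. LINT x|lebesgue_on \<Omega>. (wpd \<Omega> j f x)\<^sup>2)"
    unfolding emb_def by (simp add: inner_prod_def inner_vec_def cls_on_inner H1_L2[OF f] H1_wpd(1)[OF f] power2_eq_square)
  also have "(\<Sum>j\<in>UNIV. LINT x|lebesgue_on \<Omega>. (wpd \<Omega> j f x)\<^sup>2) = (LINT x|lebesgue_on \<Omega>. (\<Sum>j\<in>UNIV. (wpd \<Omega> j f x)\<^sup>2))"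
    by (rule Bochner_Integration.integral_sum[symmetric]) (use H1_wpd(1)[OF f] in \<open>auto simp: L2_def\<close>)
  finally show ?thesis unfolding H1_norm_def by (simp add: norm_eq_sqrt_inner)
qed

end

section \<open>The Gaussian kernel\<close>

lemma gauss_has_derivative:
  fixes z :: "real^'n::finite"
  assumes "\<sigma> > 0"
  shows "(gauss \<sigma> has_derivative (\<lambda>h. - ((z \<bullet> h) / \<sigma>) * gauss \<sigma> z)) (at z)"
  unfolding gauss_def[abs_def] power2_norm_eq_inner
  by (rule derivative_eq_intros refl ext | use assms in \<open>simp add: inner_commute field_simps\<close>)+

lemma pd_gauss: "\<sigma> > 0 \<Longrightarrow> pd j (gauss \<sigma>) z = - (z $ j / \<sigma>) * gauss \<sigma> z"
  using pd_eqI[OF gauss_has_derivative] by (simp add: inner_axis)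

lemma pd_gauss_continuous: "\<sigma> > 0 \<Longrightarrow> continuous_on UNIV (pd j (gauss \<sigma> :: real^'n::finite \<Rightarrow> real))"
proof -
  assume s: "\<sigma> > 0"
  have "pd j (gauss \<sigma>) = (\<lambda>z :: real^'n. - (z $ j / \<sigma>) * gauss \<sigma> z)" using pd_gauss[OF s] by blast
  then show ?thesis unfolding gauss_def[abs_def] by (simp add: s) (intro continuous_intros; use s in simp)
qed

lemma pd_gauss_bounded:
  assumes s: "\<sigma> > 0"
  shows "\<exists>K. \<forall>j (z :: real^'n::finite). \<bar>pd j (gauss \<sigma>) z\<bar> \<le> K"
proof -
  define c where "c = (2 * pi * \<sigma>) powr (- real CARD('n) / 2)"
  have c: "0 \<le> c" unfolding c_def by simp
  have "\<bar>pd j (gauss \<sigma>) z\<bar> \<le> (2 * \<sigma> + 1) / \<sigma> * c" for j and z :: "real^'n"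
  proof -
    define r where "r = norm z"
    have r: "0 \<le> r" "\<bar>z $ j\<bar> \<le> r" unfolding r_def by (auto simp: component_le_norm_cart)
    \<comment> \<open>Up to \<open>2 * \<sigma>\<close> the exponential is bounded by 1. Beyond it,
      \<open>r\<close> is at most \<open>r\<^sup>2 / (2 * \<sigma>)\<close> and thus at most the
      reciprocal of the Gaussian factor.\<close>
    have "r * exp (- r\<^sup>2 / (2 * \<sigma>)) \<le> 2 * \<sigma> + 1"
    proof (cases "r \<le> 2 * \<sigma>")
      case True
      have "r * exp (- r\<^sup>2 / (2 * \<sigma>)) \<le> r * 1" using r s by (intro mult_left_mono) auto
      with True show ?thesis by simp
    next
      case False
      have "r \<le> r\<^sup>2 / (2 * \<sigma>)"
      proof -
        have "r * (2 * \<sigma>) \<le> r * r" using False r by (intro mult_left_mono) auto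
        then show ?thesis using s by (simp add: field_simps power2_eq_square)
      qed
      also have "\<dots> \<le> exp (r\<^sup>2 / (2 * \<sigma>))" using exp_ge_add_one_self[of "r\<^sup>2 / (2 * \<sigma>)"] by linarith
      finally have "r * exp (- (r\<^sup>2 / (2 * \<sigma>))) \<le> exp (r\<^sup>2 / (2 * \<sigma>)) * exp (- (r\<^sup>2 / (2 * \<sigma>)))" by (intro mult_right_mono) auto
      also have "\<dots> = 1" by (simp add: exp_minus)
      finally show ?thesis using s by simp
    qed
    then have 1: "r * exp (- r\<^sup>2 / (2 * \<sigma>)) * (c / \<sigma>) \<le> (2 * \<sigma> + 1) * (c / \<sigma>)" using c s by (intro mult_right_mono) auto
    have "\<bar>pd j (gauss \<sigma>) z\<bar> = \<bar>z $ j\<bar> * exp (- r\<^sup>2 / (2 * \<sigma>)) * (c / \<sigma>)"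
      unfolding pd_gauss[OF s] gauss_def c_def[symmetric] r_def using c s by (simp add: abs_mult)
    also have "\<dots> \<le> r * exp (- r\<^sup>2 / (2 * \<sigma>)) * (c / \<sigma>)" using r c s by (intro mult_right_mono) auto
    finally show ?thesis using 1 by simp
  qed
  then show ?thesis by blast
qed

section \<open>Multiplication operators\<close>

definition mulop :: "(real^'n::finite \<Rightarrow> real) \<Rightarrow> (('n lsq)^'n) \<Rightarrow> (('n lsq)^'n)" where
  "mulop c G = (\<chi> j. cls (\<lambda>x. c x * rep (G $ j) x))"

definition bdd_meas :: "(real^'n::finite \<Rightarrow> real) \<Rightarrow> real \<Rightarrow> bool" where
  "bdd_meas c K \<longleftrightarrow> c \<in> borel_measurable lebesgue \<and> (\<forall>x. \<bar>c x\<bar> \<le> K)"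

lemma mulop_sq_int: "bdd_meas c K \<Longrightarrow> sq_int (\<lambda>x. c x * rep F x)"
  unfolding bdd_meas_def by (rule sq_int_bounded_mult[OF rep_sq_int, of _ K]) auto

lemma mulop_inner:
  assumes c: "bdd_meas c K"
  shows "mulop c G \<bullet> H = (\<Sum>j\<in>UNIV. LINT x|lebesgue. c x * (rep (G $ j) x * rep (H $ j) x))"
proof -
  have "cls (\<lambda>x. c x * rep (G $ j) x) \<bullet> H $ j = (LINT x|lebesgue. c x * (rep (G $ j) x * rep (H $ j) x))" for j
    using cls_inner[OF mulop_sq_int[OF c, of "G $ j"] rep_sq_int, of "H $ j"] by (simp add: cls_rep mult.assoc)
  then show ?thesis unfolding mulop_def inner_vec_def by simp
qed

lemma mulop_sym:
  assumes c: "bdd_meas c K" shows "mulop c G \<bullet> H = G \<bullet> mulop c H"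
proof -
  have "mulop c G \<bullet> H = mulop c H \<bullet> G"
    unfolding mulop_inner[OF c] by (intro sum.cong Bochner_Integration.integral_cong refl) (rule arg_cong2[OF refl mult.commute])
  then show ?thesis by (simp only: inner_commute[of G])
qed

lemma mulop_integrable:
  assumes c: "bdd_meas c K" shows "integrable lebesgue (\<lambda>x. c x * (rep F x * rep H x))"
  using sq_int_mult_integrable[OF mulop_sq_int[OF c, of F] rep_sq_int[of H]] by (simp add: mult.assoc)

lemma norm_vec_square: "(norm x)\<^sup>2 = (\<Sum>j\<in>UNIV. (norm (x $ j))\<^sup>2)" for x :: "'a::real_inner ^ 'n::finite"
  unfolding power2_norm_eq_inner inner_vec_def ..

lemma mulop_norm:
  assumes c: "bdd_meas c K" and K: "0 \<le> K"
  shows "norm (mulop c G) \<le> K * norm G"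
proof -
  have "(norm (cls (\<lambda>x. c x * rep F x)))\<^sup>2 \<le> K\<^sup>2 * (norm F)\<^sup>2" for F
  proof -
    have "(norm (cls (\<lambda>x. c x * rep F x)))\<^sup>2 = (LINT x|lebesgue. (c x * rep F x)\<^sup>2)" by (rule norm_cls[OF mulop_sq_int[OF c]])
    also have "\<dots> \<le> (LINT x|lebesgue. K\<^sup>2 * (rep F x)\<^sup>2)"
    proof (rule integral_mono)
      show "integrable lebesgue (\<lambda>x. (c x * rep F x)\<^sup>2)" using mulop_sq_int[OF c, of F] unfolding sq_int_def by blast
      show "integrable lebesgue (\<lambda>x. K\<^sup>2 * (rep F x)\<^sup>2)" using rep_sq_int[of F] unfolding sq_int_def by auto
      have "(c x)\<^sup>2 \<le> K\<^sup>2" for x using c unfolding bdd_meas_def by (metis abs_ge_zero power2_abs power_mono)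
      then show "(c x * rep F x)\<^sup>2 \<le> K\<^sup>2 * (rep F x)\<^sup>2" for x by (simp add: power_mult_distrib mult_right_mono)
    qed
    also have "\<dots> = K\<^sup>2 * (norm F)\<^sup>2" using norm_cls[OF rep_sq_int, of F] by (simp add: cls_rep)
    finally show ?thesis .
  qed
  then have "(\<Sum>j\<in>UNIV. (norm (mulop c G $ j))\<^sup>2) \<le> (\<Sum>j\<in>UNIV. K\<^sup>2 * (norm (G $ j))\<^sup>2)"
    unfolding mulop_def by (intro sum_mono) simp
  then have "(norm (mulop c G))\<^sup>2 \<le> (K * norm G)\<^sup>2"
    unfolding norm_vec_square power_mult_distrib sum_distrib_left .
  then show ?thesis by (rule power2_le_imp_le) (rule mult_nonneg_nonneg[OF K norm_ge_zero])
qed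

lemma mulop_coercive:
  assumes c: "bdd_meas c K" and m: "\<And>x. m \<le> c x"
  shows "m * (norm G)\<^sup>2 \<le> mulop c G \<bullet> G"
proof -
  have "m * (norm F)\<^sup>2 \<le> (LINT x|lebesgue. c x * (rep F x * rep F x))" for F
  proof -
    have "m * (norm F)\<^sup>2 = (LINT x|lebesgue. m * (rep F x * rep F x))"
      using norm_cls[OF rep_sq_int, of F] by (simp add: cls_rep power2_eq_square)
    also have "\<dots> \<le> (LINT x|lebesgue. c x * (rep F x * rep F x))"
      by (intro integral_mono mulop_integrable[OF c] mult_right_mono m integrable_mult_right sq_int_mult_integrable rep_sq_int) auto
    finally show ?thesis .
  qed
  then have "(\<Sum>j\<in>UNIV. m * (norm (G $ j))\<^sup>2) \<le> mulop c G \<bullet> G"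
    unfolding mulop_inner[OF c] by (intro sum_mono)
  then show ?thesis unfolding norm_vec_square sum_distrib_left .
qed

text \<open>The representatives in \<open>mulop\<close> are chosen, so they need not add up
  pointwise. Symmetry yields linearity instead, by moving the operator to the other argument of the
  scalar product.\<close>

lemma mulop_linear: "bdd_meas c K \<Longrightarrow> linear (mulop c)"
proof (rule linearI)
  assume c: "bdd_meas c K"
  show "mulop c (x + y) = mulop c x + mulop c y" for x y
  proof -
    have "mulop c (x + y) \<bullet> H = (mulop c x + mulop c y) \<bullet> H" for H
      using mulop_sym[OF c] by (simp add: inner_add_left)
    then show ?thesis by (metis vector_eq_rdot inner_commute)
  qed
  show "mulop c (r *\<^sub>R x) = r *\<^sub>R mulop c x" for r x
  proof -
    have "mulop c (r *\<^sub>R x) \<bullet> H = (r *\<^sub>R mulop c x) \<bullet> H" for H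
      using mulop_sym[OF c] by simp
    then show ?thesis by (metis vector_eq_rdot inner_commute)
  qed
qed

lemma mulop_diff:
  assumes c: "bdd_meas c K" "bdd_meas c' K'"
  shows "mulop c G - mulop c' G = mulop (\<lambda>x. c x - c' x) G"
proof -
  have "cls (\<lambda>x. c x * rep (G $ j) x) - cls (\<lambda>x. c' x * rep (G $ j) x) = cls (\<lambda>x. (c x - c' x) * rep (G $ j) x)" for j
    using cls_diff[OF mulop_sq_int[OF c(1)] mulop_sq_int[OF c(2)]] by (simp add: left_diff_distrib)
  then show ?thesis unfolding mulop_def by (simp add: vec_eq_iff)
qed

section \<open>Distributional time derivatives\<close>

lemma time_finite_measure: "finite_measure (lebesgue_on {0<..<T::real})"
  by (rule finite_measure_lebesgue_on) (simp flip: box_real)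

lemma bounded_integrable_time:
  fixes a :: "real \<Rightarrow> real"
  assumes m: "a \<in> borel_measurable (lebesgue_on {0<..<T})" and b: "\<And>t. t \<in> {0<..<T} \<Longrightarrow> \<bar>a t\<bar> \<le> C"
  shows "integrable (lebesgue_on {0<..<T}) a" "a integrable_on {0..T}"
    "(LINT t|lebesgue_on {0<..<T}. a t) = integral {0..T} a"
proof -
  interpret finite_measure "lebesgue_on {0<..<T}" by (rule time_finite_measure)
  show i: "integrable (lebesgue_on {0<..<T}) a"
    by (rule integrable_const_bound[where B = C]) (use m b in auto)
  show "a integrable_on {0..T}"
    using integrable_on_lebesgue_on[OF i] by (simp add: integrable_on_Icc_iff_Ioo)
  show "(LINT t|lebesgue_on {0<..<T}. a t) = integral {0..T} a"
    using lebesgue_integral_eq_integral[OF i] by (simp add: integral_open_interval_real)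
qed

lemma integrable_on_measurable_time:
  fixes a :: "real \<Rightarrow> real"
  assumes "a integrable_on {0..T}" shows "a \<in> borel_measurable (lebesgue_on {0<..<T})"
  using measurable_restrict_mono[OF integrable_imp_measurable[OF assms]] by (simp add: greaterThanLessThan_subseteq_atLeastAtMost_iff)

lemma wintble_real:
  fixes a :: "real \<Rightarrow> real"
  assumes "a integrable_on {0..T}" "\<And>t. t \<in> {0..T} \<Longrightarrow> \<bar>a t\<bar> \<le> C"
  shows "wintble C 0 T a"
  unfolding wintble_def using assms integrable_on_mult_left[of a] by auto

lemma continuous_on_Icc_bounded:
  fixes g :: "real \<Rightarrow> real"
  assumes "continuous_on {a..b} g" shows "\<exists>K. \<forall>t\<in>{a..b}. \<bar>g t\<bar> \<le> K"
  using compact_imp_bounded[OF compact_continuous_image[OF assms compact_Icc]] unfolding bounded_iff by auto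

text \<open>Integration by parts with a merely bounded integrable \<open>b\<close>, so that the
  product rule does not hold pointwise. The defect of the formula is shown to have increments
  quadratic in the interval length and is therefore zero.\<close>

lemma weak_dt_init_primitive:
  assumes b: "b integrable_on {0..T}" "\<And>t. t \<in> {0..T} \<Longrightarrow> \<bar>b t\<bar> \<le> C" and T: "0 < T"
    and a: "\<And>t. t \<in> {0<..<T} \<Longrightarrow> a t = a0 + integral {0..t} b"
  shows "weak_dt_init T a b a0"
  unfolding weak_dt_init_def
proof (intro allI impI)
  fix \<psi> \<psi>' assume "time_test T \<psi> \<psi>'"
  then have d\<psi>: "\<And>t. (\<psi> has_real_derivative \<psi>' t) (at t)" and c\<psi>': "continuous_on UNIV \<psi>'"
    and end0: "\<exists>\<delta>>0. \<forall>t\<ge>T - \<delta>. \<psi> t = 0" unfolding time_test_def by auto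
  have c\<psi>: "continuous_on UNIV \<psi>" by (intro continuous_at_imp_continuous_on ballI DERIV_isCont[OF d\<psi>])
  have bnd: "\<exists>K\<ge>0. \<forall>t\<in>{0..T}. \<bar>g t\<bar> \<le> K" if gc: "continuous_on UNIV g" for g :: "real \<Rightarrow> real"
  proof -
    obtain K where K: "\<forall>t\<in>{0..T}. \<bar>g t\<bar> \<le> K" using continuous_on_Icc_bounded[OF continuous_on_subset[OF gc subset_UNIV]] by blast
    then have "\<bar>g 0\<bar> \<le> K" using T by auto
    then have "0 \<le> K" by linarith
    with K show ?thesis by auto
  qed
  obtain P where P: "0 \<le> P" "\<And>t. t \<in> {0..T} \<Longrightarrow> \<bar>\<psi>' t\<bar> \<le> P" using bnd[OF c\<psi>'] by blast
  define A where "A t = a0 + integral {0..t} b" for t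
  have C0: "0 \<le> C" using b(2)[of 0] T by auto
  have bs: "b integrable_on {x..y}" if "0 \<le> x" "y \<le> T" for x y
    using integrable_on_subinterval[OF b(1)] that by auto
  have A_inc: "A y - A x = integral {x..y} b" if "0 \<le> x" "x \<le> y" "y \<le> T" for x y
    using Henstock_Kurzweil_Integration.integral_combine[of 0 x y b] bs[of 0 y] that unfolding A_def by simp
  have A_lip: "\<bar>A y - A x\<bar> \<le> C * (y - x)" if "0 \<le> x" "x \<le> y" "y \<le> T" for x y
  proof -
    have "norm (integral {x..y} b) \<le> integral {x..y} (\<lambda>_. C)"
      by (rule integral_norm_bound_integral[OF bs]) (use that b(2) in auto)
    then show ?thesis unfolding A_inc[OF that] using that by (simp add: mult.commute)
  qed
  have Ac: "continuous_on {0..T} A" 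
    unfolding A_def by (intro continuous_intros indefinite_integral_continuous_1 b(1))
  have \<psi>_int: "(\<psi>' has_integral \<psi> y - \<psi> x) {x..y}" if "x \<le> y" for x y
    by (rule fundamental_theorem_of_calculus[OF that])
      (use d\<psi> in \<open>auto simp: has_real_derivative_iff_has_vector_derivative intro: has_vector_derivative_at_within\<close>)
  have \<psi>_lip: "\<bar>\<psi> y - \<psi> x\<bar> \<le> P * (y - x)" if "0 \<le> x" "x \<le> y" "y \<le> T" for x y
  proof -
    have "norm (integral {x..y} \<psi>') \<le> integral {x..y} (\<lambda>_. P)"
      by (rule integral_norm_bound_integral) (use \<psi>_int[OF that(2)] that P(2) in \<open>auto intro: has_integral_integrable\<close>)
    then show ?thesis using integral_unique[OF \<psi>_int[OF that(2)]] that by (simp add: mult.commute)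
  qed
  have i1: "(\<lambda>t. A t * \<psi>' t) integrable_on {0..T}"
    by (intro integrable_continuous_interval continuous_intros Ac continuous_on_subset[OF c\<psi>']) auto
  have i2: "(\<lambda>t. b t * \<psi> t) integrable_on {0..T}"
    using integrable_inner_continuous[OF wintble_real[OF b] continuous_on_subset[OF c\<psi>]] by simp
  define \<rho> where "\<rho> t = A t * \<psi>' t + b t * \<psi> t" for t
  have \<rho>i: "\<rho> integrable_on {0..T}" unfolding \<rho>_def by (rule integrable_add[OF i1 i2])
  \<comment> \<open>The defect of the product rule on the interval from 0 to \<open>t\<close>.
    Freezing \<open>A\<close> at the left and \<psi> at the right end of a subinterval makes the
    rule exact, with a quadratic error; the Gronwall lemma with zero rate and source then applies to
    \<open>F\<close> and \<open>- F\<close>.\<close>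
  define F where "F t = A t * \<psi> t - a0 * \<psi> 0 - integral {0..t} \<rho>" for t
  have F0: "F 0 = 0" unfolding F_def A_def by simp
  have F_inc: "\<bar>F y - F x\<bar> \<le> (2 * C * P) * (y - x)\<^sup>2" if xy: "0 \<le> x" "x \<le> y" "y \<le> T" for x y
  proof -
    have sub: "(\<lambda>t. A t * \<psi>' t) integrable_on {x..y}" "(\<lambda>t. b t * \<psi> t) integrable_on {x..y}" "\<rho> integrable_on {x..y}"
      using integrable_on_subinterval[OF i1] integrable_on_subinterval[OF i2] integrable_on_subinterval[OF \<rho>i] xy by auto
    have "A y * \<psi> y - A x * \<psi> x = A x * (\<psi> y - \<psi> x) + \<psi> y * (A y - A x)" by (simp add: algebra_simps)
    also have "\<dots> = integral {x..y} (\<lambda>t. A x * \<psi>' t + \<psi> y * b t)"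
    proof (rule integral_unique[symmetric], intro has_integral_add)
      show "((\<lambda>t. A x * \<psi>' t) has_integral A x * (\<psi> y - \<psi> x)) {x..y}"
        by (rule has_integral_mult_right[OF \<psi>_int[OF xy(2)]])
      show "((\<lambda>t. \<psi> y * b t) has_integral \<psi> y * (A y - A x)) {x..y}"
        unfolding A_inc[OF xy] by (rule has_integral_mult_right[OF integrable_integral[OF bs]]) (use xy in auto)
    qed
    finally have 1: "A y * \<psi> y - A x * \<psi> x = integral {x..y} (\<lambda>t. A x * \<psi>' t + \<psi> y * b t)" .
    have 2: "integral {0..y} \<rho> - integral {0..x} \<rho> = integral {x..y} \<rho>"
      using Henstock_Kurzweil_Integration.integral_combine[of 0 x y \<rho>] integrable_on_subinterval[OF \<rho>i, of 0 y] xy by simp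
    have i3: "(\<lambda>t. A x * \<psi>' t + \<psi> y * b t) integrable_on {x..y}"
      by (intro integrable_add integrable_on_mult_right bs) (use xy \<psi>_int in \<open>auto intro: has_integral_integrable\<close>)
    have "F y - F x = integral {x..y} (\<lambda>t. (A x * \<psi>' t + \<psi> y * b t) - \<rho> t)"
      unfolding integral_diff[OF i3 sub(3)] 1[symmetric] 2[symmetric] F_def by simp
    moreover have "norm (integral {x..y} (\<lambda>t. (A x * \<psi>' t + \<psi> y * b t) - \<rho> t)) \<le> integral {x..y} (\<lambda>t. 2 * C * P * (y - x))"
    proof (rule integral_norm_bound_integral[OF integrable_diff[OF i3 sub(3)]])
      fix t assume t: "t \<in> {x..y}"
      have "(A x * \<psi>' t + \<psi> y * b t) - \<rho> t = - ((A t - A x) * \<psi>' t) + (\<psi> y - \<psi> t) * b t"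
        unfolding \<rho>_def by (simp add: algebra_simps)
      moreover have "\<bar>(A t - A x) * \<psi>' t\<bar> \<le> (C * (y - x)) * P"
      proof -
        have "\<bar>A t - A x\<bar> \<le> C * (t - x)" using A_lip[of x t] t xy by auto
        also have "\<dots> \<le> C * (y - x)" using t C0 by (intro mult_left_mono) auto
        finally show ?thesis unfolding abs_mult using P t xy C0 by (intro mult_mono) auto
      qed
      moreover have "\<bar>(\<psi> y - \<psi> t) * b t\<bar> \<le> (P * (y - x)) * C"
      proof -
        have "\<bar>\<psi> y - \<psi> t\<bar> \<le> P * (y - t)" using \<psi>_lip[of t y] t xy by auto
        also have "\<dots> \<le> P * (y - x)" using t P by (intro mult_left_mono) auto
        finally show ?thesis unfolding abs_mult using b(2)[of t] P t xy by (intro mult_mono) auto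
      qed
      ultimately show "norm ((A x * \<psi>' t + \<psi> y * b t) - \<rho> t) \<le> 2 * C * P * (y - x)" by (simp add: algebra_simps)
    qed auto
    ultimately show ?thesis using xy by (simp add: power2_eq_square mult_ac)
  qed
  have "F T \<le> 0 * T * exp (0 * T)"
    by (rule increment_gronwall[where T = T and C = "2 * C * P" and D = 0]) (use F_inc F0 T C0 P in \<open>auto simp: abs_le_iff\<close>)
  moreover have "- F T \<le> 0 * T * exp (0 * T)"
    by (rule increment_gronwall[where T = T and C = "2 * C * P" and D = 0 and F = "\<lambda>t. - F t"]) (use F_inc F0 T C0 P in \<open>auto simp: abs_le_iff\<close>)
  ultimately have "F T = 0" by simp
  moreover have "\<psi> T = 0" using end0 by auto
  moreover have "integral {0..T} \<rho> = integral {0..T} (\<lambda>t. A t * \<psi>' t) + integral {0..T} (\<lambda>t. b t * \<psi> t)"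
    unfolding \<rho>_def by (rule integral_add[OF i1 i2])
  ultimately have eq: "integral {0..T} (\<lambda>t. A t * \<psi>' t) = - a0 * \<psi> 0 - integral {0..T} (\<lambda>t. b t * \<psi> t)"
    unfolding F_def by simp
  obtain Q where Q: "0 \<le> Q" "\<And>t. t \<in> {0..T} \<Longrightarrow> \<bar>\<psi> t\<bar> \<le> Q" using bnd[OF c\<psi>] by blast
  have "\<bar>b t * \<psi> t\<bar> \<le> C * Q" if "t \<in> {0<..<T}" for t
    unfolding abs_mult using b(2)[of t] Q that C0 by (intro mult_mono) auto
  from bounded_integrable_time(3)[OF integrable_on_measurable_time[OF i2] this]
  have eb: "(LINT t|lebesgue_on {0<..<T}. b t * \<psi> t) = integral {0..T} (\<lambda>t. b t * \<psi> t)" .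
  have "\<bar>A t * \<psi>' t\<bar> \<le> (\<bar>a0\<bar> + C * T) * P" if "t \<in> {0<..<T}" for t
  proof -
    have "\<bar>A t - A 0\<bar> \<le> C * t" using A_lip[of 0 t] that by auto
    moreover have "C * t \<le> C * T" using that C0 by (intro mult_left_mono) auto
    moreover have "A 0 = a0" by (simp add: A_def)
    ultimately have "\<bar>A t\<bar> \<le> \<bar>a0\<bar> + C * T" by linarith
    then show ?thesis unfolding abs_mult using P that by (intro mult_mono) auto
  qed
  from bounded_integrable_time(3)[OF integrable_on_measurable_time[OF i1] this]
  have ea: "(LINT t|lebesgue_on {0<..<T}. A t * \<psi>' t) = integral {0..T} (\<lambda>t. A t * \<psi>' t)" .
  have "(LINT t|lebesgue_on {0<..<T}. a t * \<psi>' t) = (LINT t|lebesgue_on {0<..<T}. A t * \<psi>' t)"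
    by (rule Bochner_Integration.integral_cong) (auto simp: a A_def)
  then show "(LINT t|lebesgue_on {0<..<T}. a t * \<psi>' t) = - a0 * \<psi> 0 - (LINT t|lebesgue_on {0<..<T}. b t * \<psi> t)"
    using ea eb eq by simp
qed

text \<open>Test functions in time vanish near \<open>T\<close> but are free at 0, so their
  derivatives need not have mean zero: any continuous function vanishing near \<open>T\<close>
  occurs. This is how the weak formulation fixes the initial value.\<close>

lemma antiderivative_time_test:
  assumes c: "continuous_on UNIV \<theta>" and z: "\<And>t. d \<le> t \<Longrightarrow> \<theta> t = 0" and d: "d < T"
  shows "\<exists>\<psi>. time_test T \<psi> \<theta>"
proof -
  have "\<exists>F. \<forall>x::real. - \<infinity> < ereal x \<longrightarrow> ereal x < \<infinity> \<longrightarrow> (F has_vector_derivative \<theta> x) (at x)"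
    by (rule einterval_antiderivative) (use c in \<open>auto simp: continuous_on_eq_continuous_at\<close>)
  then obtain F where F: "\<And>x. (F has_real_derivative \<theta> x) (at x)"
    by (auto simp: has_real_derivative_iff_has_vector_derivative)
  define \<psi> where "\<psi> t = F t - F T" for t
  have deriv: "(\<psi> has_real_derivative \<theta> t) (at t)" for t
    unfolding \<psi>_def using DERIV_diff[OF F[of t] DERIV_const] by simp
  have "\<psi> t = 0" if t: "d \<le> t" for t
  proof -
    have dF: "F x = F d" if "d \<le> x" for x
    proof (cases "d = x")
      case False
      show ?thesis
      proof (rule DERIV_isconst_end[of d x F])
        show "d < x" using False that by simp
        show "continuous_on {d..x} F" by (intro continuous_at_imp_continuous_on ballI DERIV_isCont[OF F])
        show "(F has_real_derivative 0) (at y)" if "d < y" "y < x" for y using F[of y] z[of y] that by simp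
      qed
    qed simp
    show ?thesis using dF[OF t] dF[of T] d unfolding \<psi>_def by simp
  qed
  then have "\<exists>\<delta>>0. \<forall>t\<ge>T - \<delta>. \<psi> t = 0" using d by (intro exI[of _ "T - d"] conjI allI impI) simp_all
  with deriv c have "time_test T \<psi> \<theta>" unfolding time_test_def by (intro conjI allI)
  then show ?thesis by blast
qed

text \<open>The lemma of du Bois-Reymond with initial value. The primitive \<open>A\<close>
  satisfies the same identity, so \<open>a - A\<close> annihilates every continuous function
  vanishing near \<open>T\<close>; no additive constant remains free.\<close>

lemma weak_dt_init_imp_primitive:
  assumes a: "a \<in> borel_measurable (lebesgue_on {0<..<T})" "\<And>t. t \<in> {0<..<T} \<Longrightarrow> \<bar>a t\<bar> \<le> C"
    and b: "b integrable_on {0..T}" "\<And>t. t \<in> {0..T} \<Longrightarrow> \<bar>b t\<bar> \<le> C" and T: "0 < T"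
    and w: "weak_dt_init T a b a0"
  shows "AE t in lebesgue_on {0<..<T}. a t = a0 + integral {0..t} b"
proof -
  define A where "A t = a0 + integral {0..t} b" for t
  have wA: "weak_dt_init T A b a0" using weak_dt_init_primitive[OF b T, of A a0] A_def by blast
  have Ac: "continuous_on {0..T} A" 
    unfolding A_def by (intro continuous_intros indefinite_integral_continuous_1 b(1))
  then have "A integrable_on {0..T}" by (rule integrable_continuous_interval)
  then have Am: "A \<in> borel_measurable (lebesgue_on {0<..<T})" by (rule integrable_on_measurable_time)
  obtain K where K: "\<forall>t\<in>{0..T}. \<bar>A t\<bar> \<le> K" using continuous_on_Icc_bounded[OF Ac] by blast
  define e where "e t = a t - A t" for t
  have em: "e \<in> borel_measurable (lebesgue_on {0<..<T})" unfolding e_def using a(1) Am by auto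
  have eb: "\<bar>e t\<bar> \<le> C + K" if "t \<in> {0<..<T}" for t
  proof -
    have "\<bar>A t\<bar> \<le> K" using K that by auto
    then show ?thesis using a(2)[OF that] unfolding e_def by linarith
  qed
  have S: "{0<..<T} \<inter> space lebesgue \<in> sets lebesgue" by simp
  define h where "h t = indicator {0<..<T} t *\<^sub>R e t" for t
  have "integrable (lebesgue_on {0<..<T}) e" by (rule bounded_integrable_time(1)[OF em]) (rule eb)
  then have hi: "integrable lebesgue h" unfolding h_def
    by (subst (asm) integrable_restrict_space[OF S])
  have ez: "(LINT t|lebesgue. h t * \<theta> t) = 0"
    if c: "continuous_on UNIV \<theta>" and z: "\<And>t. d \<le> t \<Longrightarrow> \<theta> t = 0" and d: "d < T" for \<theta> d
  proof -
    obtain \<psi> where \<psi>: "time_test T \<psi> \<theta>" using antiderivative_time_test[OF c z d] by blast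
    obtain X where X: "\<forall>t\<in>{0..T}. \<bar>\<theta> t\<bar> \<le> X" using continuous_on_Icc_bounded[OF continuous_on_subset[OF c subset_UNIV]] by blast
    have \<theta>m: "\<theta> \<in> borel_measurable (lebesgue_on {0<..<T})"
      by (rule integrable_on_measurable_time[OF integrable_continuous_interval[OF continuous_on_subset[OF c]]]) auto
    have i: "integrable (lebesgue_on {0<..<T}) (\<lambda>t. g t * \<theta> t)"
      if g: "g \<in> borel_measurable (lebesgue_on {0<..<T})" "\<And>t. t \<in> {0<..<T} \<Longrightarrow> \<bar>g t\<bar> \<le> Y" for g Y
    proof (rule bounded_integrable_time(1)[where C = "\<bar>Y\<bar> * X"])
      show "(\<lambda>t. g t * \<theta> t) \<in> borel_measurable (lebesgue_on {0<..<T})" using g \<theta>m by auto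
      fix t assume t: "t \<in> {0<..<T}"
      then have "\<bar>\<theta> t\<bar> \<le> X" using X by auto
      moreover have "\<bar>g t\<bar> \<le> \<bar>Y\<bar>" using g(2)[OF t] by linarith
      ultimately show "\<bar>g t * \<theta> t\<bar> \<le> \<bar>Y\<bar> * X" unfolding abs_mult by (intro mult_mono) auto
    qed
    have "(LINT t|lebesgue_on {0<..<T}. a t * \<theta> t) = (LINT t|lebesgue_on {0<..<T}. A t * \<theta> t)"
      using w[unfolded weak_dt_init_def, rule_format, OF \<psi>] wA[unfolded weak_dt_init_def, rule_format, OF \<psi>] by simp
    moreover have "(LINT t|lebesgue_on {0<..<T}. e t * \<theta> t) = (LINT t|lebesgue_on {0<..<T}. a t * \<theta> t) - (LINT t|lebesgue_on {0<..<T}. A t * \<theta> t)"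
    proof -
      have "integrable (lebesgue_on {0<..<T}) (\<lambda>t. A t * \<theta> t)" by (rule i[OF Am, of K]) (use K in auto)
      from Bochner_Integration.integral_diff[OF i[OF a] this] show ?thesis unfolding e_def by (simp add: left_diff_distrib)
    qed
    moreover have "(LINT t|lebesgue_on {0<..<T}. e t * \<theta> t) = (LINT t|lebesgue. h t * \<theta> t)"
      unfolding h_def integral_restrict_space[OF S] by (simp add: mult.assoc)
    ultimately show ?thesis by simp
  qed
  have "AE t in lebesgue. t \<in> {0<..<T} \<longrightarrow> h t = 0"
  proof (rule AE_zero_if_box_integrals_zero[OF hi])
    fix c d :: real assume sub: "cbox c d \<subseteq> {0<..<T}"
    show "(LINT t:box c d|lebesgue. h t) = 0"
    proof (cases "c < d")
      case False then show ?thesis by (simp add: set_lebesgue_integral_def)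
    next
      case True
      then have "d \<in> cbox c d" by simp
      then have dT: "d < T" using sub by auto
      \<comment> \<open>The analogue of \<open>box_bump\<close> in one variable; it vanishes from
        \<open>d\<close> on, as the preceding step requires of its test functions.\<close>
      define Q where "Q t = (max 0 ((t - c) * (d - t)))\<^sup>2" for t
      have Qc: "continuous_on UNIV Q" unfolding Q_def by (intro continuous_intros)
      have Q0: "0 \<le> Q t" for t by (simp add: Q_def)
      have Qd: "Q t = 0" if "d \<le> t" for t
      proof -
        have "(t - c) * (d - t) \<le> 0" using that True by (intro mult_nonneg_nonpos) auto
        then show ?thesis unfolding Q_def by simp
      qed
      have Qpos: "{t. 0 < Q t} = box c d"
      proof -
        have "0 < (max 0 y)\<^sup>2 \<longleftrightarrow> 0 < y" for y :: real by (cases "0 < y") auto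
        then have q: "0 < Q t \<longleftrightarrow> 0 < (t - c) * (d - t)" for t unfolding Q_def .
        have "0 < (t - c) * (d - t) \<longleftrightarrow> c < t \<and> t < d" for t
          using True unfolding zero_less_mult_iff by linarith
        then show ?thesis unfolding q by (simp add: box_def greaterThanLessThan_def greaterThan_def lessThan_def Int_def)
      qed
      have "(LINT t|lebesgue. h t * (1 - exp (- (real k * Q t)))) = 0" for k
      proof (rule ez[OF _ _ dT])
        show "continuous_on UNIV (\<lambda>t. 1 - exp (- (real k * Q t)))" by (intro continuous_intros Qc)
      qed (simp add: Qd)
      then show ?thesis using bump_limit[OF hi Qc Q0] unfolding Qpos by (simp add: LIMSEQ_const_iff)
    qed
  qed auto
  then have "AE t in lebesgue_on {0<..<T}. e t = 0" unfolding AE_restrict_space_iff[OF S]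
    by eventually_elim (auto simp: h_def)
  then show ?thesis by eventually_elim (simp add: e_def A_def)
qed

lemma weak_dt_init_cong:
  assumes w: "weak_dt_init T a b a0"
    and m: "a \<in> borel_measurable (lebesgue_on {0<..<T})" "a' \<in> borel_measurable (lebesgue_on {0<..<T})"
      "b \<in> borel_measurable (lebesgue_on {0<..<T})" "b' \<in> borel_measurable (lebesgue_on {0<..<T})"
    and ae: "AE t in lebesgue_on {0<..<T}. a t = a' t" "AE t in lebesgue_on {0<..<T}. b t = b' t"
  shows "weak_dt_init T a' b' a0"
  unfolding weak_dt_init_def
proof (intro allI impI)
  fix \<psi> \<psi>' assume t: "time_test T \<psi> \<psi>'"
  then have c\<psi>': "continuous_on UNIV \<psi>'" and d\<psi>: "\<And>t. (\<psi> has_real_derivative \<psi>' t) (at t)"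
    unfolding time_test_def by auto
  have c\<psi>: "continuous_on UNIV \<psi>" by (intro continuous_at_imp_continuous_on ballI DERIV_isCont[OF d\<psi>])
  have cm: "g \<in> borel_measurable (lebesgue_on {0<..<T})" if "continuous_on UNIV g" for g :: "real \<Rightarrow> real"
    by (rule integrable_on_measurable_time[OF integrable_continuous_interval[OF continuous_on_subset[OF that]]]) auto
  have "(LINT t|lebesgue_on {0<..<T}. a' t * \<psi>' t) = (LINT t|lebesgue_on {0<..<T}. a t * \<psi>' t)"
    using m cm[OF c\<psi>'] ae(1) by (intro integral_cong_AE) (auto elim: eventually_mono)
  moreover have "(LINT t|lebesgue_on {0<..<T}. b' t * \<psi> t) = (LINT t|lebesgue_on {0<..<T}. b t * \<psi> t)"
    using m cm[OF c\<psi>] ae(2) by (intro integral_cong_AE) (auto elim: eventually_mono)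
  ultimately show "(LINT t|lebesgue_on {0<..<T}. a' t * \<psi>' t) = - a0 * \<psi> 0 - (LINT t|lebesgue_on {0<..<T}. b' t * \<psi> t)"
    using w[unfolded weak_dt_init_def, rule_format, OF t] by simp
qed

text \<open>Weak solutions are known for almost every time in the open interval, the approximate
  solutions are integrated over closed ones; the two end points join the exceptional set.\<close>

lemma integral_AE_zero:
  fixes g :: "real \<Rightarrow> real"
  assumes "AE t in lebesgue_on {0<..<T}. g t = 0" "0 \<le> a" "b \<le> T"
  shows "integral {a..b} g = 0"
proof -
  have S: "{0<..<T} \<in> sets lebesgue" by simp
  obtain N where N: "N \<in> null_sets (lebesgue_on {0<..<T})" "{t \<in> space (lebesgue_on {0<..<T}). \<not> g t = 0} \<subseteq> N"
    using assms(1) unfolding eventually_ae_filter by blast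
  then have neg: "negligible (N \<union> {0, T})"
    using null_sets_restrict_space[OF S] by (simp add: negligible_iff_null_sets[symmetric] negligible_Un)
  have "integral {a..b} g = integral {a..b} (\<lambda>t. 0)"
  proof (rule integral_spike[OF neg])
    fix t assume "t \<in> {a..b} - (N \<union> {0, T})"
    then have "t \<in> {0<..<T}" "t \<notin> N" using assms(2,3) by auto
    then show "0 = g t" using N(2) by auto
  qed
  then show ?thesis by simp
qed

section \<open>The diffusion coefficient\<close>

lemma powr_lipschitz:
  fixes a :: real
  assumes a: "a \<le> 0" and e: "\<epsilon> > 0" and s: "0 \<le> s" "0 \<le> s'"
  shows "\<bar>(\<epsilon> + s) powr a - (\<epsilon> + s') powr a\<bar> \<le> (- a) * \<epsilon> powr (a - 1) * \<bar>s - s'\<bar>"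
proof -
  have "norm ((\<epsilon> + s) powr a - (\<epsilon> + s') powr a) \<le> ((- a) * \<epsilon> powr (a - 1)) * norm (s - s')"
  proof (rule field_differentiable_bound[of "{0..}" "\<lambda>s. (\<epsilon> + s) powr a" "\<lambda>s. a * (\<epsilon> + s) powr (a - 1)"])
    fix z :: real assume z: "z \<in> {0..}"
    show "((\<lambda>s. (\<epsilon> + s) powr a) has_field_derivative a * (\<epsilon> + z) powr (a - 1)) (at z within {0..})"
      using z e by (auto intro!: derivative_eq_intros)
    have "(\<epsilon> + z) powr (a - 1) \<le> \<epsilon> powr (a - 1)" using a e z by (intro powr_mono2') auto
    then show "norm (a * (\<epsilon> + z) powr (a - 1)) \<le> (- a) * \<epsilon> powr (a - 1)"
      using a by (simp add: abs_mult mult_left_mono_neg)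
  qed (use s in auto)
  then show ?thesis by simp
qed

locale problem = domain \<Omega> for \<Omega> :: "(real^'n::finite) set" +
  fixes p \<epsilon> \<sigma> \<eta> :: real
  assumes p: "1 \<le> p" "p \<le> 2" and \<epsilon>: "\<epsilon> > 0" and \<sigma>: "\<sigma> > 0" and \<eta>: "\<eta> > 0"
begin

text \<open>The representer of the convolution at \<open>x\<close>:
  \<open>conv_dgauss \<sigma> \<Omega> j f x\<close> is the scalar product of
  \<open>kern j x\<close> with the class of \<open>f\<close>. All bounds on the coefficient thus
  become Cauchy-Schwarz estimates.\<close>

definition kern :: "'n \<Rightarrow> real^'n \<Rightarrow> 'n lsq" where
  "kern j x = cls_on \<Omega> (\<lambda>y. pd j (gauss \<sigma>) (x - y))"

lemma kern_L2: "L2 \<Omega> (\<lambda>y. pd j (gauss \<sigma>) (x - y))"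
  by (rule L2_continuous, rule continuous_on_compose2[OF pd_gauss_continuous[OF \<sigma>]]) (auto intro!: continuous_intros)

lemma kern_bounded: "\<exists>k\<ge>0. \<forall>j x. norm (kern j x) \<le> k"
proof -
  obtain K where K: "\<And>j (z :: real^'n). \<bar>pd j (gauss \<sigma>) z\<bar> \<le> K" using pd_gauss_bounded[OF \<sigma>] by blast
  define I where "I = (LINT x|lebesgue_on \<Omega>. K\<^sup>2)"
  have "norm (kern j x) \<le> sqrt I" for j x
  proof -
    have "(norm (kern j x))\<^sup>2 = (LINT y|lebesgue_on \<Omega>. (pd j (gauss \<sigma>) (x - y))\<^sup>2)"
      unfolding kern_def power2_norm_eq_inner by (simp add: cls_on_inner kern_L2 power2_eq_square)
    also have "\<dots> \<le> I" unfolding I_def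
    proof (rule integral_mono)
      show "integrable (lebesgue_on \<Omega>) (\<lambda>y. (pd j (gauss \<sigma>) (x - y))\<^sup>2)" using kern_L2 unfolding L2_def by blast
      show "integrable (lebesgue_on \<Omega>) (\<lambda>x. K\<^sup>2)" by (rule L2_integrable[OF L2_continuous]) simp
      show "(pd j (gauss \<sigma>) (x - y))\<^sup>2 \<le> K\<^sup>2" for y using K[of j "x - y"] by (metis abs_ge_zero power2_abs power_mono)
    qed
    finally show ?thesis by (rule real_le_rsqrt)
  qed
  moreover have "0 \<le> sqrt I" unfolding I_def by simp
  ultimately show ?thesis by blast
qed

definition "kern_max = (SOME k. 0 \<le> k \<and> (\<forall>j x. norm (kern j x) \<le> k))"

lemma kern_max: "0 \<le> kern_max" "norm (kern j x) \<le> kern_max"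
  using someI_ex[of "\<lambda>k. 0 \<le> k \<and> (\<forall>j x. norm (kern j x) \<le> k)"] kern_bounded unfolding kern_max_def by auto

lemma kern_inner_continuous: "continuous_on UNIV (\<lambda>x. F \<bullet> kern j x)"
proof -
  obtain K where K: "\<And>j (z :: real^'n). \<bar>pd j (gauss \<sigma>) z\<bar> \<le> K" using pd_gauss_bounded[OF \<sigma>] by blast
  have eq: "F \<bullet> kern j x = (LINT y|lebesgue_on \<Omega>. rep F y * pd j (gauss \<sigma>) (x - y))" for x
    unfolding kern_def by (rule inner_cls_on[OF kern_L2])
  show ?thesis unfolding continuous_on_sequentially comp_def eq
  proof (intro allI ballI impI, elim conjE)
    fix X :: "nat \<Rightarrow> real^'n" and x assume X: "X \<longlonglongrightarrow> x"
    show "(\<lambda>n. LINT y|lebesgue_on \<Omega>. rep F y * pd j (gauss \<sigma>) (X n - y)) \<longlonglongrightarrow> (LINT y|lebesgue_on \<Omega>. rep F y * pd j (gauss \<sigma>) (x - y))"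
    proof (rule integral_dominated_convergence[where w = "\<lambda>y. K * \<bar>rep F y\<bar>"])
      show "(\<lambda>y. rep F y * pd j (gauss \<sigma>) (z - y)) \<in> borel_measurable (lebesgue_on \<Omega>)" for z
        using L2_integrable_mult[OF L2_rep kern_L2] by auto
      show "(\<lambda>y. rep F y * pd j (gauss \<sigma>) (X n - y)) \<in> borel_measurable (lebesgue_on \<Omega>)" for n
        using L2_integrable_mult[OF L2_rep kern_L2] by auto
      show "integrable (lebesgue_on \<Omega>) (\<lambda>y. K * \<bar>rep F y\<bar>)" using L2_integrable[OF L2_rep] by auto
      have "(\<lambda>n. pd j (gauss \<sigma>) (X n - y)) \<longlonglongrightarrow> pd j (gauss \<sigma>) (x - y)" for y
        by (rule continuous_on_tendsto_compose[OF pd_gauss_continuous[OF \<sigma>]]) (auto intro!: tendsto_intros X)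
      then show "AE y in lebesgue_on \<Omega>. (\<lambda>n. rep F y * pd j (gauss \<sigma>) (X n - y)) \<longlonglongrightarrow> rep F y * pd j (gauss \<sigma>) (x - y)"
        by (intro AE_I2 tendsto_intros)
      show "AE y in lebesgue_on \<Omega>. norm (rep F y * pd j (gauss \<sigma>) (X n - y)) \<le> K * \<bar>rep F y\<bar>" for n
        using K by (intro AE_I2) (simp add: abs_mult mult.commute[of K] mult_left_mono)
    qed
  qed
qed

definition "coefL F x = (\<epsilon> + (\<Sum>j\<in>UNIV. (F \<bullet> kern j x)\<^sup>2)) powr ((p - 2) / 2)"
definition "coef_max = \<epsilon> powr ((p - 2) / 2)"
definition "coef_min R = (\<epsilon> + real CARD('n) * (R * kern_max)\<^sup>2) powr ((p - 2) / 2)"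
text \<open>The product of the largest slope of the power, attained at \<epsilon>, and the Lipschitz
  constant of the sum of squares on the ball, from the factorisation of a difference of squares. The
  absolute value makes it nonnegative for every real radius, as the locale demands.\<close>

definition "coef_lip R = (2 - p) / 2 * \<epsilon> powr ((p - 2) / 2 - 1) * (real CARD('n) * (2 * (\<bar>R\<bar> * kern_max) * kern_max))"

lemma quad_nonneg: "0 \<le> (\<Sum>j\<in>UNIV. (F \<bullet> kern j x)\<^sup>2)"
  by (intro sum_nonneg) simp

lemma coefL_bounds: "0 \<le> coefL F x" "coefL F x \<le> coef_max"
proof -
  show "0 \<le> coefL F x" unfolding coefL_def by simp
  show "coefL F x \<le> coef_max" unfolding coefL_def coef_max_def using p \<epsilon> quad_nonneg[of F x] by (intro powr_mono2') auto
qed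

lemma kern_inner_bound: "norm F \<le> R \<Longrightarrow> \<bar>F \<bullet> kern j x\<bar> \<le> R * kern_max"
  using kern_max by (intro order_trans[OF Cauchy_Schwarz_ineq2] mult_mono) (auto intro: order_trans[OF norm_ge_zero])

lemma coefL_lower: "norm F \<le> R \<Longrightarrow> coef_min R \<le> coefL F x"
proof -
  assume R: "norm F \<le> R"
  have "(F \<bullet> kern j x)\<^sup>2 \<le> (R * kern_max)\<^sup>2" for j
    using kern_inner_bound[OF R, of j x] by (metis abs_ge_zero power2_abs power_mono)
  then have "(\<Sum>j\<in>UNIV. (F \<bullet> kern j x)\<^sup>2) \<le> (\<Sum>j\<in>(UNIV::'n set). (R * kern_max)\<^sup>2)" by (intro sum_mono)
  then have "(\<Sum>j\<in>UNIV. (F \<bullet> kern j x)\<^sup>2) \<le> real CARD('n) * (R * kern_max)\<^sup>2" by simp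
  then show ?thesis unfolding coefL_def coef_min_def using p \<epsilon> quad_nonneg[of F x] by (intro powr_mono2') auto
qed

lemma coefL_lipschitz:
  assumes R: "norm F \<le> R" "norm F' \<le> R"
  shows "\<bar>coefL F x - coefL F' x\<bar> \<le> coef_lip R * norm (F - F')"
proof -
  let ?q = "\<lambda>F. \<Sum>j\<in>UNIV. (F \<bullet> kern j x)\<^sup>2"
  have R0: "0 \<le> R" using R(1) norm_ge_zero order_trans by blast
  have "\<bar>coefL F x - coefL F' x\<bar> \<le> (- ((p - 2) / 2)) * \<epsilon> powr ((p - 2) / 2 - 1) * \<bar>?q F - ?q F'\<bar>"
    unfolding coefL_def using p by (intro powr_lipschitz \<epsilon> quad_nonneg) auto
  moreover have "\<bar>?q F - ?q F'\<bar> \<le> real CARD('n) * (2 * (\<bar>R\<bar> * kern_max) * kern_max) * norm (F - F')"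
  proof -
    have "\<bar>(F \<bullet> kern j x)\<^sup>2 - (F' \<bullet> kern j x)\<^sup>2\<bar> \<le> (2 * (\<bar>R\<bar> * kern_max)) * (norm (F - F') * kern_max)" for j
    proof -
      have eq: "(F \<bullet> kern j x)\<^sup>2 - (F' \<bullet> kern j x)\<^sup>2 = (F \<bullet> kern j x + F' \<bullet> kern j x) * ((F - F') \<bullet> kern j x)"
        by (simp add: power2_eq_square inner_diff_left algebra_simps)
      have "\<bar>F \<bullet> kern j x + F' \<bullet> kern j x\<bar> \<le> 2 * (\<bar>R\<bar> * kern_max)"
        using kern_inner_bound[OF R(1), of j x] kern_inner_bound[OF R(2), of j x] R0 by auto
      moreover have "\<bar>(F - F') \<bullet> kern j x\<bar> \<le> norm (F - F') * kern_max" by (rule kern_inner_bound) simp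
      ultimately show ?thesis unfolding eq abs_mult using kern_max(1) by (intro mult_mono) auto
    qed
    then have "(\<Sum>j\<in>UNIV. \<bar>(F \<bullet> kern j x)\<^sup>2 - (F' \<bullet> kern j x)\<^sup>2\<bar>) \<le> (\<Sum>j\<in>(UNIV :: 'n set). (2 * (\<bar>R\<bar> * kern_max)) * (norm (F - F') * kern_max))"
      by (intro sum_mono)
    moreover have "\<bar>?q F - ?q F'\<bar> \<le> (\<Sum>j\<in>UNIV. \<bar>(F \<bullet> kern j x)\<^sup>2 - (F' \<bullet> kern j x)\<^sup>2\<bar>)"
      unfolding sum_subtractf[symmetric] by (rule sum_abs)
    ultimately show ?thesis by (simp add: mult_ac)
  qed
  moreover have "0 \<le> (- ((p - 2) / 2)) * \<epsilon> powr ((p - 2) / 2 - 1)" using p by (intro mult_nonneg_nonneg) auto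
  ultimately have "\<bar>coefL F x - coefL F' x\<bar> \<le> (- ((p - 2) / 2)) * \<epsilon> powr ((p - 2) / 2 - 1) * (real CARD('n) * (2 * (\<bar>R\<bar> * kern_max) * kern_max) * norm (F - F'))"
    by (meson mult_left_mono order_trans)
  also have "- ((p - 2) / 2) = (2 - p) / 2" by (simp add: field_simps)
  finally show ?thesis unfolding coef_lip_def by (simp only: mult.assoc)
qed

lemma coefL_bdd_meas: "bdd_meas (coefL F) coef_max"
proof -
  have "continuous_on UNIV (\<lambda>x. \<epsilon> + (\<Sum>j\<in>UNIV. (F \<bullet> kern j x)\<^sup>2))"
    by (intro continuous_on_add continuous_on_const continuous_on_sum continuous_on_power kern_inner_continuous)
  moreover have "\<epsilon> + (\<Sum>j\<in>UNIV. (F \<bullet> kern j x)\<^sup>2) \<noteq> 0" for x using add_pos_nonneg[OF \<epsilon> quad_nonneg[of F x]] by simp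
  ultimately have c: "continuous_on UNIV (coefL F)" unfolding coefL_def by (intro continuous_on_powr continuous_on_const) auto
  have "coefL F \<in> borel_measurable lebesgue"
    using borel_measurable_continuous_onI[OF c] by (intro measurable_completion) simp
  then show ?thesis unfolding bdd_meas_def using coefL_bounds[of F] by auto
qed

sublocale wave V "\<lambda>F. mulop (coefL F)" coef_max coef_lip coef_min \<eta>
proof (rule wave.intro)
  show "subspace V" "closed V" by (rule V_subspace V_closed)+
  show "(0, g) \<in> V \<Longrightarrow> g = 0" for g by (rule V_inj)
  show "linear (mulop (coefL F))" for F by (rule mulop_linear[OF coefL_bdd_meas])
  show "mulop (coefL F) x \<bullet> y = x \<bullet> mulop (coefL F) y" for F x y by (rule mulop_sym[OF coefL_bdd_meas])
  show coef_max: "0 \<le> coef_max" unfolding coef_max_def by simp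
  show "norm (mulop (coefL F) x) \<le> coef_max * norm x" for F x by (rule mulop_norm[OF coefL_bdd_meas coef_max])
  show coef_lip: "0 \<le> coef_lip R" for R unfolding coef_lip_def using p kern_max(1) by (intro mult_nonneg_nonneg) auto
  show "norm (mulop (coefL F) x - mulop (coefL F') x) \<le> coef_lip R * norm (F - F') * norm x"
    if "norm F \<le> R" "norm F' \<le> R" for R F F' x
    unfolding mulop_diff[OF coefL_bdd_meas coefL_bdd_meas]
  proof (rule mulop_norm)
    show "bdd_meas (\<lambda>x. coefL F x - coefL F' x) (coef_lip R * norm (F - F'))"
      using coefL_bdd_meas[of F] coefL_bdd_meas[of F'] coefL_lipschitz[OF that] unfolding bdd_meas_def by auto
    show "0 \<le> coef_lip R * norm (F - F')" using coef_lip by simp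
  qed
  show "0 < coef_min R" for R unfolding coef_min_def using \<epsilon> by (simp add: add_pos_nonneg pos_add_strict) (metis add_pos_nonneg less_irrefl mult_nonneg_nonneg of_nat_0_le_iff zero_le_power2)
  show "coef_min R * (norm x)\<^sup>2 \<le> mulop (coefL F) x \<bullet> x" if "norm F \<le> R" for R F x
    by (rule mulop_coercive[OF coefL_bdd_meas coefL_lower[OF that]])
  show "0 \<le> \<eta>" using \<eta> by simp
qed

lemma coef_eq: "L2 \<Omega> f \<Longrightarrow> coef p \<epsilon> \<sigma> \<Omega> f x = coefL (cls_on \<Omega> f) x"
proof -
  assume f: "L2 \<Omega> f"
  have "conv_dgauss \<sigma> \<Omega> j f x = cls_on \<Omega> f \<bullet> kern j x" for j
    unfolding conv_dgauss_def kern_def by (simp add: cls_on_inner[OF f kern_L2] mult.commute)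
  then show ?thesis unfolding coef_def coefL_def by simp
qed

text \<open>The kernels are extended by zero outside \<Omega>, so the coefficient sees a state only
  through functions on \<Omega>. This suits weak solutions, which are identified only by such scalar
  products.\<close>

lemma coefL_cong:
  assumes "\<And>v. L2 \<Omega> v \<Longrightarrow> F \<bullet> cls_on \<Omega> v = F' \<bullet> cls_on \<Omega> v" shows "coefL F = coefL F'"
  unfolding coefL_def kern_def using assms[OF kern_L2] by simp

lemma mult_cls_on:
  assumes c: "bdd_meas c K" and f: "L2 \<Omega> f"
  shows "L2 \<Omega> (\<lambda>x. c x * f x)" "cls (\<lambda>x. c x * rep (cls_on \<Omega> f) x) = cls_on \<Omega> (\<lambda>x. c x * f x)"
proof -
  have eq: "res \<Omega> (\<lambda>x. c x * f x) = (\<lambda>x. c x * res \<Omega> f x)" by (auto simp: res_def)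
  have s: "sq_int (\<lambda>x. c x * res \<Omega> f x)"
    by (rule sq_int_bounded_mult[where K = K]) (use c f in \<open>auto simp: bdd_meas_def L2_iff\<close>)
  then show "L2 \<Omega> (\<lambda>x. c x * f x)" unfolding L2_iff eq .
  have "AE x in lebesgue. rep (cls_on \<Omega> f) x = res \<Omega> f x"
    unfolding cls_on_def by (rule rep_cls) (use f in \<open>simp add: L2_iff\<close>)
  then have "AE x in lebesgue. c x * rep (cls_on \<Omega> f) x = c x * res \<Omega> f x" by eventually_elim simp
  then show "cls (\<lambda>x. c x * rep (cls_on \<Omega> f) x) = cls_on \<Omega> (\<lambda>x. c x * f x)"
    unfolding cls_on_def eq using cls_eq_iff[OF mulop_sq_int[OF c] s] unfolding cls_on_def by blast
qed

text \<open>The bridge between the integral in the weak formulation and the abstract terms of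
  damping and flux.\<close>

lemma form_eq:
  assumes u: "H1 \<Omega> u" and \<phi>: "H1 \<Omega> \<phi>" and w: "L2 \<Omega> w"
  shows "(LINT x|lebesgue_on \<Omega>. \<eta> * w x * \<phi> x + coef p \<epsilon> \<sigma> \<Omega> u x * grad_dot \<Omega> u \<phi> x) =
    \<eta> * (cls_on \<Omega> w \<bullet> cls_on \<Omega> \<phi>) + mulop (coefL (cls_on \<Omega> u)) (snd (emb u)) \<bullet> snd (emb \<phi>)"
proof -
  let ?c = "coefL (cls_on \<Omega> u)"
  note m = mult_cls_on[OF coefL_bdd_meas H1_wpd(1)[OF u]]
  have i: "integrable (lebesgue_on \<Omega>) (\<lambda>x. (?c x * wpd \<Omega> j u x) * wpd \<Omega> j \<phi> x)" for j
    by (rule L2_integrable_mult[OF m(1) H1_wpd(1)[OF \<phi>]])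
  have "(LINT x|lebesgue_on \<Omega>. \<eta> * w x * \<phi> x + coef p \<epsilon> \<sigma> \<Omega> u x * grad_dot \<Omega> u \<phi> x) =
     (LINT x|lebesgue_on \<Omega>. \<eta> * (w x * \<phi> x) + (\<Sum>j\<in>UNIV. (?c x * wpd \<Omega> j u x) * wpd \<Omega> j \<phi> x))"
    unfolding grad_dot_def coef_eq[OF H1_L2[OF u]] sum_distrib_left by (simp add: mult.assoc)
  also have "\<dots> = (LINT x|lebesgue_on \<Omega>. \<eta> * (w x * \<phi> x)) + (LINT x|lebesgue_on \<Omega>. (\<Sum>j\<in>UNIV. (?c x * wpd \<Omega> j u x) * wpd \<Omega> j \<phi> x))"
    by (intro Bochner_Integration.integral_add Bochner_Integration.integrable_sum i integrable_mult_right L2_integrable_mult w H1_L2[OF \<phi>])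
  also have "(LINT x|lebesgue_on \<Omega>. \<eta> * (w x * \<phi> x)) = \<eta> * (cls_on \<Omega> w \<bullet> cls_on \<Omega> \<phi>)"
    by (simp add: cls_on_inner[OF w H1_L2[OF \<phi>]])
  also have "(LINT x|lebesgue_on \<Omega>. (\<Sum>j\<in>UNIV. (?c x * wpd \<Omega> j u x) * wpd \<Omega> j \<phi> x)) =
      (\<Sum>j\<in>UNIV. LINT x|lebesgue_on \<Omega>. (?c x * wpd \<Omega> j u x) * wpd \<Omega> j \<phi> x)"
    by (rule Bochner_Integration.integral_sum[OF i])
  also have "\<dots> = (\<Sum>j\<in>UNIV. cls_on \<Omega> (\<lambda>x. ?c x * wpd \<Omega> j u x) \<bullet> cls_on \<Omega> (wpd \<Omega> j \<phi>))"
    by (simp add: cls_on_inner[OF m(1) H1_wpd(1)[OF \<phi>]])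
  also have "\<dots> = mulop ?c (snd (emb u)) \<bullet> snd (emb \<phi>)"
    unfolding mulop_def emb_def inner_vec_def by (simp add: m(2))
  finally show ?thesis .
qed

end

section \<open>Weak solutions\<close>

context problem
begin

lemma H1_lin: "H1 \<Omega> f \<Longrightarrow> H1 \<Omega> g \<Longrightarrow> H1 \<Omega> (\<lambda>x. a * f x + b * g x)"
proof (rule H1I(1)[OF L2_lin[OF H1_L2 H1_L2], of f g "a *\<^sub>R emb f + b *\<^sub>R emb g"])
  assume fg: "H1 \<Omega> f" "H1 \<Omega> g"
  then show "a *\<^sub>R emb f + b *\<^sub>R emb g \<in> V"
    by (intro subspace_add subspace_scale V_subspace emb_in_V)
  show "fst (a *\<^sub>R emb f + b *\<^sub>R emb g) = cls_on \<Omega> (\<lambda>x. a * f x + b * g x)"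
    using fg by (simp add: emb_def cls_on_lin H1_L2)
qed

lemma cls_on_rep_cls_on: "L2 \<Omega> g \<Longrightarrow> cls_on \<Omega> (rep F) \<bullet> cls_on \<Omega> g = F \<bullet> cls_on \<Omega> g"
  by (simp only: inner_cls_on[of g F] cls_on_inner[OF L2_rep])

lemma cls_on_inner_rep: "L2 \<Omega> f \<Longrightarrow> cls_on \<Omega> f \<bullet> cls_on \<Omega> (rep F) = cls_on \<Omega> f \<bullet> F"
  using cls_on_rep_cls_on[of f F] by (simp add: inner_commute)

lemma norm_cls_on_rep: "norm (cls_on \<Omega> (rep F)) \<le> norm F"
proof (cases "cls_on \<Omega> (rep F) = 0")
  case False
  have "norm (cls_on \<Omega> (rep F)) * norm (cls_on \<Omega> (rep F)) = F \<bullet> cls_on \<Omega> (rep F)"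
    using cls_on_rep_cls_on[OF L2_rep, of F F] by (simp add: power2_norm_eq_inner[symmetric] power2_eq_square)
  also have "\<dots> \<le> norm F * norm (cls_on \<Omega> (rep F))" by (rule norm_cauchy_schwarz)
  finally show ?thesis using False by simp
qed simp

lemma L2_norm_cls_on: "L2 \<Omega> f \<Longrightarrow> L2_norm \<Omega> f = norm (cls_on \<Omega> f)"
  unfolding L2_norm_def norm_eq_sqrt_inner by (simp add: cls_on_inner power2_eq_square)

lemma AE_timeI: "(\<And>t. t \<in> {0<..<T} \<Longrightarrow> P t) \<Longrightarrow> AE t in lebesgue_on {0<..<T::real}. P t"
  by (rule AE_I2) simp

lemma inner_le: "norm x \<le> C \<Longrightarrow> \<bar>x \<bullet> y\<bar> \<le> C * norm y" for x y :: "'z::real_inner"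
  by (meson Cauchy_Schwarz_ineq2 mult_right_mono norm_ge_zero order_trans)

theorem weak_solution_exists:
  assumes u0: "H1 \<Omega> u0" and T: "0 < T" "T < life (H1_norm \<Omega> u0)"
  shows "\<exists>u. weak_solution \<Omega> p \<epsilon> \<sigma> \<eta> u0 T u"
proof -
  have f0: "fst (emb u0) = cls_on \<Omega> u0" by (simp add: emb_def)
  obtain B f U w where P: "proper_approx 0 B T (cls_on \<Omega> u0) f U w"
    using exact_solution_exists[OF emb_in_V[OF u0] _ T] norm_emb[OF u0] f0 by auto
  have UV: "U t \<in> V" and fB: "norm (f t) \<le> B" and fU: "f t = fst (U t)" if "t \<in> {0..T}" for t
  proof -
    have "U t \<in> V \<and> norm (f t) \<le> B \<and> norm (f t - fst (U t)) \<le> 0"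
      using P that unfolding proper_approx_def by blast
    then show "U t \<in> V" "norm (f t) \<le> B" "f t = fst (U t)" by (blast, blast, simp)
  qed
  have Uw: "wintble B 0 T U" and ww: "wintble B 0 T w" using P unfolding proper_approx_def by auto
  have UB: "norm (U t) \<le> B" and wB: "norm (w t) \<le> B" if "t \<in> {0..T}" for t
    using Uw ww that unfolding wintble_def by auto
  have f_inner: "f t \<bullet> h = cls_on \<Omega> u0 \<bullet> h + integral {0..t} (\<lambda>s. w s \<bullet> h)" if "t \<in> {0..T}" for t h
    using P that unfolding proper_approx_def by blast
  have eqn: "w t \<bullet> fst \<phi> + \<eta> * ((f t - cls_on \<Omega> u0) \<bullet> fst \<phi>) + integral {0..t} (\<lambda>s. mulop (coefL (f s)) (snd (U s)) \<bullet> snd \<phi>) = 0"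
    if "t \<in> {0..T}" "\<phi> \<in> V" for t \<phi>
  proof -
    have "\<bar>w t \<bullet> fst \<phi> + \<eta> * ((f t - cls_on \<Omega> u0) \<bullet> fst \<phi>) + integral {0..t} (\<lambda>s. mulop (coefL (f s)) (snd (U s)) \<bullet> snd \<phi>)\<bar> \<le> 0 * norm \<phi>"
      using P that unfolding proper_approx_def by blast
    then show ?thesis by simp
  qed
  have B0: "0 \<le> B" using order_trans[OF norm_ge_zero UB[of 0]] T by simp
  have Mw: "wintble (coef_max * B) 0 T (\<lambda>s. mulop (coefL (f s)) (snd (U s)))"
    by (rule wintble_M[OF wintble_snd[OF Uw] proper_approx_continuous[OF P] fB])
  define u where "u t = rep (f t)" for t
  define W where "W t = rep (w t)" for t
  \<comment> \<open>The second derivative is read off from the equation, which then holds trivially.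
    What remains is to show that it is the distributional derivative of the velocity, and this is
    the equation integrated in time.\<close>
  define z where "z t \<phi> = - (LINT x|lebesgue_on \<Omega>. \<eta> * W t x * \<phi> x + coef p \<epsilon> \<sigma> \<Omega> (u t) x * grad_dot \<Omega> (u t) \<phi> x)" for t \<phi>
  have uH: "H1 \<Omega> (u t)" and uU: "emb (u t) = U t" if "t \<in> {0..T}" for t
    using V_H1[OF UV[OF that]] fU[OF that] unfolding u_def by simp_all
  have cu: "cls_on \<Omega> (u t) = f t" if "t \<in> {0..T}" for t
    using uU[OF that] fU[OF that] unfolding emb_def by (metis fst_conv)
  have WL: "L2 \<Omega> (W t)" for t unfolding W_def by (rule L2_rep)
  have Wi: "(LINT x|lebesgue_on \<Omega>. W t x * v x) = w t \<bullet> cls_on \<Omega> v" if "L2 \<Omega> v" for t v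
    unfolding W_def inner_cls_on[OF that] ..
  have ui: "(LINT x|lebesgue_on \<Omega>. u t x * v x) = f t \<bullet> cls_on \<Omega> v" if "L2 \<Omega> v" for t v
    unfolding u_def inner_cls_on[OF that] ..
  have zeq: "z t \<phi> = - (\<eta> * (w t \<bullet> cls_on \<Omega> \<phi>) + mulop (coefL (f t)) (snd (U t)) \<bullet> snd (emb \<phi>))"
    if t: "t \<in> {0..T}" and \<phi>: "H1 \<Omega> \<phi>" for t \<phi>
    unfolding z_def form_eq[OF uH[OF t] \<phi> WL] cu[OF t] uU[OF t]
    using cls_on_inner[OF WL H1_L2[OF \<phi>], of t] Wi[OF H1_L2[OF \<phi>], of t] by simp
  have sub: "{0<..<T} \<subseteq> {0..T}" by auto
  have meas: "(\<lambda>t. U t \<bullet> y) \<in> borel_measurable (lebesgue_on {0<..<T})" for y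
    using Uw unfolding wintble_def by (intro integrable_on_measurable_time) blast
  have meas_w: "(\<lambda>t. w t \<bullet> y) \<in> borel_measurable (lebesgue_on {0<..<T})" for y
    using ww unfolding wintble_def by (intro integrable_on_measurable_time) auto
  have s1: "Linf_H1 T \<Omega> u"
    unfolding Linf_H1_def
  proof (intro conjI allI impI)
    show "AE t in lebesgue_on {0<..<T}. H1 \<Omega> (u t)" by (rule AE_timeI) (use uH sub in auto)
    show "(\<lambda>t. LINT x|lebesgue_on \<Omega>. u t x * v x) \<in> borel_measurable (lebesgue_on {0<..<T})" if v: "L2 \<Omega> v" for v
      using meas[of "(cls_on \<Omega> v, 0)"] by (rule measurable_cong[THEN iffD1, rotated]) (use ui[OF v] fU in \<open>auto simp: inner_prod_def\<close>)
    show "(\<lambda>t. LINT x|lebesgue_on \<Omega>. wpd \<Omega> j (u t) x * v x) \<in> borel_measurable (lebesgue_on {0<..<T})" if v: "L2 \<Omega> v" for v j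
    proof (rule measurable_cong[THEN iffD1, OF _ meas[of "(0, axis j (cls_on \<Omega> v))"]])
      fix t assume "t \<in> space (lebesgue_on {0<..<T})"
      then have t: "t \<in> {0..T}" by auto
      have "U t \<bullet> (0, axis j (cls_on \<Omega> v)) = snd (U t) $ j \<bullet> cls_on \<Omega> v" by (simp add: inner_prod_def inner_axis)
      also have "snd (U t) $ j = cls_on \<Omega> (wpd \<Omega> j (u t))" unfolding uU[OF t, symmetric] emb_def by simp
      finally show "U t \<bullet> (0, axis j (cls_on \<Omega> v)) = (LINT x|lebesgue_on \<Omega>. wpd \<Omega> j (u t) x * v x)"
        by (simp add: cls_on_inner[OF H1_wpd(1)[OF uH[OF t]] v])
    qed
    have "AE t in lebesgue_on {0<..<T}. H1_norm \<Omega> (u t) \<le> B"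
      by (rule AE_timeI) (use norm_emb[OF uH] uU UB sub in \<open>auto simp: subset_iff\<close>)
    then show "\<exists>M. AE t in lebesgue_on {0<..<T}. H1_norm \<Omega> (u t) \<le> M" by (rule exI)
  qed
  have s2: "Linf_L2 T \<Omega> W"
    unfolding Linf_L2_def
  proof (intro conjI allI impI)
    show "AE t in lebesgue_on {0<..<T}. L2 \<Omega> (W t)" using WL by simp
    show "(\<lambda>t. LINT x|lebesgue_on \<Omega>. W t x * v x) \<in> borel_measurable (lebesgue_on {0<..<T})" if v: "L2 \<Omega> v" for v
      unfolding Wi[OF v] by (rule meas_w)
    have "L2_norm \<Omega> (W t) \<le> B" if "t \<in> {0<..<T}" for t
      unfolding L2_norm_cls_on[OF WL] unfolding W_def using that by (intro order_trans[OF norm_cls_on_rep wB]) auto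
    then have "AE t in lebesgue_on {0<..<T}. L2_norm \<Omega> (W t) \<le> B" by (rule AE_timeI)
    then show "\<exists>M. AE t in lebesgue_on {0<..<T}. L2_norm \<Omega> (W t) \<le> M" by (rule exI)
  qed
  have zb: "\<bar>z t v\<bar> \<le> (\<eta> * B + coef_max * B) * H1_norm \<Omega> v" if t: "t \<in> {0..T}" and v: "H1 \<Omega> v" for t v
  proof -
    have n: "norm (cls_on \<Omega> v) \<le> H1_norm \<Omega> v" "norm (snd (emb v)) \<le> H1_norm \<Omega> v"
      unfolding norm_emb[OF v, symmetric] using norm_fst_le[of "fst (emb v)" "snd (emb v)"] norm_snd_le[of "snd (emb v)" "fst (emb v)"]
      by (auto simp: emb_def)
    have "\<bar>w t \<bullet> cls_on \<Omega> v\<bar> \<le> B * H1_norm \<Omega> v"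
      using n wB[OF t] B0 by (intro order_trans[OF Cauchy_Schwarz_ineq2] mult_mono) auto
    then have "\<bar>\<eta> * (w t \<bullet> cls_on \<Omega> v)\<bar> \<le> \<eta> * (B * H1_norm \<Omega> v)" using \<eta> by (simp add: abs_mult)
    moreover have "\<bar>mulop (coefL (f t)) (snd (U t)) \<bullet> snd (emb v)\<bar> \<le> (coef_max * B) * H1_norm \<Omega> v"
      using n Mw t B0 M0_nonneg unfolding wintble_def by (intro order_trans[OF Cauchy_Schwarz_ineq2] mult_mono) auto
    ultimately show ?thesis unfolding zeq[OF t v] by (simp add: algebra_simps)
  qed
  have zm: "(\<lambda>t. - (\<eta> * (w t \<bullet> cls_on \<Omega> v) + mulop (coefL (f t)) (snd (U t)) \<bullet> snd (emb v))) integrable_on {0..T}" for v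
    using ww Mw unfolding wintble_def by (intro integrable_neg integrable_add integrable_on_mult_right) auto
  then have zi: "(\<lambda>t. z t v) integrable_on {0..T}" if v: "H1 \<Omega> v" for v
    by (rule integrable_eq) (use zeq v in auto)
  have s3: "Linf_H1dual T \<Omega> z"
    unfolding Linf_H1dual_def
  proof (intro conjI allI impI)
    show "AE t in lebesgue_on {0<..<T}. H1_dual \<Omega> (z t)"
    proof (rule AE_timeI)
      fix t assume "t \<in> {0<..<T}"
      then have t: "t \<in> {0..T}" by auto
      have "z t (\<lambda>x. a * v1 x + b * v2 x) = a * z t v1 + b * z t v2" if v: "H1 \<Omega> v1" "H1 \<Omega> v2" for v1 v2 a b
        unfolding zeq[OF t H1_lin[OF v]] zeq[OF t v(1)] zeq[OF t v(2)] emb_lin[OF v] cls_on_lin[OF H1_L2[OF v(1)] H1_L2[OF v(2)]]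
        by (simp add: inner_add_right algebra_simps)
      then show "H1_dual \<Omega> (z t)" unfolding H1_dual_def using zb[OF t] by blast
    qed
    show "(\<lambda>t. z t v) \<in> borel_measurable (lebesgue_on {0<..<T})" if "H1 \<Omega> v" for v
      by (rule integrable_on_measurable_time[OF zi[OF that]])
    have "AE t in lebesgue_on {0<..<T}. \<forall>v. H1 \<Omega> v \<longrightarrow> \<bar>z t v\<bar> \<le> (\<eta> * B + coef_max * B) * H1_norm \<Omega> v"
      by (rule AE_timeI) (use zb in auto)
    then show "\<exists>M. AE t in lebesgue_on {0<..<T}. \<forall>v. H1 \<Omega> v \<longrightarrow> \<bar>z t v\<bar> \<le> M * H1_norm \<Omega> v" by blast
  qed
  have s4: "weak_dt_init T (\<lambda>t. LINT x|lebesgue_on \<Omega>. u t x * v x) (\<lambda>t. LINT x|lebesgue_on \<Omega>. W t x * v x) (LINT x|lebesgue_on \<Omega>. u0 x * v x)"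
    if v: "L2 \<Omega> v" for v
    unfolding Wi[OF v] ui[OF v]
  proof (rule weak_dt_init_primitive[OF _ _ T(1), of _ "B * norm (cls_on \<Omega> v)"])
    show "(\<lambda>t. w t \<bullet> cls_on \<Omega> v) integrable_on {0..T}" using ww unfolding wintble_def by blast
    show "\<bar>w t \<bullet> cls_on \<Omega> v\<bar> \<le> B * norm (cls_on \<Omega> v)" if "t \<in> {0..T}" for t using wB[OF that] by (rule inner_le)
    show "f t \<bullet> cls_on \<Omega> v = (LINT x|lebesgue_on \<Omega>. u0 x * v x) + integral {0..t} (\<lambda>t. w t \<bullet> cls_on \<Omega> v)" if "t \<in> {0<..<T}" for t
      using f_inner[of t "cls_on \<Omega> v"] that cls_on_inner[OF H1_L2[OF u0] v] by simp
  qed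
  have s5: "weak_dt_init T (\<lambda>t. LINT x|lebesgue_on \<Omega>. W t x * v x) (\<lambda>t. z t v) 0" if v: "H1 \<Omega> v" for v
    unfolding Wi[OF H1_L2[OF v]]
  proof (rule weak_dt_init_primitive[OF zi[OF v] _ T(1)])
    show "\<bar>z t v\<bar> \<le> (\<eta> * B + coef_max * B) * H1_norm \<Omega> v" if "t \<in> {0..T}" for t by (rule zb[OF that v])
    fix t assume "t \<in> {0<..<T}"
    then have t: "t \<in> {0..T}" "0 \<le> t" "t \<le> T" by auto
    have i1: "(\<lambda>s. w s \<bullet> cls_on \<Omega> v) integrable_on {0..t}"
      using wintble_subinterval[OF ww, of 0 t] t unfolding wintble_def by auto
    have i2: "(\<lambda>s. mulop (coefL (f s)) (snd (U s)) \<bullet> snd (emb v)) integrable_on {0..t}"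
      using wintble_subinterval[OF Mw, of 0 t] t unfolding wintble_def by auto
    have "integral {0..t} (\<lambda>s. z s v) = integral {0..t} (\<lambda>s. - (\<eta> * (w s \<bullet> cls_on \<Omega> v) + mulop (coefL (f s)) (snd (U s)) \<bullet> snd (emb v)))"
      by (rule integral_cong) (use zeq v t in auto)
    also have "\<dots> = - (\<eta> * integral {0..t} (\<lambda>s. w s \<bullet> cls_on \<Omega> v) + integral {0..t} (\<lambda>s. mulop (coefL (f s)) (snd (U s)) \<bullet> snd (emb v)))"
      by (intro integral_unique has_integral_neg has_integral_add has_integral_mult_right integrable_integral i1 i2)
    also have "integral {0..t} (\<lambda>s. w s \<bullet> cls_on \<Omega> v) = (f t - cls_on \<Omega> u0) \<bullet> cls_on \<Omega> v"
      using f_inner[OF t(1), of "cls_on \<Omega> v"] by (simp add: inner_diff_left)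
    \<comment> \<open>The integrated equation \<open>eqn\<close>, with the integral of the velocity
      identified as the increment of \<open>f\<close>. The initial velocity is zero, so no constant
      appears.\<close>
    finally show "w t \<bullet> cls_on \<Omega> v = 0 + integral {0..t} (\<lambda>t. z t v)"
      using eqn[OF t(1) emb_in_V[OF v]] by (simp add: emb_def)
  qed
  have s6: "AE t in lebesgue_on {0<..<T}. \<forall>\<phi>. H1 \<Omega> \<phi> \<longrightarrow>
         z t \<phi> + (LINT x|lebesgue_on \<Omega>.
            \<eta> * W t x * \<phi> x + coef p \<epsilon> \<sigma> \<Omega> (u t) x * grad_dot \<Omega> (u t) \<phi> x) = 0"
    unfolding z_def by simp
  show ?thesis unfolding weak_solution_def using s1 s2 s3 s4 s5 s6 by blast
qed

text \<open>The bound is left free above a threshold so that two weak solutions can later be given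
  the same one, as the stability estimate requires.\<close>

lemma weak_solution_imp_approx_sol:
  assumes T: "0 < T" and u0: "L2 \<Omega> u0" and ws: "weak_solution \<Omega> p \<epsilon> \<sigma> \<eta> u0 T u"
  shows "\<exists>B0 f U W. (\<forall>B\<ge>B0. approx_sol 0 B T (cls_on \<Omega> u0) f U W) \<and>
     (AE t in lebesgue_on {0<..<T}. H1 \<Omega> (u t) \<and> (\<forall>v. L2 \<Omega> v \<longrightarrow> cls_on \<Omega> (u t) \<bullet> cls_on \<Omega> v = f t \<bullet> cls_on \<Omega> v))"
proof -
  obtain w z where s: "Linf_H1 T \<Omega> u" "Linf_L2 T \<Omega> w" "Linf_H1dual T \<Omega> z"
    and dt1: "\<And>v. L2 \<Omega> v \<Longrightarrow> weak_dt_init T (\<lambda>t. LINT x|lebesgue_on \<Omega>. u t x * v x)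
                        (\<lambda>t. LINT x|lebesgue_on \<Omega>. w t x * v x) (LINT x|lebesgue_on \<Omega>. u0 x * v x)"
    and dt2: "\<And>v. H1 \<Omega> v \<Longrightarrow> weak_dt_init T (\<lambda>t. LINT x|lebesgue_on \<Omega>. w t x * v x) (\<lambda>t. z t v) 0"
    and eq: "AE t in lebesgue_on {0<..<T}. \<forall>\<phi>. H1 \<Omega> \<phi> \<longrightarrow> z t \<phi> + (LINT x|lebesgue_on \<Omega>.
            \<eta> * w t x * \<phi> x + coef p \<epsilon> \<sigma> \<Omega> (u t) x * grad_dot \<Omega> (u t) \<phi> x) = 0"
    using ws unfolding weak_solution_def by auto
  obtain M1 where M1: "AE t in lebesgue_on {0<..<T}. H1_norm \<Omega> (u t) \<le> M1" using s(1) unfolding Linf_H1_def by blast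
  obtain M2 where M2: "AE t in lebesgue_on {0<..<T}. L2_norm \<Omega> (w t) \<le> M2" using s(2) unfolding Linf_L2_def by blast
  have mu: "(\<lambda>t. LINT x|lebesgue_on \<Omega>. u t x * v x) \<in> borel_measurable (lebesgue_on {0<..<T})"
    "(\<lambda>t. LINT x|lebesgue_on \<Omega>. wpd \<Omega> j (u t) x * v x) \<in> borel_measurable (lebesgue_on {0<..<T})"
    "(\<lambda>t. LINT x|lebesgue_on \<Omega>. w t x * v x) \<in> borel_measurable (lebesgue_on {0<..<T})" if "L2 \<Omega> v" for v j
    using s that unfolding Linf_H1_def Linf_L2_def by auto
  have mz: "(\<lambda>t. z t v) \<in> borel_measurable (lebesgue_on {0<..<T})" if "H1 \<Omega> v" for v
    using s(3) that unfolding Linf_H1dual_def by auto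
  have "AE t in lebesgue_on {0<..<T}. H1 \<Omega> (u t) \<and> H1_norm \<Omega> (u t) \<le> M1 \<and> L2 \<Omega> (w t) \<and> L2_norm \<Omega> (w t) \<le> M2 \<and>
     (\<forall>\<phi>. H1 \<Omega> \<phi> \<longrightarrow> z t \<phi> + (LINT x|lebesgue_on \<Omega>.
            \<eta> * w t x * \<phi> x + coef p \<epsilon> \<sigma> \<Omega> (u t) x * grad_dot \<Omega> (u t) \<phi> x) = 0)"
    using s M1 M2 eq unfolding Linf_H1_def Linf_L2_def by simp
  then obtain N where N: "N \<in> null_sets (lebesgue_on {0<..<T})"
    and good0: "\<And>t. t \<in> {0<..<T} \<Longrightarrow> t \<notin> N \<Longrightarrow> H1 \<Omega> (u t) \<and> H1_norm \<Omega> (u t) \<le> M1 \<and> L2 \<Omega> (w t) \<and> L2_norm \<Omega> (w t) \<le> M2 \<and>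
     (\<forall>\<phi>. H1 \<Omega> \<phi> \<longrightarrow> z t \<phi> + (LINT x|lebesgue_on \<Omega>.
            \<eta> * w t x * \<phi> x + coef p \<epsilon> \<sigma> \<Omega> (u t) x * grad_dot \<Omega> (u t) \<phi> x) = 0)"
    unfolding eventually_ae_filter by auto
  define good where "good t \<longleftrightarrow> t \<in> {0<..<T} \<and> t \<notin> N" for t
  have gu: "H1 \<Omega> (u t)" "H1_norm \<Omega> (u t) \<le> M1" "L2 \<Omega> (w t)" "L2_norm \<Omega> (w t) \<le> M2" if "good t" for t
    using good0 that unfolding good_def by auto
  have ge: "z t \<phi> + (LINT x|lebesgue_on \<Omega>.
            \<eta> * w t x * \<phi> x + coef p \<epsilon> \<sigma> \<Omega> (u t) x * grad_dot \<Omega> (u t) \<phi> x) = 0" if "good t" "H1 \<Omega> \<phi>" for t \<phi>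
    using good0 that unfolding good_def by blast
  have AEgood: "AE t in lebesgue_on {0<..<T}. good t"
    using AE_not_in[OF N] AE_space by eventually_elim (auto simp: good_def)
  \<comment> \<open>\<open>approx_sol\<close> constrains every time of the closed interval, the weak
    solution only almost every time. On the exceptional set zero is inserted, which lies in
    \<open>V\<close> and respects the bounds.\<close>
  define U where "U t = (if good t then emb (u t) else 0)" for t
  define W where "W t = (if good t then cls_on \<Omega> (w t) else 0)" for t
  define C where "C = \<bar>M1\<bar> + \<bar>M2\<bar>"
  have C0: "0 \<le> C" unfolding C_def by simp
  have UV: "U t \<in> V" for t unfolding U_def using emb_in_V gu(1) subspace_0[OF V_subspace] by auto
  have nU: "norm (U t) \<le> C" for t
    unfolding U_def C_def using gu(2)[of t] norm_emb[OF gu(1)[of t]] by auto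
  have nW: "norm (W t) \<le> C" for t
    unfolding W_def C_def using gu(4)[of t] L2_norm_cls_on[OF gu(3)[of t]] by auto
  have Nset: "{t \<in> space (lebesgue_on {0<..<T}). t \<in> N} \<in> sets (lebesgue_on {0<..<T})"
  proof -
    have "{t \<in> space (lebesgue_on {0<..<T}). t \<in> N} = N" using sets.sets_into_space[OF null_setsD2[OF N]] by auto
    then show ?thesis using N by auto
  qed
  have mU: "(\<lambda>t. U t \<bullet> y) \<in> borel_measurable (lebesgue_on {0<..<T})" for y
  proof -
    have "(\<lambda>t. if t \<in> N then 0 else (LINT x|lebesgue_on \<Omega>. u t x * rep (fst y) x) +
        (\<Sum>j\<in>UNIV. LINT x|lebesgue_on \<Omega>. wpd \<Omega> j (u t) x * rep (snd y $ j) x)) \<in> borel_measurable (lebesgue_on {0<..<T})"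
      by (intro measurable_If borel_measurable_add borel_measurable_sum mu L2_rep Nset) simp
    then show ?thesis
    proof (rule measurable_cong[THEN iffD1, rotated])
      fix t assume "t \<in> space (lebesgue_on {0<..<T})"
      then have t: "t \<in> {0<..<T}" by simp
      show "(if t \<in> N then 0 else (LINT x|lebesgue_on \<Omega>. u t x * rep (fst y) x) +
        (\<Sum>j\<in>UNIV. LINT x|lebesgue_on \<Omega>. wpd \<Omega> j (u t) x * rep (snd y $ j) x)) = U t \<bullet> y"
      proof (cases "t \<in> N")
        case False
        then have g: "good t" using t by (simp add: good_def)
        then show ?thesis using False unfolding U_def emb_def
          by (simp add: inner_prod_def inner_vec_def cls_on_rep_inner[OF H1_L2[OF gu(1)[OF g]]] cls_on_rep_inner[OF H1_wpd(1)[OF gu(1)[OF g]]])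
      qed (simp add: U_def good_def)
    qed
  qed
  have mW: "(\<lambda>t. W t \<bullet> y) \<in> borel_measurable (lebesgue_on {0<..<T})" for y
  proof -
    have "(\<lambda>t. if t \<in> N then 0 else (LINT x|lebesgue_on \<Omega>. w t x * rep y x)) \<in> borel_measurable (lebesgue_on {0<..<T})"
      by (intro measurable_If mu L2_rep Nset) simp
    then show ?thesis
    proof (rule measurable_cong[THEN iffD1, rotated])
      fix t assume "t \<in> space (lebesgue_on {0<..<T})"
      then have t: "t \<in> {0<..<T}" by simp
      show "(if t \<in> N then 0 else (LINT x|lebesgue_on \<Omega>. w t x * rep y x)) = W t \<bullet> y"
      proof (cases "t \<in> N")
        case False
        then have g: "good t" using t by (simp add: good_def)
        then show ?thesis using False unfolding W_def by (simp add: cls_on_rep_inner[OF gu(3)[OF g]])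
      qed (simp add: W_def good_def)
    qed
  qed
  have Uw: "wintble C 0 T U" unfolding wintble_def
  proof (intro conjI ballI allI nU)
    show "(\<lambda>t. U t \<bullet> h) integrable_on {0..T}" for h
      by (rule bounded_integrable_time(2)[OF mU]) (rule inner_le[OF nU])
  qed
  have Ww: "wintble C 0 T W" unfolding wintble_def
  proof (intro conjI ballI allI nW)
    show "(\<lambda>t. W t \<bullet> h) integrable_on {0..T}" for h
      by (rule bounded_integrable_time(2)[OF mW]) (rule inner_le[OF nW])
  qed
  have Wint: "(\<lambda>t. W t \<bullet> h) integrable_on {0..T}" for h using Ww unfolding wintble_def by blast
  \<comment> \<open>The continuous representative of the solution: a primitive of the velocity at
    every time. That it agrees with \<open>U\<close> for almost every time, when tested on \<Omega>,
    is derived next from the weak derivative.\<close>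
  define f where "f t = cls_on \<Omega> u0 + wint 0 t W" for t
  have f_inner: "f t \<bullet> h = cls_on \<Omega> u0 \<bullet> h + integral {0..t} (\<lambda>s. W s \<bullet> h)" if "t \<in> {0..T}" for t h
    unfolding f_def using wint_inner[OF wintble_subinterval[OF Ww]] that by (simp add: inner_add_left)
  have fc: "continuous_on {0..T} f"
    by (rule lipschitz_continuous_on, rule primitive_lipschitz[OF Ww]) (use f_inner in auto)
  define B0 where "B0 = C + norm (cls_on \<Omega> u0) + C * T"
  have fB: "norm (f t) \<le> B0" if t: "t \<in> {0..T}" for t
  proof -
    have "norm (wint 0 t W) \<le> C * (t - 0)" by (rule norm_wint[OF wintble_subinterval[OF Ww]]) (use t in auto)
    also have "\<dots> \<le> C * T" using t C0 by (intro mult_left_mono) auto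
    finally show ?thesis unfolding f_def B0_def using norm_triangle_ineq[of "cls_on \<Omega> u0" "wint 0 t W"] C0 by linarith
  qed
  have C_B0: "C \<le> B0" unfolding B0_def using C0 T by simp
  have prim: "AE t in lebesgue_on {0<..<T}. fst (U t) \<bullet> cls_on \<Omega> v = f t \<bullet> cls_on \<Omega> v" if v: "L2 \<Omega> v" for v
  proof -
    have mU': "(\<lambda>t. fst (U t) \<bullet> cls_on \<Omega> v) \<in> borel_measurable (lebesgue_on {0<..<T})"
      using mU[of "(cls_on \<Omega> v, 0)"] by (simp add: inner_prod_def)
    have "weak_dt_init T (\<lambda>t. fst (U t) \<bullet> cls_on \<Omega> v) (\<lambda>t. W t \<bullet> cls_on \<Omega> v) (LINT x|lebesgue_on \<Omega>. u0 x * v x)"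
    proof (rule weak_dt_init_cong[OF dt1[OF v] mu(1)[OF v] mU' mu(3)[OF v] mW])
      show "AE t in lebesgue_on {0<..<T}. (LINT x|lebesgue_on \<Omega>. u t x * v x) = fst (U t) \<bullet> cls_on \<Omega> v"
        using AEgood by eventually_elim (simp add: U_def emb_def cls_on_inner[OF H1_L2[OF gu(1)] v])
      show "AE t in lebesgue_on {0<..<T}. (LINT x|lebesgue_on \<Omega>. w t x * v x) = W t \<bullet> cls_on \<Omega> v"
        using AEgood by eventually_elim (simp add: W_def cls_on_inner[OF gu(3) v])
    qed
    then have "AE t in lebesgue_on {0<..<T}. fst (U t) \<bullet> cls_on \<Omega> v = (LINT x|lebesgue_on \<Omega>. u0 x * v x) + integral {0..t} (\<lambda>t. W t \<bullet> cls_on \<Omega> v)"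
    proof (rule weak_dt_init_imp_primitive[OF mU' _ Wint _ T, rotated 2])
      show "\<bar>fst (U t) \<bullet> cls_on \<Omega> v\<bar> \<le> C * norm (cls_on \<Omega> v)" for t
        by (rule inner_le) (use nU[of t] norm_fst_le[of "fst (U t)" "snd (U t)"] in simp)
      show "\<bar>W t \<bullet> cls_on \<Omega> v\<bar> \<le> C * norm (cls_on \<Omega> v)" for t by (rule inner_le[OF nW])
    qed
    then show ?thesis using AE_space
    proof eventually_elim
      case (elim t)
      then show ?case using f_inner[of t "cls_on \<Omega> v"] cls_on_inner[OF u0 v] by simp
    qed
  qed
  \<comment> \<open>Countably many test functions suffice, so one null set of times serves all of them.\<close>
  have all: "AE t in lebesgue_on {0<..<T}. \<forall>v. L2 \<Omega> v \<longrightarrow> fst (U t) \<bullet> cls_on \<Omega> v = f t \<bullet> cls_on \<Omega> v"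
  proof -
    have cnt: "countable ((rational_vectors :: (real^'n) set) \<times> (rational_vectors :: (real^'n) set))"
      by (intro countable_SIGMA countable_rational_vectors)
    have "AE t in lebesgue_on {0<..<T}. \<forall>q\<in>(rational_vectors :: (real^'n) set) \<times> rational_vectors.
        fst (U t) \<bullet> cls_on \<Omega> (indicator (box (fst q) (snd q))) = f t \<bullet> cls_on \<Omega> (indicator (box (fst q) (snd q)))"
      unfolding AE_ball_countable[OF cnt] using prim[OF L2_indicator_box] by blast
    then show ?thesis
    proof eventually_elim
      case (elim t)
      have "(fst (U t) - f t) \<bullet> cls_on \<Omega> v = 0" if "L2 \<Omega> v" for v
        by (rule weak_box_fundamental[OF _ that]) (use elim in \<open>auto simp: inner_diff_left\<close>)
      then show ?case by (simp add: inner_diff_left)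
    qed
  qed
  \<comment> \<open>The test vector \<open>h\<close> lives on the whole space, but
    \<open>all\<close> speaks of functions on \<Omega>. Neither \<open>f t\<close> nor
    \<open>fst (U t)\<close> distinguishes \<open>h\<close> from its restriction.\<close>
  have f_rep: "f t \<bullet> cls_on \<Omega> (rep h) = f t \<bullet> h" if "t \<in> {0..T}" for t h
  proof -
    have "W s \<bullet> cls_on \<Omega> (rep h) = W s \<bullet> h" for s unfolding W_def using cls_on_inner_rep[OF gu(3)] by auto
    then show ?thesis unfolding f_inner[OF that] cls_on_inner_rep[OF u0] by simp
  qed
  have U_rep: "fst (U t) \<bullet> cls_on \<Omega> (rep h) = fst (U t) \<bullet> h" for t h
    unfolding U_def emb_def using cls_on_inner_rep[OF H1_L2[OF gu(1)]] by auto
  have Mw: "wintble (coef_max * B0) 0 T (\<lambda>s. mulop (coefL (f s)) (snd (U s)))"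
  proof (rule wintble_M[OF wintble_snd fc fB])
    show "wintble B0 0 T U" using Uw C_B0 unfolding wintble_def by (meson order_trans)
  qed
  have sol: "approx_sol 0 B T (cls_on \<Omega> u0) f U W" if B: "B0 \<le> B" for B
    unfolding approx_sol_def
  proof (intro conjI ballI allI impI)
    show "U t \<in> V" for t by (rule UV)
    show "wintble B 0 T U" "wintble B 0 T W" using Uw Ww C_B0 B unfolding wintble_def by (meson order_trans)+
    show "norm (f t) \<le> B" if "t \<in> {0..T}" for t using fB[OF that] B by simp
    show "f t \<bullet> h = cls_on \<Omega> u0 \<bullet> h + integral {0..t} (\<lambda>s. W s \<bullet> h)" if "t \<in> {0..T}" for t h by (rule f_inner[OF that])
  next
    fix a b h assume ab: "0 \<le> a" "a \<le> b" "b \<le> T"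
    have "AE t in lebesgue_on {0<..<T}. (f t - fst (U t)) \<bullet> h = 0"
      using all AE_space
    proof eventually_elim
      case (elim t)
      then show ?case using f_rep[of t h] U_rep[of t h] L2_rep by (simp add: inner_diff_left)
    qed
    then show "\<bar>integral {a..b} (\<lambda>t. (f t - fst (U t)) \<bullet> h)\<bar> \<le> 0 * (b - a) * norm h"
      using integral_AE_zero ab by simp
  next
    fix a b \<phi> assume \<phi>: "\<phi> \<in> V" and ab: "0 \<le> a" "a \<le> b" "b \<le> T"
    define \<phi>0 where "\<phi>0 = rep (fst \<phi>)"
    have \<phi>0: "H1 \<Omega> \<phi>0" "emb \<phi>0 = \<phi>" unfolding \<phi>0_def using V_H1[OF \<phi>] by auto
    have f\<phi>: "fst \<phi> = cls_on \<Omega> \<phi>0" using \<phi>0(2) by (auto simp: emb_def)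
    \<comment> \<open>The value that the equation gives for the second derivative, with the
      coefficient taken at \<open>f t\<close> instead of \<open>u t\<close>; unlike \<open>z\<close>
      it is bounded and defined at every time.\<close>
    define y where "y t = - (\<eta> * (W t \<bullet> fst \<phi>) + mulop (coefL (f t)) (snd (U t)) \<bullet> snd \<phi>)" for t
    have i1: "(\<lambda>t. mulop (coefL (f t)) (snd (U t)) \<bullet> snd \<phi>) integrable_on {0..T}" using Mw unfolding wintble_def by blast
    have yi: "y integrable_on {0..T}" unfolding y_def
      by (intro integrable_neg integrable_add integrable_on_mult_right Wint i1)
    have yb: "\<bar>y t\<bar> \<le> \<eta> * (C * norm (fst \<phi>)) + coef_max * B0 * norm (snd \<phi>)" if "t \<in> {0..T}" for t
    proof -
      have "\<bar>\<eta> * (W t \<bullet> fst \<phi>)\<bar> \<le> \<eta> * (C * norm (fst \<phi>))"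
        using inner_le[OF nW, of t "fst \<phi>"] \<eta> by (simp add: abs_mult)
      moreover have "\<bar>mulop (coefL (f t)) (snd (U t)) \<bullet> snd \<phi>\<bar> \<le> coef_max * B0 * norm (snd \<phi>)"
        by (rule inner_le) (use Mw that in \<open>auto simp: wintble_def\<close>)
      ultimately show ?thesis unfolding y_def by linarith
    qed
    define K where "K = C * norm (fst \<phi>) + (\<eta> * (C * norm (fst \<phi>)) + coef_max * B0 * norm (snd \<phi>))"
    have Kp: "0 \<le> C * norm (fst \<phi>)" "0 \<le> \<eta> * (C * norm (fst \<phi>)) + coef_max * B0 * norm (snd \<phi>)"
      using C0 yb[of 0] T by auto
    have "weak_dt_init T (\<lambda>t. W t \<bullet> fst \<phi>) y 0"
    proof (rule weak_dt_init_cong[OF dt2[OF \<phi>0(1)] mu(3)[OF H1_L2[OF \<phi>0(1)]] mW mz[OF \<phi>0(1)] integrable_on_measurable_time[OF yi]])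
      show "AE t in lebesgue_on {0<..<T}. (LINT x|lebesgue_on \<Omega>. w t x * \<phi>0 x) = W t \<bullet> fst \<phi>"
        using AEgood by eventually_elim (simp add: W_def f\<phi> cls_on_inner[OF gu(3) H1_L2[OF \<phi>0(1)]])
      show "AE t in lebesgue_on {0<..<T}. z t \<phi>0 = y t"
        using AEgood all
      proof eventually_elim
        case (elim t)
        note g = elim(1)
        \<comment> \<open>Here the null set must not depend on the test function: the coefficient
          involves the kernels of all points \<open>x\<close> at once.\<close>
        have "coefL (f t) = coefL (cls_on \<Omega> (u t))" by (rule coefL_cong) (use elim in \<open>auto simp: U_def emb_def\<close>)
        then show ?case using ge[OF g \<phi>0(1)] unfolding form_eq[OF gu(1)[OF g] \<phi>0(1) gu(3)[OF g]] y_def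
          using g by (simp add: U_def W_def f\<phi> \<phi>0(2))
      qed
    qed
    then have "AE t in lebesgue_on {0<..<T}. W t \<bullet> fst \<phi> = 0 + integral {0..t} y"
    proof (rule weak_dt_init_imp_primitive[OF mW _ yi _ T, rotated 2])
      show "\<bar>W t \<bullet> fst \<phi>\<bar> \<le> K" for t unfolding K_def using inner_le[OF nW, of t "fst \<phi>"] Kp by linarith
      show "\<bar>y t\<bar> \<le> K" if "t \<in> {0..T}" for t unfolding K_def using yb[OF that] Kp by linarith
    qed
    then have "AE t in lebesgue_on {0<..<T}. W t \<bullet> fst \<phi> + \<eta> * ((f t - cls_on \<Omega> u0) \<bullet> fst \<phi>) +
            integral {0..t} (\<lambda>s. mulop (coefL (f s)) (snd (U s)) \<bullet> snd \<phi>) = 0"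
      using AE_space
    proof eventually_elim
      case (elim t)
      then have t: "t \<in> {0..T}" "0 \<le> t" "t \<le> T" by auto
      have j1: "(\<lambda>s. W s \<bullet> fst \<phi>) integrable_on {0..t}" using wintble_subinterval[OF Ww, of 0 t] t unfolding wintble_def by auto
      have j2: "(\<lambda>s. mulop (coefL (f s)) (snd (U s)) \<bullet> snd \<phi>) integrable_on {0..t}"
        using wintble_subinterval[OF Mw, of 0 t] t unfolding wintble_def by auto
      have "integral {0..t} y = - (\<eta> * integral {0..t} (\<lambda>s. W s \<bullet> fst \<phi>) + integral {0..t} (\<lambda>s. mulop (coefL (f s)) (snd (U s)) \<bullet> snd \<phi>))"
        unfolding y_def by (intro integral_unique has_integral_neg has_integral_add has_integral_mult_right integrable_integral j1 j2)
      also have "integral {0..t} (\<lambda>s. W s \<bullet> fst \<phi>) = (f t - cls_on \<Omega> u0) \<bullet> fst \<phi>"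
        using f_inner[OF t(1), of "fst \<phi>"] by (simp add: inner_diff_left)
      finally show ?case using elim(1) by simp
    qed
    then show "\<bar>integral {a..b} (\<lambda>t. W t \<bullet> fst \<phi> + \<eta> * ((f t - cls_on \<Omega> u0) \<bullet> fst \<phi>) +
            integral {0..t} (\<lambda>s. mulop (coefL (f s)) (snd (U s)) \<bullet> snd \<phi>))\<bar> \<le> 0 * (b - a) * norm \<phi>"
      using integral_AE_zero ab by simp
  qed
  have "AE t in lebesgue_on {0<..<T}. H1 \<Omega> (u t) \<and> (\<forall>v. L2 \<Omega> v \<longrightarrow> cls_on \<Omega> (u t) \<bullet> cls_on \<Omega> v = f t \<bullet> cls_on \<Omega> v)"
    using AEgood all by eventually_elim (auto simp: U_def emb_def gu(1))
  with sol show ?thesis by blast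
qed

theorem weak_solution_unique:
  assumes T: "0 < T" and u0: "L2 \<Omega> u0"
    and ws: "weak_solution \<Omega> p \<epsilon> \<sigma> \<eta> u0 T u1" "weak_solution \<Omega> p \<epsilon> \<sigma> \<eta> u0 T u2"
  shows "AE t in lebesgue_on {0<..<T}. AE x in lebesgue_on \<Omega>. u1 t x = u2 t x"
proof -
  obtain B1 f1 U1 W1 where 1: "\<And>B. B1 \<le> B \<Longrightarrow> approx_sol 0 B T (cls_on \<Omega> u0) f1 U1 W1"
     "AE t in lebesgue_on {0<..<T}. H1 \<Omega> (u1 t) \<and> (\<forall>v. L2 \<Omega> v \<longrightarrow> cls_on \<Omega> (u1 t) \<bullet> cls_on \<Omega> v = f1 t \<bullet> cls_on \<Omega> v)"
    using weak_solution_imp_approx_sol[OF T u0 ws(1)] by blast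
  obtain B2 f2 U2 W2 where 2: "\<And>B. B2 \<le> B \<Longrightarrow> approx_sol 0 B T (cls_on \<Omega> u0) f2 U2 W2"
     "AE t in lebesgue_on {0<..<T}. H1 \<Omega> (u2 t) \<and> (\<forall>v. L2 \<Omega> v \<longrightarrow> cls_on \<Omega> (u2 t) \<bullet> cls_on \<Omega> v = f2 t \<bullet> cls_on \<Omega> v)"
    using weak_solution_imp_approx_sol[OF T u0 ws(2)] by blast
  \<comment> \<open>Stability with residual zero; the larger of the two thresholds bounds both
    solutions.\<close>
  have f12: "f1 t = f2 t" if t: "0 \<le> t" "t \<le> T" for t
    using approx_sol_stable[OF 1(1) 2(1), of "max B1 B2" t] t by simp
  show ?thesis using 1(2) 2(2) AE_space
  proof eventually_elim
    case (elim t)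
    have L: "L2 \<Omega> (u1 t)" "L2 \<Omega> (u2 t)" using elim H1_L2 by auto
    define D where "D = cls_on \<Omega> (u1 t) - cls_on \<Omega> (u2 t)"
    have "D \<bullet> cls_on \<Omega> v = 0" if "L2 \<Omega> v" for v
      using elim that f12[of t] unfolding D_def by (simp add: inner_diff_left)
    then have "D \<bullet> D = 0" using L unfolding D_def by (simp add: inner_diff_right)
    then have "cls_on \<Omega> (u1 t) = cls_on \<Omega> (u2 t)" unfolding D_def by simp
    then show ?case using cls_on_eq_iff[OF L] by simp
  qed
qed

end

theorem mainTheorem2:
  fixes \<Omega> :: "(real^'n::finite) set" and p \<epsilon> \<sigma> \<eta> :: real
  assumes "CARD('n) = 2 \<or> CARD('n) = 3"
    and "bounded_domain \<Omega>" and "ae_C2_boundary \<Omega>"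
    and "1 \<le> p" and "p \<le> 2" and "\<epsilon> > 0" and "\<sigma> > 0" and "\<eta> > 0"
  shows "\<exists>T0 :: real \<Rightarrow> real. (\<forall>r. T0 r > 0) \<and>
    (\<forall>u0 T. H2 \<Omega> u0 \<longrightarrow> 0 < T \<longrightarrow> T < T0 (H1_norm \<Omega> u0) \<longrightarrow>
       (\<exists>u. weak_solution \<Omega> p \<epsilon> \<sigma> \<eta> u0 T u) \<and>
       (\<forall>u1 u2. weak_solution \<Omega> p \<epsilon> \<sigma> \<eta> u0 T u1 \<longrightarrow> weak_solution \<Omega> p \<epsilon> \<sigma> \<eta> u0 T u2 \<longrightarrow>
          (AE t in lebesgue_on {0<..<T}. AE x in lebesgue_on \<Omega>. u1 t x = u2 t x)))"
proof -
  interpret problem \<Omega> p \<epsilon> \<sigma> \<eta>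
    using assms unfolding bounded_domain_def by unfold_locales auto
  show ?thesis
  \<comment> \<open>The life span is a function of the norm bound alone, so the existence time
    depends on the initial datum only through its H1 norm.\<close>
  proof (intro exI[of _ life] conjI allI impI)
    show "0 < life r" for r by (rule life_pos)
    fix u0 T assume u0: "H2 \<Omega> u0" and T: "0 < T" "T < life (H1_norm \<Omega> u0)"
    have H: "H1 \<Omega> u0" using u0 unfolding H2_def by blast
    show "\<exists>u. weak_solution \<Omega> p \<epsilon> \<sigma> \<eta> u0 T u" by (rule weak_solution_exists[OF H T])
    show "AE t in lebesgue_on {0<..<T}. AE x in lebesgue_on \<Omega>. u1 t x = u2 t x"
      if "weak_solution \<Omega> p \<epsilon> \<sigma> \<eta> u0 T u1" "weak_solution \<Omega> p \<epsilon> \<sigma> \<eta> u0 T u2" for u1 u2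
      by (rule weak_solution_unique[OF T(1) H1_L2[OF H] that])
  qed
qed

end
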